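(* For each $n\ge1$ let $u=u_n$ be the odometer of the oil and water process on $\mathbb{Z}$ started from $n$ oil and $n$ water particles at the origin, and let $\tilde u(x)=\mathbb{E}\,u(x)$. Assume that both of the following hold: (i) for every $\delta>0$, $$\mathbb{P}\left(\sup_{x\in\mathbb{Z}}\left|\frac{u(x)-\tilde u(x)}{n^{4/3}}\right|>\delta\right)\to 0\quad\text{as } n\to\infty;$$ (ii) there is a function $w:\mathbb{R}\to\mathbb{R}$ such that $$\frac{\tilde u(\lfloor n^{1/3}\xi\rfloor)}{n^{4/3}}\to w(\xi)\quad\text{as } n\to\infty,$$ uniformly in $\xi\in\mathbb{R}$. Then $$w(x)=\begin{cases}\frac{1}{72\pi}\left((18\pi)^{1/3}-|x|\right)^4, & |x|<(18\pi)^{1/3},\\ 0, & |x|\ge (18\pi)^{1/3}.\end{cases}$$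
   Context: Oil and water process. Fix an integer $n\ge 1$ and let $(X^x_k, Y^x_k)_{x\in\mathbb{Z}, k\ge 1}$ be independent random variables, each uniform on $\{+1,-1\}$. For $x\in\mathbb{Z}$ and $t=0,1,2,\dots$ let $\eta_1(x,t)$ and $\eta_2(x,t)$ be the numbers of oil and water particles at $x$ at time $t$. Initially there are $n$ oil and $n$ water particles at the origin and none elsewhere. At time $t$, if some site $x$ has $\min(\eta_1(x,t),\eta_2(x,t))\ge 1$, let $x_t$ be the leftmost (smallest) such site; $x_t$ fires: if this is the $k$-th firing of $x_t$, one oil particle moves from $x_t$ to $x_t+X^{x_t}_k$ and one water particle moves from $x_t$ to $x_t+Y^{x_t}_k$, giving the configuration at time $t+1$. If there is no such site, the process has stopped; let $\tau$ be the first time at which this happens ($\tau$ is almost surely finite, with finite expectation). (The number of firings at each site does not depend on the order in which legal firings are performed; the leftmost rule is a convention.) The odometer is the random function $u(x)=\#\{0\le t<\tau : x_t=x\}$, the total number of times $x$ fires. *)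

theory Defs
  imports "HOL-Probability.Probability"
begin

text \<open>
  The process is defined pathwise, as a function of the number \<open>n\<close> of initial pairs
  and of two deterministic stacks \<open>X\<close>, \<open>Y\<close> of instructions: \<open>X x k\<close> and \<open>Y x k\<close> are the
  displacements of the oil and of the water particle in the \<open>k\<close>-th firing of \<open>x\<close>.
  Stacks are indexed from \<open>k = 1\<close>; the entries at \<open>k = 0\<close> are never used.
\<close>

type_synonym stack = "int \<Rightarrow> nat \<Rightarrow> int"

record ow_state =
  oil :: "int \<Rightarrow> nat"
  water :: "int \<Rightarrow> nat"
  fired :: "int \<Rightarrow> nat"

definition can_fire :: "ow_state \<Rightarrow> int \<Rightarrow> bool" where
  "can_fire s x \<longleftrightarrow> min (oil s x) (water s x) \<ge> 1"

definition stopped :: "ow_state \<Rightarrow> bool" where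
  "stopped s \<longleftrightarrow> \<not> (\<exists>x. can_fire s x)"

definition leftmost :: "ow_state \<Rightarrow> int" where
  "leftmost s = (LEAST x. can_fire s x)"

definition move_particle :: "int \<Rightarrow> int \<Rightarrow> (int \<Rightarrow> nat) \<Rightarrow> int \<Rightarrow> nat" where
  "move_particle x y \<eta> = (let \<eta>' = \<eta>(x := \<eta> x - 1) in \<eta>'(y := \<eta>' y + 1))"

definition fire :: "stack \<Rightarrow> stack \<Rightarrow> int \<Rightarrow> ow_state \<Rightarrow> ow_state" where
  "fire X Y x s =
    (let k = fired s x + 1 in
      \<lparr>oil = move_particle x (x + X x k) (oil s),
       water = move_particle x (x + Y x k) (water s),
       fired = (fired s)(x := k)\<rparr>)"

primrec ow_process :: "nat \<Rightarrow> stack \<Rightarrow> stack \<Rightarrow> nat \<Rightarrow> ow_state" where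
  "ow_process n X Y 0 =
    \<lparr>oil = (\<lambda>x. if x = 0 then n else 0),
     water = (\<lambda>x. if x = 0 then n else 0),
     fired = (\<lambda>x. 0)\<rparr>"
| "ow_process n X Y (Suc t) =
    (let s = ow_process n X Y t in
      if stopped s then s else fire X Y (leftmost s) s)"

definition firing_site :: "nat \<Rightarrow> stack \<Rightarrow> stack \<Rightarrow> nat \<Rightarrow> int" where
  "firing_site n X Y t = leftmost (ow_process n X Y t)"

text \<open>The stopping time is \<open>\<infinity>\<close> (the infimum of the empty set) if the process never stops.\<close>

definition stop_time :: "nat \<Rightarrow> stack \<Rightarrow> stack \<Rightarrow> enat" where
  "stop_time n X Y = (INF t \<in> {t. stopped (ow_process n X Y t)}. enat t)"

text \<open>
  \<open>card\<close> makes the odometer \<open>0\<close> at a site that fires infinitely often; for random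
  stacks as below the stopping time is almost surely finite, so this is a null event.
\<close>

definition odometer :: "nat \<Rightarrow> stack \<Rightarrow> stack \<Rightarrow> int \<Rightarrow> nat" where
  "odometer n X Y x = card {t. enat t < stop_time n X Y \<and> firing_site n X Y t = x}"

text \<open>All \<open>X x k\<close> and \<open>Y x k\<close> with \<open>k \<ge> 1\<close> are jointly independent; the two families
  are joined into one by indexing over a disjoint sum.\<close>

definition random_stacks ::
  "'a measure \<Rightarrow> (int \<Rightarrow> nat \<Rightarrow> 'a \<Rightarrow> int) \<Rightarrow> (int \<Rightarrow> nat \<Rightarrow> 'a \<Rightarrow> int) \<Rightarrow> bool" where
  "random_stacks M X Y \<longleftrightarrow>
    prob_space M \<and>
    prob_space.indep_vars M (\<lambda>_. count_space UNIV)
      (case_sum (\<lambda>(x, k). X x k) (\<lambda>(x, k). Y x k))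
      ((UNIV \<times> {1..}) <+> (UNIV \<times> {1..})) \<and>
    (\<forall>x. \<forall>k\<ge>1.
      distr M (count_space UNIV) (X x k) = measure_pmf (pmf_of_set {1, -1}) \<and>
      distr M (count_space UNIV) (Y x k) = measure_pmf (pmf_of_set {1, -1}))"

definition random_odometer ::
  "nat \<Rightarrow> (int \<Rightarrow> nat \<Rightarrow> 'a \<Rightarrow> int) \<Rightarrow> (int \<Rightarrow> nat \<Rightarrow> 'a \<Rightarrow> int) \<Rightarrow> int \<Rightarrow> 'a \<Rightarrow> real" where
  "random_odometer n X Y x \<omega> =
    real (odometer n (\<lambda>z k. X z k \<omega>) (\<lambda>z k. Y z k \<omega>) x)"

definition mean_odometer ::
  "'a measure \<Rightarrow> nat \<Rightarrow> (int \<Rightarrow> nat \<Rightarrow> 'a \<Rightarrow> int) \<Rightarrow> (int \<Rightarrow> nat \<Rightarrow> 'a \<Rightarrow> int) \<Rightarrow> int \<Rightarrow> real" where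
  "mean_odometer M n X Y x = (\<integral>\<omega>. random_odometer n X Y x \<omega> \<partial>M)"

end

theory Submission
  imports Defs "HOL-Real_Asymp.Real_Asymp"
begin

text \<open>
  Stop the process and let \<open>S\<^sub>X\<close>, \<open>S\<^sub>Y\<close> be the partial sums of the two stacks of a site up to its
  odometer. Counting particles, the final total \<open>\<eta>\<^sub>1 + \<eta>\<^sub>2\<close> at a site is
  \<open>2 n \<delta>\<^sub>0 + \<Delta>u\<close> plus half a discrete derivative of \<open>S\<^sub>X + S\<^sub>Y\<close>, while \<open>\<eta>\<^sub>1 - \<eta>\<^sub>2\<close> is
  half the difference of \<open>S\<^sub>X - S\<^sub>Y\<close> between the two neighbours. As no site holds both types,
  \<open>\<eta>\<^sub>1 + \<eta>\<^sub>2 = \<bar>\<eta>\<^sub>1 - \<eta>\<^sub>2\<bar>\<close>. Since \<open>u\<close> is close to \<open>n\<^bsup>4/3\<^esup> w\<close>, a maximal inequality lets us replace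
  the random odometer in \<open>S\<^sub>X - S\<^sub>Y\<close> by a deterministic one, and then the mean of the right-hand side
  is that of a simple random walk, about \<open>n\<^bsup>2/3\<^esup> \<surd>(2 w / \<pi>)\<close> by Wallis' product. The term
  \<open>S\<^sub>X + S\<^sub>Y\<close> is of lower order after testing against ramps and tents. Ramps show that \<open>w\<close> is Lipschitz,
  and tents give \<open>w'' = \<surd>(2 w / \<pi>) - 2 \<delta>\<^sub>0\<close> in integrated form. On each half-line the energy of
  this equation vanishes, so \<open>w\<^bsup>1/4\<^esup>\<close> is linear until it reaches \<open>0\<close>; continuity and the jump of \<open>w'\<close>
  at \<open>0\<close> fix the constants.
\<close>

section \<open>The process driven by a list of moves\<close>

text \<open>With \<open>N = n powr (1 / 3)\<close>, sites have scale \<open>N\<close>, odometers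
  \<open>N ^ 4\<close> and stack sums \<open>N ^ 2\<close>. Against a tent of height and width of
  order \<open>N\<close>, the source and the absolute differences have order \<open>N ^ 4\<close>,
  while the sums S_X + S_Y meet only its bounded gradient and give \<open>N ^ 3\<close>. The
  obstacle is that the odometer depends on the very stacks it indexes. Uncertainty
  \<open>\<delta> * N ^ 4\<close> in the index costs order \<open>sqrt \<delta> * N ^ 2\<close> per
  site, comparable to the main term, so \<delta> tends to 0 only after \<open>n\<close> tends to
  infinity. Concentration holds in probability only; second moments at the deterministic profile
  absorb the exceptional event. Two neighbours together give a walk of about \<open>4 * u\<close>
  steps; half its mean absolute value is about \<open>sqrt (2 * u / pi)\<close>. The square root is
  not Lipschitz at 0, so the limit equation has several solutions from zero data; a bounded
  derivative and \<open>w \<ge> 0\<close> select the right one. Setting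
  \<open>w = V / (72 * pi)\<close> gives \<open>V'' = 12 * sqrt V\<close>, solved by
  \<open>(a - x) ^ 4\<close>, and the slope jump -2 at 0 forces
  \<open>a ^ 3 = 18 * pi\<close>.\<close>

lemma of_nat_move_particle:
  assumes "\<eta> x \<ge> 1"
  shows "real (move_particle x y \<eta> z) = real (\<eta> z) - of_bool (z = x) + of_bool (z = y)"
  using assms by (auto simp: move_particle_def Let_def)

lemma sum_move_particle:
  fixes \<phi> :: "int \<Rightarrow> real"
  assumes "finite A" "x \<in> A" "y \<in> A" "\<eta> x \<ge> 1"
  shows "(\<Sum>z\<in>A. \<phi> z * real (move_particle x y \<eta> z)) = (\<Sum>z\<in>A. \<phi> z * real (\<eta> z)) - \<phi> x + \<phi> y"
proof -
  have "(\<Sum>z\<in>A. \<phi> z * real (move_particle x y \<eta> z))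
      = (\<Sum>z\<in>A. \<phi> z * real (\<eta> z) - \<phi> z * of_bool (z = x) + \<phi> z * of_bool (z = y))"
    by (intro sum.cong refl) (simp only: of_nat_move_particle[where \<eta> = \<eta> and x = x, OF assms(4)] algebra_simps)
  also have "\<dots> = (\<Sum>z\<in>A. \<phi> z * real (\<eta> z)) - \<phi> x + \<phi> y"
    using assms by (simp add: sum.distrib sum_subtractf)
  finally show ?thesis .
qed

definition sign_stack :: "stack \<Rightarrow> bool" where
  "sign_stack X \<longleftrightarrow> (\<forall>x. \<forall>k\<ge>1. X x k \<in> {1, -1})"

definition stack_sum :: "stack \<Rightarrow> int \<Rightarrow> nat \<Rightarrow> int" where
  "stack_sum X x m = (\<Sum>k=1..m. X x k)"

definition initial_state :: "nat \<Rightarrow> ow_state" where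
  "initial_state n = \<lparr>oil = (\<lambda>x. if x = 0 then n else 0),
     water = (\<lambda>x. if x = 0 then n else 0), fired = (\<lambda>x. 0)\<rparr>"

text \<open>One step of the process with the two displacements given in advance instead of read from
  the stacks. Lists of such pairs are countable, and over \<open>{1, -1}\<close> there are finitely
  many of each length, which reduces measurability and termination to statements about lists. The
  counter \<open>fired\<close> is kept so that a run still knows which stack entry each move would
  use.\<close>

definition advance :: "int \<times> int \<Rightarrow> ow_state \<Rightarrow> ow_state" where
  "advance p s = (if stopped s then s else let x = leftmost s in
     \<lparr>oil = move_particle x (x + fst p) (oil s), water = move_particle x (x + snd p) (water s),
      fired = (fired s)(x := fired s x + 1)\<rparr>)"

definition run :: "nat \<Rightarrow> (int \<times> int) list \<Rightarrow> ow_state" where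
  "run n ps = fold advance ps (initial_state n)"

definition next_move :: "stack \<Rightarrow> stack \<Rightarrow> ow_state \<Rightarrow> int \<times> int" where
  "next_move X Y s = (let x = leftmost s; k = fired s x + 1 in (X x k, Y x k))"

primrec moves :: "nat \<Rightarrow> stack \<Rightarrow> stack \<Rightarrow> nat \<Rightarrow> (int \<times> int) list" where
  "moves n X Y 0 = []"
| "moves n X Y (Suc t) = moves n X Y t @ [next_move X Y (run n (moves n X Y t))]"

lemma length_moves [simp]: "length (moves n X Y t) = t"
  by (induction t) auto

lemma run_Nil [simp]: "run n [] = initial_state n"
  by (simp add: run_def)

lemma run_snoc [simp]: "run n (ps @ [p]) = advance p (run n ps)"
  by (simp add: run_def)

lemma ow_process_Suc:
  "ow_process n X Y (Suc t) = advance (next_move X Y (ow_process n X Y t)) (ow_process n X Y t)"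
  by (simp add: advance_def next_move_def fire_def Let_def)

lemma ow_process_eq_run: "ow_process n X Y t = run n (moves n X Y t)"
  by (induction t) (simp_all add: initial_state_def ow_process_Suc del: ow_process.simps(2))

lemma sign_stackD: "sign_stack X \<Longrightarrow> X x (Suc k) \<in> {1, -1}"
  by (simp add: sign_stack_def)

lemma set_moves_subset:
  assumes "sign_stack X" "sign_stack Y"
  shows "set (moves n X Y t) \<subseteq> {1, -1} \<times> {1, -1}"
  proof (induction t)
  case (Suc t)
  have "next_move X Y s \<in> {1, -1} \<times> {1, -1}" for s
    using assms[THEN sign_stackD] unfolding next_move_def Let_def Suc_eq_plus1[symmetric] by blast
  with Suc show ?case by simp
qed simp

definition supported :: "nat \<Rightarrow> ow_state \<Rightarrow> bool" where
  "supported r s \<longleftrightarrow> (\<forall>x. int r < \<bar>x\<bar> \<longrightarrow> oil s x = 0 \<and> water s x = 0)"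

text \<open>\<open>LEAST\<close> on \<open>int\<close> is meaningful only for sets bounded below;
  the finite support supplies this and lets \<open>leftmost\<close> be read as a
  \<open>Min\<close>.\<close>

lemma leftmost_active:
  assumes "supported r s" "\<not> stopped s"
  shows "oil s (leftmost s) \<ge> 1" "water s (leftmost s) \<ge> 1" "\<bar>leftmost s\<bar> \<le> int r"
proof -
  have sub: "{x. can_fire s x} \<subseteq> {- int r..int r}"
  proof
    fix x assume "x \<in> {x. can_fire s x}"
    hence "oil s x \<noteq> 0" by (auto simp: can_fire_def)
    hence "\<not> int r < \<bar>x\<bar>" using assms(1) by (auto simp: supported_def)
    thus "x \<in> {- int r..int r}" by auto
  qed
  hence fin: "finite {x. can_fire s x}" by (rule finite_subset) auto
  have ne: "{x. can_fire s x} \<noteq> {}" using assms(2) by (auto simp: stopped_def)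
  have "leftmost s = Min {x. can_fire s x}"
    unfolding leftmost_def using fin ne by (metis Least_Min mem_Collect_eq empty_Collect_eq)
  hence "leftmost s \<in> {x. can_fire s x}" using Min_in[OF fin ne] by simp
  moreover from this have "leftmost s \<in> {- int r..int r}" using sub by blast
  ultimately show "oil s (leftmost s) \<ge> 1" "water s (leftmost s) \<ge> 1" "\<bar>leftmost s\<bar> \<le> int r"
    by (auto simp: can_fire_def)
qed

lemma supported_advance:
  assumes "supported r s" "p \<in> {1, -1} \<times> {1, -1}"
  shows "supported (Suc r) (advance p s)"
proof (cases "stopped s")
  case True
  then show ?thesis using assms by (auto simp: advance_def supported_def)
next
  case False
  note L = leftmost_active[OF assms(1) False]
  show ?thesis
    using assms L(3) False
    by (auto simp: advance_def supported_def Let_def move_particle_def)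
qed

lemma supported_run:
  "set ps \<subseteq> {1, -1} \<times> {1, -1} \<Longrightarrow> supported (length ps) (run n ps)"
proof (induction ps rule: rev_induct)
  case Nil
  then show ?case by (auto simp: supported_def initial_state_def)
next
  case (snoc p ps)
  then show ?case using supported_advance[of "length ps" "run n ps" p] by simp
qed

lemma supported_ow_process:
  "sign_stack X \<Longrightarrow> sign_stack Y \<Longrightarrow> supported t (ow_process n X Y t)"
  using supported_run[OF set_moves_subset] by (simp add: ow_process_eq_run)

lemma ow_process_active:
  assumes "\<not> stopped (ow_process n X Y t)"
  shows "ow_process n X Y (Suc t) = fire X Y (firing_site n X Y t) (ow_process n X Y t)"
  using assms by (simp add: firing_site_def Let_def)

section \<open>Discrete Green identities for the particle counts\<close>

lemma stack_sum_Suc: "stack_sum X x (Suc m) = stack_sum X x m + X x (Suc m)"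
  by (simp add: stack_sum_def)

lemma stack_sum_0 [simp]: "stack_sum X x 0 = 0"
  by (simp add: stack_sum_def)

lemma weighted_sum_fired_upd:
  fixes a b :: "int \<Rightarrow> real"
  assumes "x \<in> A" "finite A"
  shows "(\<Sum>y\<in>A. a y * real ((f(x := Suc (f x))) y) + b y * real_of_int (stack_sum X y ((f(x := Suc (f x))) y)))
    = (\<Sum>y\<in>A. a y * real (f y) + b y * real_of_int (stack_sum X y (f y))) + a x + b x * real_of_int (X x (Suc (f x)))"
proof -
  have "(\<Sum>y\<in>A. a y * real ((f(x := Suc (f x))) y) + b y * real_of_int (stack_sum X y ((f(x := Suc (f x))) y)))
    = (\<Sum>y\<in>A. (a y * real (f y) + b y * real_of_int (stack_sum X y (f y)))
         + (a x + b x * real_of_int (X x (Suc (f x)))) * of_bool (y = x))"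
    by (intro sum.cong refl) (auto simp: stack_sum_Suc algebra_simps)
  thus ?thesis using assms by (simp add: sum.distrib)
qed

text \<open>For a step \<open>e\<close> in \<open>{1, -1}\<close>,
  \<open>2 * (\<phi> (x + e) - \<phi> x)\<close> is the discrete Laplacian of \<phi> at
  \<open>x\<close> plus \<open>e\<close> times \<open>\<phi> (x + 1) - \<phi> (x - 1)\<close>;
  adding this over all firings gives both identities. The condition \<open>t < r\<close> keeps every
  source and target of a move inside the window, so no boundary terms arise.\<close>

lemma test_function_identity:
  fixes \<phi> :: "int \<Rightarrow> real" and n t r :: nat and X Y :: stack
  assumes X: "sign_stack X" and Y: "sign_stack Y" and "t < r"
  defines "s \<equiv> ow_process n X Y t"
  shows "2 * (\<Sum>y=-int r..int r. \<phi> y * real (oil s y)) = 2 * real n * \<phi> 0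
      + (\<Sum>y=-int r..int r. (\<phi> (y + 1) + \<phi> (y - 1) - 2 * \<phi> y) * real (fired s y)
          + (\<phi> (y + 1) - \<phi> (y - 1)) * real_of_int (stack_sum X y (fired s y)))" (is ?thO)
    and "2 * (\<Sum>y=-int r..int r. \<phi> y * real (water s y)) = 2 * real n * \<phi> 0
      + (\<Sum>y=-int r..int r. (\<phi> (y + 1) + \<phi> (y - 1) - 2 * \<phi> y) * real (fired s y)
          + (\<phi> (y + 1) - \<phi> (y - 1)) * real_of_int (stack_sum Y y (fired s y)))" (is ?thW)
proof -
  have "?thO \<and> ?thW" unfolding s_def using \<open>t < r\<close>
  proof (induction t)
    case 0
    have "(\<Sum>y=-int r..int r. \<phi> y * real (if y = 0 then n else 0)) = real n * \<phi> 0"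
      by (simp add: if_distrib[of real] if_distrib[of "(*) _"] cong: if_cong)
    then show ?case by simp
  next
    case (Suc t)
    define s where "s = ow_process n X Y t"
    define x where "x = firing_site n X Y t"
    show ?case
    proof (cases "stopped s")
      case True
      then show ?thesis using Suc by (simp add: s_def)
    next
      case False
      have w: "supported t s" unfolding s_def by (rule supported_ow_process[OF X Y])
      note L = leftmost_active[OF w False, folded firing_site_def]
      have xl: "leftmost s = x" by (simp add: x_def s_def firing_site_def)
      have s': "ow_process n X Y (Suc t) = fire X Y x s"
        using ow_process_active[of n X Y t] False unfolding s_def x_def by blast
      have PX: "X x (Suc (fired s x)) \<in> {1, -1}" "Y x (Suc (fired s x)) \<in> {1, -1}"
        using X Y by (auto simp: sign_stack_def)
      have "\<bar>x\<bar> \<le> int t" "oil s x \<ge> 1" "water s x \<ge> 1" using L xl by auto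
      moreover have r: "int t + 1 < int r" using Suc.prems by simp
      ultimately have mem: "x \<in> {-int r..int r}" "x + X x (Suc (fired s x)) \<in> {-int r..int r}"
         "x + Y x (Suc (fired s x)) \<in> {-int r..int r}"
        using PX by auto
      note IH = Suc.IH[OF Suc_lessD[OF Suc.prems], folded s_def]
      have simps: "oil (fire X Y x s) = move_particle x (x + X x (Suc (fired s x))) (oil s)"
        "water (fire X Y x s) = move_particle x (x + Y x (Suc (fired s x))) (water s)"
        "fired (fire X Y x s) = (fired s)(x := Suc (fired s x))"
        by (simp_all add: fire_def Let_def)
      show ?thesis
        unfolding s' simps weighted_sum_fired_upd[OF mem(1) finite_atLeastAtMost_int, where f = "fired s"]
          sum_move_particle[OF finite_atLeastAtMost_int mem(1) mem(2), of "oil s", OF \<open>oil s x \<ge> 1\<close>]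
          sum_move_particle[OF finite_atLeastAtMost_int mem(1) mem(3), of "water s", OF \<open>water s x \<ge> 1\<close>]
        using IH PX by (auto simp: algebra_simps)
    qed
  qed
  thus ?thO ?thW by auto
qed

lemma test_function_identity_total:
  fixes \<phi> :: "int \<Rightarrow> real" and n t r :: nat and X Y :: stack
  assumes X: "sign_stack X" and Y: "sign_stack Y" and "t < r"
  defines "s \<equiv> ow_process n X Y t"
  shows "(\<Sum>y=-int r..int r. \<phi> y * (real (oil s y) + real (water s y))) = 2 * real n * \<phi> 0
      + (\<Sum>y=-int r..int r. (\<phi> (y + 1) + \<phi> (y - 1) - 2 * \<phi> y) * real (fired s y))
      + (\<Sum>y=-int r..int r. (\<phi> (y + 1) - \<phi> (y - 1)) *
          (real_of_int (stack_sum X y (fired s y)) + real_of_int (stack_sum Y y (fired s y)))) / 2"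
proof -
  have "2 * x = a + (b + c) \<Longrightarrow> 2 * y = a + (b + d) \<Longrightarrow> x + y = a + b + (c + d) / 2" for x y a b c d :: real
    by algebra
  from this[OF test_function_identity[OF X Y \<open>t < r\<close>, where n = n and \<phi> = \<phi>, unfolded sum.distrib]]
  show ?thesis unfolding s_def[symmetric] sum.distrib distrib_left .
qed

lemma total_mass:
  assumes X: "sign_stack X" and Y: "sign_stack Y" and "t < r"
  shows "(\<Sum>y=-int r..int r. real (oil (ow_process n X Y t) y) + real (water (ow_process n X Y t) y)) = 2 * real n"
  using test_function_identity_total[OF X Y \<open>t < r\<close>, where n = n and \<phi> = "\<lambda>_. 1"] by simp

text \<open>Subtracting the two test identities for the indicator of \<open>z\<close> cancels the
  initial mass and the Laplacian term, since both types start equal and fire together. What is left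
  is the gradient of an indicator, which sees only the two neighbours of \<open>z\<close>.\<close>

lemma oil_minus_water:
  fixes n t :: nat and X Y :: stack
  assumes X: "sign_stack X" and Y: "sign_stack Y"
  defines "s \<equiv> ow_process n X Y t"
  shows "2 * (real (oil s z) - real (water s z)) =
      (real_of_int (stack_sum X (z - 1) (fired s (z - 1))) - real_of_int (stack_sum Y (z - 1) (fired s (z - 1))))
    - (real_of_int (stack_sum X (z + 1) (fired s (z + 1))) - real_of_int (stack_sum Y (z + 1) (fired s (z + 1))))"
proof -
  define r where "r = Suc (Suc (t + nat \<bar>z\<bar>))"
  define \<phi> :: "int \<Rightarrow> real" where "\<phi> = (\<lambda>y. of_bool (y = z))"
  have "t < r" by (simp add: r_def)
  have mem: "z \<in> {-int r..int r}" "z - 1 \<in> {-int r..int r}" "z + 1 \<in> {-int r..int r}"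
    by (auto simp: r_def)
  have *: "(\<Sum>y=-int r..int r. \<phi> y * f y) = f z" for f :: "int \<Rightarrow> real"
    using mem by (simp add: \<phi>_def)
  have "(\<Sum>y=-int r..int r. (\<phi> (y + 1) - \<phi> (y - 1)) * f y) = f (z - 1) - f (z + 1)" for f :: "int \<Rightarrow> real"
  proof -
    have "(\<Sum>y=-int r..int r. (\<phi> (y + 1) - \<phi> (y - 1)) * f y)
       = (\<Sum>y=-int r..int r. of_bool (y = z - 1) * f y - of_bool (y = z + 1) * f y)"
      by (intro sum.cong) (auto simp: \<phi>_def)
    thus ?thesis using mem by (simp add: sum_subtractf)
  qed
  note ** = this
  show ?thesis
    using test_function_identity[OF X Y \<open>t < r\<close>, where n = n and \<phi> = \<phi>]
    unfolding s_def[symmetric] sum.distrib * ** by (simp add: algebra_simps)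
qed

lemma stopped_total_eq_abs_diff:
  assumes "stopped s"
  shows "real (oil s z) + real (water s z) = \<bar>real (oil s z) - real (water s z)\<bar>"
proof -
  have "\<not> can_fire s z" using assms by (simp add: stopped_def)
  hence "oil s z = 0 \<or> water s z = 0" by (auto simp: can_fire_def)
  thus ?thesis by auto
qed

text \<open>The cardinality of a set of firing times is matched with the counter carried by the
  state, by induction up to the first stopping time; a single \<open>t\<close> serves all
  sites.\<close>

lemma odometer_eq_fired:
  assumes "\<exists>t. stopped (ow_process n X Y t)"
  obtains t where "stopped (ow_process n X Y t)" "\<And>x. odometer n X Y x = fired (ow_process n X Y t) x"
proof -
  define T where "T = (LEAST t. stopped (ow_process n X Y t))"
  have T: "stopped (ow_process n X Y T)" unfolding T_def using assms by (rule LeastI_ex)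
  have lt: "\<not> stopped (ow_process n X Y t)" if "t < T" for t
    using not_less_Least that unfolding T_def by blast
  have "stop_time n X Y = enat T" unfolding stop_time_def
  proof (rule antisym)
    show "(INF t\<in>{t. stopped (ow_process n X Y t)}. enat t) \<le> enat T"
      using T by (intro INF_lower) auto
    show "enat T \<le> (INF t\<in>{t. stopped (ow_process n X Y t)}. enat t)"
      using lt by (intro INF_greatest) (auto simp: not_less[symmetric])
  qed
  moreover have "card {s. s < t \<and> firing_site n X Y s = x} = fired (ow_process n X Y t) x" if "t \<le> T" for t x
    using that
  proof (induction t)
    case (Suc t)
    have "{s. s < Suc t \<and> firing_site n X Y s = x} =
       (if firing_site n X Y t = x then insert t {s. s < t \<and> firing_site n X Y s = x} else {s. s < t \<and> firing_site n X Y s = x})"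
      by (auto simp: less_Suc_eq)
    moreover have "\<not> stopped (ow_process n X Y t)" using lt Suc.prems by auto
    ultimately show ?case using Suc
      by (auto simp: fire_def Let_def firing_site_def)
  qed simp
  ultimately have "odometer n X Y x = fired (ow_process n X Y T) x" for x
    by (simp add: odometer_def)
  with T show ?thesis using that by blast
qed

text \<open>\<open>D\<close> is the final surplus of oil over water, expressed through the stacks
  alone, so its absolute value is the final number of particles at a site. The threshold
  \<open>r0\<close> depends on the stopping time and hence on the stacks.\<close>

lemma odometer_identity:
  fixes n :: nat and X Y :: stack
  assumes X: "sign_stack X" and Y: "sign_stack Y" and stop: "\<exists>t. stopped (ow_process n X Y t)"
  defines "u \<equiv> odometer n X Y"
  defines "D \<equiv> \<lambda>z. ((real_of_int (stack_sum X (z - 1) (u (z - 1))) - real_of_int (stack_sum Y (z - 1) (u (z - 1))))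
    - (real_of_int (stack_sum X (z + 1) (u (z + 1))) - real_of_int (stack_sum Y (z + 1) (u (z + 1))))) / 2"
  obtains r0 where "\<And>r \<phi>. r0 \<le> r \<Longrightarrow> 
     (\<Sum>y=-int r..int r. \<phi> y * \<bar>D y\<bar>) = 2 * real n * \<phi> 0
      + (\<Sum>y=-int r..int r. (\<phi> (y + 1) + \<phi> (y - 1) - 2 * \<phi> y) * real (u y))
      + (\<Sum>y=-int r..int r. (\<phi> (y + 1) - \<phi> (y - 1)) *
          (real_of_int (stack_sum X y (u y)) + real_of_int (stack_sum Y y (u y)))) / 2"
    and "\<And>r. r0 \<le> r \<Longrightarrow> (\<Sum>y=-int r..int r. \<bar>D y\<bar>) = 2 * real n"
proof -
  obtain t where t: "stopped (ow_process n X Y t)" "\<And>x. odometer n X Y x = fired (ow_process n X Y t) x"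
    using odometer_eq_fired[OF stop] by blast
  define s where "s = ow_process n X Y t"
  have "D z = real (oil s z) - real (water s z)" for z
    using oil_minus_water[OF X Y, of n t z] by (simp add: D_def u_def t(2) s_def)
  hence D: "\<bar>D z\<bar> = real (oil s z) + real (water s z)" for z
    using stopped_total_eq_abs_diff[of s z] t(1) by (simp add: s_def)
  show ?thesis
  proof (rule that[of "Suc t"])
    fix r assume r: "Suc t \<le> r"
    hence "t < r" by simp
    show "(\<Sum>y=-int r..int r. \<phi> y * \<bar>D y\<bar>) = 2 * real n * \<phi> 0
      + (\<Sum>y=-int r..int r. (\<phi> (y + 1) + \<phi> (y - 1) - 2 * \<phi> y) * real (u y))
      + (\<Sum>y=-int r..int r. (\<phi> (y + 1) - \<phi> (y - 1)) *
          (real_of_int (stack_sum X y (u y)) + real_of_int (stack_sum Y y (u y)))) / 2" for \<phi>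
      using test_function_identity_total[OF X Y \<open>t < r\<close>, where n = n and \<phi> = \<phi>]
      by (simp add: D u_def t(2) s_def)
    show "(\<Sum>y=-int r..int r. \<bar>D y\<bar>) = 2 * real n"
      using total_mass[OF X Y \<open>t < r\<close>, of n] by (simp add: D s_def)
  qed
qed

section \<open>Termination\<close>

lemma run_append_stopped: "stopped (run n ps) \<Longrightarrow> run n (ps @ qs) = run n ps"
proof (induction qs rule: rev_induct)
  case (snoc q qs)
  then show ?case unfolding append_assoc[symmetric] run_snoc by (simp add: advance_def)
qed simp

lemma mass_run:
  assumes "set ps \<subseteq> {1, -1} \<times> {1, -1}" "length ps < r"
  shows "(\<Sum>y=-int r..int r. real (oil (run n ps) y)) = real n"
    and "(\<Sum>y=-int r..int r. real (water (run n ps) y)) = real n"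
proof -
  have "(\<Sum>y=-int r..int r. real (oil (run n ps) y)) = real n \<and>
    (\<Sum>y=-int r..int r. real (water (run n ps) y)) = real n"
    using assms
  proof (induction ps rule: rev_induct)
    case Nil
    have "(\<Sum>y=-int r..int r. real (if y = 0 then n else 0)) = real n"
      by (simp add: if_distrib[of real] cong: if_cong)
    then show ?case by (simp add: initial_state_def)
  next
    case (snoc p ps)
    define s where "s = run n ps"
    show ?case
    proof (cases "stopped s")
      case True
      then show ?thesis using snoc by (simp add: advance_def s_def)
    next
      case False
      have "supported (length ps) s" unfolding s_def by (rule supported_run) (use snoc in auto)
      note L = leftmost_active[OF this False]
      have p: "fst p \<in> {1, -1}" "snd p \<in> {1, -1}" using snoc.prems by auto
      have mem: "leftmost s \<in> {-int r..int r}" "leftmost s + fst p \<in> {-int r..int r}"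
         "leftmost s + snd p \<in> {-int r..int r}"
        using L(3) p snoc.prems(2) by auto
      show ?thesis
        using snoc False
        by (simp add: advance_def Let_def flip: s_def)
           (use sum_move_particle[OF finite_atLeastAtMost_int mem(1) mem(2), of "oil s" "\<lambda>_. 1"]
            sum_move_particle[OF finite_atLeastAtMost_int mem(1) mem(3), of "water s" "\<lambda>_. 1"] L(1,2) in simp)
    qed
  qed
  thus "(\<Sum>y=-int r..int r. real (oil (run n ps) y)) = real n"
    and "(\<Sum>y=-int r..int r. real (water (run n ps) y)) = real n" by auto
qed

text \<open>Firings that send oil left and water right never create an inversion and each of them
  removes at least one, so a long enough block of such firings stops the process.\<close>

definition inversions :: "nat \<Rightarrow> ow_state \<Rightarrow> real" where
  "inversions r s = (\<Sum>x=-int r..int r. \<Sum>y=-int r..int r. of_bool (y \<le> x) * real (oil s x) * real (water s y))"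

lemma inversions_nonneg: "inversions r s \<ge> 0"
  unfolding inversions_def by (intro sum_nonneg) auto

lemma inversions_le:
  "inversions r s \<le> (\<Sum>y=-int r..int r. real (oil s y)) * (\<Sum>y=-int r..int r. real (water s y))"
  unfolding inversions_def sum_product by (intro sum_mono) auto

lemma inversions_advance:
  assumes "supported k s" "k < r" "\<not> stopped s"
  shows "inversions r (advance (-1, 1) s) \<le> inversions r s - 1"
proof -
  define x where "x = leftmost s"
  define A where "A = {-int r..int r}"
  define o' where "o' = move_particle x (x - 1) (oil s)"
  define w' where "w' = move_particle x (x + 1) (water s)"
  note L = leftmost_active[OF assms(1,3), folded x_def]
  have mem: "x \<in> A" "x - 1 \<in> A" "x + 1 \<in> A" using L(3) assms(2) by (auto simp: A_def)
  have fin: "finite A" by (simp add: A_def)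
  \<comment> \<open>\<open>W\<close> and \<open>Q\<close> are inner sums of the double sum:
    \<open>W\<close> counts the water weakly to the left of a site, \<open>Q\<close> the already
    moved oil weakly to its right. Moving first the oil and then the water thus changes one single
    sum at a time; the first move removes \<open>water s x \<ge> 1\<close> inversions, the second a
    nonnegative number.\<close>
  define W where "W = (\<lambda>z. \<Sum>y\<in>A. of_bool (y \<le> z) * real (water s y))"
  define Q where "Q = (\<lambda>z. \<Sum>y\<in>A. of_bool (z \<le> y) * real (o' y))"
  have "W x - W (x - 1) = (\<Sum>y\<in>A. of_bool (y = x) * real (water s y))"
    unfolding W_def sum_subtractf[symmetric] by (intro sum.cong) auto
  also have "\<dots> = real (water s x)" using mem fin by simp
  finally have W: "W (x - 1) = W x - real (water s x)" by simp
  have "Q x - Q (x + 1) = (\<Sum>y\<in>A. of_bool (y = x) * real (o' y))"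
    unfolding Q_def sum_subtractf[symmetric] by (intro sum.cong) auto
  also have "\<dots> = real (o' x)" using mem fin by simp
  finally have Q: "Q (x + 1) = Q x - real (o' x)" by simp
  have "inversions r s = (\<Sum>z\<in>A. W z * real (oil s z))"
    unfolding inversions_def W_def A_def sum_distrib_right by (intro sum.cong refl) (simp only: mult_ac)
  moreover have "(\<Sum>z\<in>A. W z * real (o' z)) = (\<Sum>z\<in>A. W z * real (oil s z)) - W x + W (x - 1)"
    unfolding o'_def using sum_move_particle[OF fin mem(1) mem(2), of "oil s"] L(1) by simp
  moreover have "(\<Sum>z\<in>A. W z * real (o' z)) = (\<Sum>z\<in>A. Q z * real (water s z))"
    unfolding W_def Q_def sum_distrib_right
    by (subst sum.swap, intro sum.cong refl) (simp only: mult_ac)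
  moreover have "(\<Sum>z\<in>A. Q z * real (w' z)) = (\<Sum>z\<in>A. Q z * real (water s z)) - Q x + Q (x + 1)"
    unfolding w'_def using sum_move_particle[OF fin mem(1) mem(3), of "water s"] L(2) by simp
  moreover have "inversions r (advance (-1, 1) s) = (\<Sum>z\<in>A. Q z * real (w' z))"
  proof -
    have "oil (advance (-1, 1) s) = o'" "water (advance (-1, 1) s) = w'"
      using assms(3) by (auto simp: advance_def Let_def x_def o'_def w'_def)
    thus ?thesis unfolding inversions_def Q_def sum_distrib_right A_def
      by (subst sum.swap, intro sum.cong refl) (simp only: mult_ac)
  qed
  ultimately have "inversions r (advance (-1, 1) s) = inversions r s - real (water s x) - real (o' x)"
    using W Q by simp
  thus ?thesis using L(2) by simp
qed

text \<open>A state holds at most \<open>n * n\<close> inversions whatever moves \<open>ps\<close>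
  came before, so more than \<open>n\<^sup>2\<close> consecutive separating firings cannot all take
  place.\<close>

lemma separating_block_stops:
  assumes ps: "set ps \<subseteq> {1, -1} \<times> {1, -1}" and L: "n\<^sup>2 < L"
  shows "stopped (run n (ps @ replicate L (-1, 1)))"
proof (rule ccontr)
  assume not: "\<not> stopped (run n (ps @ replicate L (-1, 1)))"
  define r where "r = length ps + L + 1"
  have set: "set (ps @ replicate j (-1, 1)) \<subseteq> {1, -1} \<times> {1, -1}" for j
    using ps by (auto simp: set_replicate_conv_if)
  have ns: "\<not> stopped (run n (ps @ replicate j (-1, 1)))" if "j \<le> L" for j
  proof
    assume "stopped (run n (ps @ replicate j (-1, 1)))"
    hence "run n ((ps @ replicate j (-1, 1)) @ replicate (L - j) (-1, 1)) = run n (ps @ replicate j (-1, 1))"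
      by (rule run_append_stopped)
    moreover have "(ps @ replicate j (-1, 1)) @ replicate (L - j) (-1, 1) = ps @ replicate L (-1::int, 1::int)"
      using that by (simp flip: replicate_add)
    ultimately show False using not \<open>stopped (run n (ps @ replicate j (-1, 1)))\<close> by simp
  qed
  have "inversions r (run n (ps @ replicate j (-1, 1))) \<le> (real n)\<^sup>2 - real j" if "j \<le> L" for j
    using that
  proof (induction j)
    case 0
    show ?case
      using inversions_le[of r "run n ps"] mass_run[OF ps, of r n] by (simp add: r_def power2_eq_square)
  next
    case (Suc j)
    have "inversions r (advance (-1, 1) (run n (ps @ replicate j (-1, 1)))) \<le> inversions r (run n (ps @ replicate j (-1, 1))) - 1"
      by (rule inversions_advance[OF supported_run[OF set]]) (use Suc.prems ns in \<open>auto simp: r_def\<close>)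
    moreover have "run n (ps @ replicate (Suc j) (-1, 1)) = advance (-1, 1) (run n (ps @ replicate j (-1, 1)))"
      by (simp only: replicate_Suc replicate_append_same[symmetric] append_assoc[symmetric] run_snoc)
    ultimately show ?case using Suc by simp
  qed
  from this[of L] inversions_nonneg[of r "run n (ps @ replicate L (-1, 1))"]
  have "real L \<le> (real n)\<^sup>2" by linarith
  hence "L \<le> n\<^sup>2" by (metis of_nat_le_iff of_nat_power)
  with L show False by simp
qed

section \<open>Counting the move lists that leave the process running\<close>

definition unstopped_moves :: "nat \<Rightarrow> nat \<Rightarrow> (int \<times> int) list set" where
  "unstopped_moves n T = {ps. set ps \<subseteq> {1, -1} \<times> {1, -1} \<and> length ps = T \<and> \<not> stopped (run n ps)}"

lemma finite_unstopped_moves [simp]: "finite (unstopped_moves n T)"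
  unfolding unstopped_moves_def
  by (rule finite_subset[OF _ finite_lists_length_eq[of "{1, -1} \<times> {1, -1} :: (int \<times> int) set" T]]) auto

text \<open>Cut a list after \<open>T\<close> moves: the head must itself leave the process running,
  and the tail may be any of the \<open>4 ^ L\<close> lists except the separating block. The cut is
  injective, so the counts multiply.\<close>

lemma card_unstopped_moves_add:
  assumes L: "n\<^sup>2 < L"
  shows "card (unstopped_moves n (T + L)) \<le> card (unstopped_moves n T) * (4 ^ L - 1)"
proof -
  define P :: "(int \<times> int) set" where "P = {1, -1} \<times> {1, -1}"
  define C where "C = {qs. set qs \<subseteq> P \<and> length qs = L} - {replicate L (-1, 1)}"
  have finP: "finite P" by (simp add: P_def)
  have cP: "card P = 4" by (simp add: P_def card_cartesian_product)
  have "replicate L (-1, 1) \<in> {qs. set qs \<subseteq> P \<and> length qs = L}"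
    by (auto simp: P_def set_replicate_conv_if)
  hence cC: "card C = 4 ^ L - 1" "finite C" unfolding C_def
    by (simp_all add: card_Diff_singleton card_lists_length_eq finP cP finite_lists_length_eq)
  have "card (unstopped_moves n (T + L)) \<le> card (unstopped_moves n T \<times> C)"
  proof (rule card_inj_on_le[where f = "\<lambda>ps. (take T ps, drop T ps)"])
    show "inj_on (\<lambda>ps. (take T ps, drop T ps)) (unstopped_moves n (T + L))"
      by (rule inj_onI) (metis append_take_drop_id prod.inject)
    show "(\<lambda>ps. (take T ps, drop T ps)) ` unstopped_moves n (T + L) \<subseteq> unstopped_moves n T \<times> C"
    proof
      fix q assume "q \<in> (\<lambda>ps. (take T ps, drop T ps)) ` unstopped_moves n (T + L)"
      then obtain ps where ps: "ps \<in> unstopped_moves n (T + L)" and q: "q = (take T ps, drop T ps)" by blast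
      have sub: "set (take T ps) \<subseteq> P" "set (drop T ps) \<subseteq> P"
        using ps set_take_subset[of T ps] set_drop_subset[of T ps] by (auto simp: unstopped_moves_def P_def)
      have run: "\<not> stopped (run n (take T ps @ drop T ps))" using ps by (simp add: unstopped_moves_def)
      have 1: "\<not> stopped (run n (take T ps))"
        using run run_append_stopped[of n "take T ps" "drop T ps"] by metis
      have 2: "drop T ps \<noteq> replicate L (-1, 1)"
        using run separating_block_stops[OF sub(1)[unfolded P_def] L] by metis
      show "q \<in> unstopped_moves n T \<times> C"
        using ps sub 1 2 unfolding q C_def by (auto simp: unstopped_moves_def P_def)
    qed
  qed (use cC in auto)
  thus ?thesis using cC by (simp add: card_cartesian_product)
qed

text \<open>Every further block of \<open>L = Suc (n\<^sup>2)\<close> moves multiplies the fraction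
  of unstopped lists by at most \<open>1 - 1 / 4 ^ L\<close>, which gives geometric decay.\<close>

lemma card_unstopped_moves_tendsto_0:
  "(\<lambda>m. real (card (unstopped_moves n (m * Suc (n\<^sup>2)))) / 4 ^ (m * Suc (n\<^sup>2))) \<longlonglongrightarrow> 0"
proof -
  define L where "L = Suc (n\<^sup>2)"
  define q :: real where "q = 1 - 1 / 4 ^ L"
  have q: "0 \<le> q" "q < 1" by (auto simp: q_def)
  have le: "real (card (unstopped_moves n (m * L))) / 4 ^ (m * L) \<le> q ^ m" for m
  proof (induction m)
    case 0
    have "unstopped_moves n 0 \<subseteq> {[]}" by (auto simp: unstopped_moves_def)
    hence "card (unstopped_moves n 0) \<le> card {[] :: (int \<times> int) list}" by (intro card_mono) auto
    then show ?case by simp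
  next
    case (Suc m)
    have "real (card (unstopped_moves n (m * L + L))) \<le> real (card (unstopped_moves n (m * L)) * (4 ^ L - 1))"
      unfolding of_nat_le_iff by (rule card_unstopped_moves_add) (simp add: L_def)
    also have "\<dots> = real (card (unstopped_moves n (m * L))) * (4 ^ L - 1)"
      by (simp add: of_nat_diff)
    finally have "real (card (unstopped_moves n (m * L + L))) / 4 ^ (m * L + L)
        \<le> real (card (unstopped_moves n (m * L))) * (4 ^ L - 1) / 4 ^ (m * L + L)"
      by (rule divide_right_mono) simp
    also have "\<dots> = real (card (unstopped_moves n (m * L))) / 4 ^ (m * L) * q"
      by (simp add: q_def power_add field_simps)
    also have "\<dots> \<le> q ^ m * q" using Suc q by (intro mult_right_mono) auto
    finally show ?case by (simp add: add.commute mult.commute)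
  qed
  show ?thesis unfolding L_def[symmetric]
  proof (rule tendsto_sandwich[OF _ _ tendsto_const])
    show "(\<lambda>m. q ^ m) \<longlonglongrightarrow> 0" using q by (intro LIMSEQ_realpow_zero) auto
  qed (use le in auto)
qed

lemma fired_run_mono: "i \<le> j \<Longrightarrow> fired (run n (take i ps)) x \<le> fired (run n (take j ps)) x"
proof (induction j rule: dec_induct)
  case (step j)
  have "fired s x \<le> fired (advance p s) x" for s p
    by (auto simp: advance_def Let_def)
  moreover have "take (Suc j) ps = take j ps \<or> (\<exists>p. take (Suc j) ps = take j ps @ [p])"
    by (cases "j < length ps") (auto simp: take_Suc_conv_app_nth)
  ultimately show ?case using step by (metis order_trans order_refl run_snoc)
qed simp

text \<open>The stack position, site and 1-based index, from which \<open>ps ! i\<close> is drawn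
  when \<open>ps\<close> arises from stacks.\<close>

definition stack_key :: "nat \<Rightarrow> (int \<times> int) list \<Rightarrow> nat \<Rightarrow> int \<times> nat" where
  "stack_key n ps i = (let s = run n (take i ps) in (leftmost s, Suc (fired s (leftmost s))))"

text \<open>A firing raises the counter of its site and no counter ever decreases, so no stack
  position is used twice while the process keeps running.\<close>

lemma inj_on_stack_key:
  assumes "\<not> stopped (run n ps)"
  shows "inj_on (stack_key n ps) {..<length ps}"
proof (rule linorder_inj_onI)
  fix i j assume ij: "i < j" "i \<in> {..<length ps}" "j \<in> {..<length ps}"
  have ns: "\<not> stopped (run n (take i ps))"
    using assms run_append_stopped[of n "take i ps" "drop i ps"] by auto
  define x where "x = leftmost (run n (take i ps))"
  have "fired (run n (take (Suc i) ps)) x = Suc (fired (run n (take i ps)) x)"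
    using ij ns by (simp add: take_Suc_conv_app_nth advance_def Let_def x_def)
  moreover have "fired (run n (take (Suc i) ps)) x \<le> fired (run n (take j ps)) x"
    using ij by (intro fired_run_mono) auto
  ultimately show "stack_key n ps i \<noteq> stack_key n ps j"
    by (auto simp: stack_key_def Let_def x_def)
qed auto

lemma moves_nth:
  assumes "moves n X Y T = ps" "i < T"
  shows "ps ! i = (X (fst (stack_key n ps i)) (snd (stack_key n ps i)), Y (fst (stack_key n ps i)) (snd (stack_key n ps i)))"
proof -
  have take: "take i (moves n X Y T) = moves n X Y i" if "i \<le> T" for i T
    using that by (induction T) (auto simp: le_Suc_eq)
  have "take (Suc i) ps = moves n X Y (Suc i)" "take i ps = moves n X Y i"
    using take[of "Suc i" T] take[of i T] assms by auto
  moreover have "i < length ps" using assms by auto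
  ultimately have "ps ! i = next_move X Y (run n (take i ps))"
    by (simp add: take_Suc_conv_app_nth)
  thus ?thesis by (simp add: stack_key_def next_move_def Let_def)
qed

section \<open>Walks with fair signs\<close>

lemma central_binomial_Suc:
  "real (Suc m) * real ((2 * Suc m) choose Suc m) = 2 * (2 * real m + 1) * real ((2 * m) choose m)"
proof -
  have "Suc m * ((2 * Suc m) choose Suc m) = (2 * Suc m) * ((2 * m + 1) choose m)"
    using Suc_times_binomial_eq[of "2 * m + 1" m] by (simp add: mult.commute)
  moreover have "(2 * m + 1) choose m = (2 * m + 1) choose Suc m"
    by (subst binomial_symmetric) auto
  moreover have "Suc m * ((2 * m + 1) choose Suc m) = (2 * m + 1) * ((2 * m) choose m)"
    using Suc_times_binomial_eq[of "2 * m" m] by (simp add: mult.commute)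
  ultimately have "Suc m * ((2 * Suc m) choose Suc m) = 2 * ((2 * m + 1) * ((2 * m) choose m))"
    by (metis mult.assoc)
  from arg_cong[OF this, of real] show ?thesis by (simp add: algebra_simps)
qed

text \<open>Half of the mean absolute value of a simple random walk after \<open>2 * m\<close>
  steps.\<close>

definition mean_abs :: "nat \<Rightarrow> real" where
  "mean_abs m = real m * real ((2 * m) choose m) / 4 ^ m"

text \<open>Write \<open>c\<close> for the central binomial coefficient over \<open>4 ^ m\<close>.
  From \<open>m\<close> to \<open>m + 1\<close> the partial Wallis product and
  \<open>c\<^sup>2 * (2 * m + 1)\<close> change by reciprocal factors. The limit
  \<open>pi / 2\<close> of the product therefore determines that of \<open>c\<^sup>2 * m\<close>,
  the square of \<open>mean_abs m / sqrt m\<close>.\<close>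

lemma mean_abs_square_wallis:
  "(\<Prod>k=1..m. (4 * real k ^ 2) / (4 * real k ^ 2 - 1)) * ((real ((2 * m) choose m) / 4 ^ m)\<^sup>2 * (2 * real m + 1)) = 1"
proof (induction m)
  case (Suc m)
  define c where "c = real ((2 * m) choose m) / 4 ^ m"
  define b where "b = real ((2 * Suc m) choose Suc m)"
  have "(real m + 1) * b = 2 * (2 * real m + 1) * (c * 4 ^ m)"
    using central_binomial_Suc[of m, folded b_def] by (simp add: c_def add.commute)
  hence "b / 4 ^ Suc m = c * (2 * real m + 1) / (2 * (real m + 1))"
    by (simp add: divide_simps) (simp add: algebra_simps)
  hence c': "real ((2 * Suc m) choose Suc m) / 4 ^ Suc m = c * (2 * real m + 1) / (2 * (real m + 1))"
    by (simp only: b_def)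
  have ne: "4 * (real m + 1)\<^sup>2 - 1 = (2 * real m + 1) * (2 * real m + 3)" by (simp add: power2_eq_square algebra_simps)
  have "(4 * real (Suc m) ^ 2) / (4 * real (Suc m) ^ 2 - 1) * ((c * (2 * real m + 1) / (2 * (real m + 1)))\<^sup>2 * (2 * real (Suc m) + 1))
     = c\<^sup>2 * (2 * real m + 1)"
    using ne by (simp add: add.commute[of 1] divide_simps) (simp add: power2_eq_square algebra_simps)
  moreover have "(\<Prod>k=1..Suc m. (4 * real k ^ 2) / (4 * real k ^ 2 - 1)) =
    (\<Prod>k=1..m. (4 * real k ^ 2) / (4 * real k ^ 2 - 1)) * ((4 * real (Suc m) ^ 2) / (4 * real (Suc m) ^ 2 - 1))"
    by simp
  ultimately show ?case using Suc unfolding c' c_def[symmetric] by (simp only: mult.assoc)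
qed simp

lemma mean_abs_over_sqrt_tendsto: "(\<lambda>m. mean_abs m / sqrt (real m)) \<longlonglongrightarrow> sqrt (1 / pi)"
proof -
  define P where "P = (\<lambda>m. \<Prod>k=1..m. (4 * real k ^ 2) / (4 * real k ^ 2 - 1))"
  have P: "(\<lambda>m. inverse (P m)) \<longlonglongrightarrow> inverse (pi / 2)"
    unfolding P_def using wallis by (rule tendsto_inverse) simp
  have "(\<lambda>m. real m / (2 * real m + 1)) \<longlonglongrightarrow> 1 / 2" by real_asymp
  from tendsto_mult[OF P this] have "(\<lambda>m. inverse (P m) * (real m / (2 * real m + 1))) \<longlonglongrightarrow> 1 / pi" by simp
  hence "(\<lambda>m. sqrt (inverse (P m) * (real m / (2 * real m + 1)))) \<longlonglongrightarrow> sqrt (1 / pi)"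
    by (rule tendsto_real_sqrt)
  moreover have "sqrt (inverse (P m) * (real m / (2 * real m + 1))) = mean_abs m / sqrt (real m)" for m
  proof -
    define c where "c = real ((2 * m) choose m) / 4 ^ m"
    have "P m * (c\<^sup>2 * (2 * real m + 1)) = 1" using mean_abs_square_wallis[of m] by (simp add: P_def c_def)
    hence "inverse (P m) = c\<^sup>2 * (2 * real m + 1)" by (rule inverse_unique)
    hence "inverse (P m) * (real m / (2 * real m + 1)) = c\<^sup>2 * real m" by (simp add: field_simps)
    moreover have "c \<ge> 0" by (simp add: c_def)
    moreover have "mean_abs m / sqrt (real m) = c * (real m / sqrt (real m))"
      by (simp add: mean_abs_def c_def)
    moreover have "real m / sqrt (real m) = sqrt (real m)" by (rule real_div_sqrt) simp
    ultimately show ?thesis by (simp add: real_sqrt_mult)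
  qed
  ultimately show ?thesis by simp
qed

text \<open>The additive \<open>C\<close> absorbs the finitely many small \<open>m\<close>, so the
  estimate holds for every \<open>m\<close>. This matters because the profile may be small or zero
  at some sites; after division by \<open>N\<^sup>2\<close> the constant vanishes in the
  limit.\<close>

lemma mean_abs_asymptotics:
  assumes "\<epsilon> > 0"
  obtains C where "C \<ge> 0" "\<And>m. \<bar>mean_abs m - sqrt (real m / pi)\<bar> \<le> \<epsilon> * sqrt (real m) + C"
proof -
  obtain m0 where m0: "\<And>m. m \<ge> m0 \<Longrightarrow> \<bar>mean_abs m / sqrt (real m) - sqrt (1 / pi)\<bar> < \<epsilon>"
    using LIMSEQ_D[OF mean_abs_over_sqrt_tendsto assms] by auto
  define C where "C = (\<Sum>m\<le>m0. \<bar>mean_abs m - sqrt (real m / pi)\<bar>)"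
  show ?thesis
  proof (rule that[of C])
    show "C \<ge> 0" unfolding C_def by (intro sum_nonneg) auto
    fix m
    show "\<bar>mean_abs m - sqrt (real m / pi)\<bar> \<le> \<epsilon> * sqrt (real m) + C"
    proof (cases "m \<le> m0")
      case True
      hence "\<bar>mean_abs m - sqrt (real m / pi)\<bar> \<le> C"
        unfolding C_def by (intro member_le_sum[of m "{..m0}" "\<lambda>m. \<bar>mean_abs m - sqrt (real m / pi)\<bar>"]) auto
      moreover have "0 \<le> \<epsilon> * sqrt (real m)" using assms by simp
      ultimately show ?thesis by linarith
    next
      case False
      hence "real m > 0" by simp
      have "mean_abs m - sqrt (real m / pi) = (mean_abs m / sqrt (real m) - sqrt (1 / pi)) * sqrt (real m)"
        using \<open>real m > 0\<close> by (simp add: left_diff_distrib real_sqrt_divide)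
      hence "\<bar>mean_abs m - sqrt (real m / pi)\<bar> = \<bar>mean_abs m / sqrt (real m) - sqrt (1 / pi)\<bar> * sqrt (real m)"
        by (simp add: abs_mult)
      also have "\<dots> \<le> \<epsilon> * sqrt (real m)"
        using m0[of m] False by (intro mult_right_mono) auto
      finally show ?thesis using \<open>C \<ge> 0\<close> by linarith
    qed
  qed
qed

section \<open>Families of independent fair signs\<close>

locale fair_signs = prob_space M for M :: "'a measure" +
  fixes Z :: "'i \<Rightarrow> 'a \<Rightarrow> int" and I :: "'i set"
  assumes indep: "indep_vars (\<lambda>_. count_space UNIV) Z I"
    and distr_Z: "i \<in> I \<Longrightarrow> distr M (count_space UNIV) (Z i) = measure_pmf (pmf_of_set {1, -1})"
begin

lemma measurable_Z [measurable]: "i \<in> I \<Longrightarrow> Z i \<in> M \<rightarrow>\<^sub>M count_space UNIV"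
  using indep by (auto simp: indep_vars_def2)

lemma prob_Z_eq:
  assumes "i \<in> I" "v \<in> {1, -1}"
  shows "prob (Z i -` {v} \<inter> space M) = 1 / 2"
proof -
  have "prob (Z i -` {v} \<inter> space M) = measure (distr M (count_space UNIV) (Z i)) {v}"
    using assms by (subst measure_distr) auto
  also have "\<dots> = pmf (pmf_of_set {1, -1}) v" by (simp add: distr_Z[OF assms(1)] pmf.rep_eq)
  also have "\<dots> = 1 / 2" using assms(2) by (subst pmf_of_set) auto
  finally show ?thesis .
qed

lemma AE_Z: 
  assumes "i \<in> I"
  shows "AE \<omega> in M. Z i \<omega> \<in> {1, -1}"
proof -
  have "AE z in distr M (count_space UNIV) (Z i). z \<in> {1, -1}"
    unfolding distr_Z[OF assms] by (simp add: AE_measure_pmf_iff)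
  thus ?thesis using assms by (subst (asm) AE_distr_iff) auto
qed

lemma AE_Z_all:
  assumes "countable J" "J \<subseteq> I"
  shows "AE \<omega> in M. \<forall>i\<in>J. Z i \<omega> \<in> {1, -1}"
  using AE_Z assms by (subst AE_ball_countable) auto

lemma prob_pattern:
  assumes "finite J" "J \<subseteq> I" "\<And>i. i \<in> J \<Longrightarrow> v i \<in> {1, -1}"
  shows "prob {\<omega> \<in> space M. \<forall>i\<in>J. Z i \<omega> = v i} = (1 / 2) ^ card J"
proof (cases "J = {}")
  case True
  then show ?thesis by (simp add: prob_space)
next
  case False
  have "{\<omega> \<in> space M. \<forall>i\<in>J. Z i \<omega> = v i} = (\<Inter>i\<in>J. Z i -` {v i} \<inter> space M)"
    using False by auto
  also have "prob \<dots> = (\<Prod>i\<in>J. prob (Z i -` {v i} \<inter> space M))"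
    by (rule indep_varsD[OF indep False]) (use assms in auto)
  also have "\<dots> = (\<Prod>i\<in>J. 1 / 2)"
    using assms by (intro prod.cong refl prob_Z_eq) auto
  finally show ?thesis by simp
qed

text \<open>A finite product of countable discrete spaces is again a \<open>count_space\<close>, so
  an arbitrary function \<open>h\<close> of finitely many signs is measurable.\<close>

lemma measurable_restrict_Z:
  assumes "finite J" "J \<subseteq> I"
  shows "(\<lambda>\<omega>. h (\<lambda>i\<in>J. Z i \<omega>)) \<in> M \<rightarrow>\<^sub>M (count_space UNIV :: 'b measure)"
proof -
  have 1: "(\<lambda>\<omega>. \<lambda>i\<in>J. Z i \<omega>) \<in> M \<rightarrow>\<^sub>M PiM J (\<lambda>_. count_space UNIV)"
    using assms by (intro measurable_restrict) auto
  also have "PiM J (\<lambda>_. count_space UNIV) = (count_space (PiE J (\<lambda>_. UNIV)) :: ('i \<Rightarrow> int) measure)"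
    by (rule count_space_PiM_finite) (use assms in auto)
  finally have "(\<lambda>\<omega>. \<lambda>i\<in>J. Z i \<omega>) \<in> M \<rightarrow>\<^sub>M count_space (PiE J (\<lambda>_. UNIV))" .
  from measurable_compose[OF this, of h "count_space UNIV"] show ?thesis by simp
qed

lemma measurable_restrict_Z_borel:
  assumes "finite J" "J \<subseteq> I"
  shows "(\<lambda>\<omega>. h (\<lambda>i\<in>J. Z i \<omega>)) \<in> borel_measurable M"
  using measurable_compose[OF measurable_restrict_Z[OF assms, of h], of "\<lambda>x. x" borel] by simp

lemma integrable_restrict_Z:
  fixes h :: "('i \<Rightarrow> int) \<Rightarrow> real"
  assumes "finite J" "J \<subseteq> I"
  shows "integrable M (\<lambda>\<omega>. h (\<lambda>i\<in>J. Z i \<omega>))"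
proof (rule integrable_const_bound)
  let ?V = "PiE J (\<lambda>_. {1, -1})"
  have fin: "finite ((\<lambda>v. norm (h v)) ` ?V)" using assms by (intro finite_imageI finite_PiE) auto
  have "AE \<omega> in M. \<forall>i\<in>J. Z i \<omega> \<in> {1, -1}"
    using assms by (intro AE_Z_all) (auto intro: countable_finite)
  thus "AE \<omega> in M. norm (h (\<lambda>i\<in>J. Z i \<omega>)) \<le> Max ((\<lambda>v. norm (h v)) ` ?V)"
  proof eventually_elim
    case (elim \<omega>)
    thus ?case by (intro Max_ge fin imageI) auto
  qed
qed (rule measurable_restrict_Z_borel[OF assms])

text \<open>The martingale difference property in elementary form: \<open>Z i\<close> is independent
  of the signs indexed by \<open>J\<close> and has mean 0. It takes the place of conditional
  expectations.\<close>

lemma expectation_restrict_times_Z: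
  fixes h :: "('i \<Rightarrow> int) \<Rightarrow> real"
  assumes "finite J" "J \<subseteq> I" "i \<in> I" "i \<notin> J"
  shows "expectation (\<lambda>\<omega>. h (\<lambda>j\<in>J. Z j \<omega>) * real_of_int (Z i \<omega>)) = 0"
proof -
  have "indep_var (PiM J (\<lambda>_. count_space UNIV)) (\<lambda>\<omega>. \<lambda>j\<in>J. Z j \<omega>)
      (PiM {i} (\<lambda>_. count_space UNIV)) (\<lambda>\<omega>. \<lambda>j\<in>{i}. Z j \<omega>)"
    by (rule indep_var_restrict[OF indep]) (use assms in auto)
  moreover have "h \<in> borel_measurable (PiM J (\<lambda>_. count_space UNIV))"
    by (subst count_space_PiM_finite) (use assms in auto)
  moreover have "(\<lambda>v. real_of_int (v i)) \<in> borel_measurable (PiM {i} (\<lambda>_. count_space UNIV))"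
    by (subst count_space_PiM_finite) (use assms in auto)
  ultimately have "indep_var borel (h \<circ> (\<lambda>\<omega>. \<lambda>j\<in>J. Z j \<omega>)) borel ((\<lambda>v. real_of_int (v i)) \<circ> (\<lambda>\<omega>. \<lambda>j\<in>{i}. Z j \<omega>))"
    by (rule indep_var_compose)
  hence ind: "indep_var borel (\<lambda>\<omega>. h (\<lambda>j\<in>J. Z j \<omega>)) borel (\<lambda>\<omega>. real_of_int (Z i \<omega>))"
    by (simp add: comp_def)
  have int: "integrable M (\<lambda>\<omega>. real_of_int (Z i \<omega>))"
    using integrable_restrict_Z[of "{i}" "\<lambda>v. real_of_int (v i)"] assms by simp
  have "expectation (\<lambda>\<omega>. real_of_int (Z i \<omega>)) = (\<integral>z. real_of_int z \<partial>distr M (count_space UNIV) (Z i))"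
    using assms by (subst integral_distr) auto
  also have "\<dots> = 0"
    unfolding distr_Z[OF assms(3)] by (subst integral_pmf_of_set) auto
  finally show ?thesis
    by (subst indep_var_lebesgue_integral[OF ind integrable_restrict_Z[OF assms(1,2)] int])
       (simp only: mult_zero_right)
qed

end

text \<open>The injection \<open>j\<close> selects the signs that serve as steps and \<sigma> flips
  them deterministically, so that signed combinations of entries from several stacks become walks as
  well.\<close>

locale fair_sign_sequence = fair_signs M Z I for M :: "'a measure" and Z :: "'i \<Rightarrow> 'a \<Rightarrow> int" and I +
  fixes j :: "nat \<Rightarrow> 'i" and \<sigma> :: "nat \<Rightarrow> int"
  assumes j: "j l \<in> I" and inj_j: "inj j" and \<sigma>: "\<sigma> l \<in> {1, -1}"
begin

definition walk :: "nat \<Rightarrow> 'a \<Rightarrow> int" where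
  "walk k \<omega> = (\<Sum>l<k. \<sigma> l * Z (j l) \<omega>)"

abbreviation rwalk :: "nat \<Rightarrow> 'a \<Rightarrow> real" where
  "rwalk k \<omega> \<equiv> real_of_int (walk k \<omega>)"

text \<open>Adaptedness to the first \<open>k\<close> steps, in place of a filtration: the function
  factors through finitely many discrete variables.\<close>

definition determined :: "nat \<Rightarrow> ('a \<Rightarrow> 'b) \<Rightarrow> bool" where
  "determined k f \<longleftrightarrow> (\<exists>h. f = (\<lambda>\<omega>. h (\<lambda>i\<in>j ` {..<k}. Z i \<omega>)))"

lemma determined_const: "determined k (\<lambda>_. c)"
  unfolding determined_def by (rule exI[of _ "\<lambda>_. c"]) auto

lemma determined_compose: "determined k f \<Longrightarrow> determined k (\<lambda>\<omega>. g (f \<omega>))"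
  unfolding determined_def by (auto intro: exI[of _ "\<lambda>v. g (h v)" for h])

lemma determined_compose2:
  assumes "determined k f1" "determined k f2"
  shows "determined k (\<lambda>\<omega>. g (f1 \<omega>) (f2 \<omega>))"
proof -
  obtain h1 h2 where "f1 = (\<lambda>\<omega>. h1 (\<lambda>i\<in>j ` {..<k}. Z i \<omega>))" "f2 = (\<lambda>\<omega>. h2 (\<lambda>i\<in>j ` {..<k}. Z i \<omega>))"
    using assms by (auto simp: determined_def)
  thus ?thesis unfolding determined_def by (auto intro!: exI[of _ "\<lambda>v. g (h1 v) (h2 v)"])
qed

lemma determined_walk: "m \<le> k \<Longrightarrow> determined k (walk m)"
  unfolding determined_def
  by (rule exI[of _ "\<lambda>v. \<Sum>l<m. \<sigma> l * v (j l)"]) (auto simp: walk_def fun_eq_iff intro!: sum.cong)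

lemma integrable_determined:
  fixes f :: "'a \<Rightarrow> real"
  assumes "determined k f"
  shows "integrable M f"
  using assms unfolding determined_def using integrable_restrict_Z[of "j ` {..<k}"] j by auto

lemma expectation_determined_times:
  fixes f :: "'a \<Rightarrow> real"
  assumes "determined k f"
  shows "expectation (\<lambda>\<omega>. f \<omega> * real_of_int (Z (j k) \<omega>)) = 0"
proof -
  obtain h where f: "f = (\<lambda>\<omega>. h (\<lambda>i\<in>j ` {..<k}. Z i \<omega>))" using assms by (auto simp: determined_def)
  have "j k \<notin> j ` {..<k}" using inj_j by (auto dest: injD)
  thus ?thesis unfolding f using j by (intro expectation_restrict_times_Z) auto
qed

lemma walk_0 [simp]: "walk 0 \<omega> = 0"
  by (simp add: walk_def)

lemma walk_Suc: "walk (Suc k) \<omega> = walk k \<omega> + \<sigma> k * Z (j k) \<omega>"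
  by (simp add: walk_def)

lemma expectation_walk_Suc:
  fixes f :: "int \<Rightarrow> real"
  shows "expectation (\<lambda>\<omega>. f (walk (Suc k) \<omega>)) =
    (expectation (\<lambda>\<omega>. f (walk k \<omega> + 1)) + expectation (\<lambda>\<omega>. f (walk k \<omega> - 1))) / 2"
proof -
  define g1 where "g1 = (\<lambda>\<omega>. f (walk k \<omega> + 1))"
  define g2 where "g2 = (\<lambda>\<omega>. f (walk k \<omega> - 1))"
  define h where "h = (\<lambda>\<omega>. real_of_int (\<sigma> k) / 2 * (g1 \<omega> - g2 \<omega>))"
  have d: "determined k g1" "determined k g2" unfolding g1_def g2_def
    by (rule determined_compose[OF determined_walk[OF order_refl]])+
  hence dh: "determined k h" unfolding h_def by (rule determined_compose2)
  have int: "integrable M (\<lambda>\<omega>. f (walk (Suc k) \<omega>))"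
    by (rule integrable_determined[OF determined_compose[OF determined_walk[OF order_refl]]])
  \<comment> \<open>For \<open>z\<close> in \<open>{1, -1}\<close> the value
    \<open>f (s + \<sigma> k * z)\<close> is the average of \<open>f (s + 1)\<close> and
    \<open>f (s - 1)\<close> plus \<open>\<sigma> k * z\<close> times half their difference; that
    last term has mean 0.\<close>
  have "AE \<omega> in M. f (walk (Suc k) \<omega>) - (g1 \<omega> + g2 \<omega>) / 2 = h \<omega> * real_of_int (Z (j k) \<omega>)"
    using AE_Z[OF j[of k]]
  proof eventually_elim
    case (elim \<omega>)
    thus ?case using \<sigma>[of k] by (auto simp: g1_def g2_def h_def walk_Suc field_simps)
  qed
  hence "expectation (\<lambda>\<omega>. f (walk (Suc k) \<omega>) - (g1 \<omega> + g2 \<omega>) / 2) = expectation (\<lambda>\<omega>. h \<omega> * real_of_int (Z (j k) \<omega>))"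
    using int integrable_determined[OF d(1)] integrable_determined[OF d(2)]
      borel_measurable_integrable[OF integrable_determined[OF dh]] j[of k]
    by (intro integral_cong_AE) (auto intro!: borel_measurable_diff borel_measurable_times)
  also have "\<dots> = 0" by (rule expectation_determined_times[OF dh])
  finally show ?thesis using int integrable_determined[OF d(1)] integrable_determined[OF d(2)]
    by (simp add: g1_def g2_def)
qed

lemma integrable_walk:
  fixes f :: "int \<Rightarrow> real"
  shows "integrable M (\<lambda>\<omega>. f (walk k \<omega>))"
  by (rule integrable_determined[OF determined_compose[OF determined_walk[OF order_refl]]])

text \<open>Pascal's rule turns the averaging over one step into the recursion of the binomial
  distribution.\<close>

lemma expectation_walk:
  fixes f :: "int \<Rightarrow> real"
  shows "expectation (\<lambda>\<omega>. f (walk k \<omega>)) = (\<Sum>i\<le>k. real (k choose i) * f (2 * int i - int k)) / 2 ^ k"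
proof (induction k arbitrary: f)
  case 0
  then show ?case by (simp add: prob_space)
next
  case (Suc k)
  have "(\<Sum>i\<le>Suc k. real (Suc k choose i) * f (2 * int i - int (Suc k)))
     = f (- int (Suc k)) + (\<Sum>i\<le>k. real (Suc k choose Suc i) * f (2 * int (Suc i) - int (Suc k)))"
    by (subst sum.atMost_Suc_shift) simp
  also have "(\<Sum>i\<le>k. real (Suc k choose Suc i) * f (2 * int (Suc i) - int (Suc k)))
      = (\<Sum>i\<le>k. real (k choose i) * f (2 * int i - int k + 1)) + (\<Sum>i\<le>k. real (k choose Suc i) * f (2 * int (Suc i) - int k - 1))"
    unfolding sum.distrib[symmetric] by (intro sum.cong refl) (simp add: algebra_simps)
  finally have 1: "(\<Sum>i\<le>Suc k. real (Suc k choose i) * f (2 * int i - int (Suc k))) = f (- int (Suc k))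
      + ((\<Sum>i\<le>k. real (k choose i) * f (2 * int i - int k + 1)) + (\<Sum>i\<le>k. real (k choose Suc i) * f (2 * int (Suc i) - int k - 1)))" .
  have "(\<Sum>i\<le>k. real (k choose Suc i) * f (2 * int (Suc i) - int k - 1)) + f (- int (Suc k))
     = (\<Sum>i\<le>Suc k. real (k choose i) * f (2 * int i - int k - 1))"
    by (subst sum.atMost_Suc_shift) (simp, rule arg_cong[where f = f], simp)
  also have "\<dots> = (\<Sum>i\<le>k. real (k choose i) * f (2 * int i - int k - 1))" by simp
  finally have "(\<Sum>i\<le>Suc k. real (Suc k choose i) * f (2 * int i - int (Suc k)))
    = (\<Sum>i\<le>k. real (k choose i) * f (2 * int i - int k + 1)) + (\<Sum>i\<le>k. real (k choose i) * f (2 * int i - int k - 1))"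
    using 1 by linarith
  thus ?case unfolding expectation_walk_Suc
    using Suc[of "\<lambda>x. f (x + 1)"] Suc[of "\<lambda>x. f (x - 1)"] by (simp add: field_simps)
qed

lemma expectation_walk_square: "expectation (\<lambda>\<omega>. (rwalk k \<omega>)\<^sup>2) = real k"
proof (induction k)
  case (Suc k)
  have "expectation (\<lambda>\<omega>. (rwalk (Suc k) \<omega>)\<^sup>2)
    = (expectation (\<lambda>\<omega>. (rwalk k \<omega>)\<^sup>2 + 2 * rwalk k \<omega> + 1)
      + expectation (\<lambda>\<omega>. (rwalk k \<omega>)\<^sup>2 - 2 * rwalk k \<omega> + 1)) / 2"
    using expectation_walk_Suc[of "\<lambda>x. (real_of_int x)\<^sup>2" k] by (simp add: power2_eq_square algebra_simps)
  also have "\<dots> = expectation (\<lambda>\<omega>. (rwalk k \<omega>)\<^sup>2) + 1"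
    using integrable_walk[of real_of_int k] integrable_walk[of "\<lambda>x. (real_of_int x)\<^sup>2" k] by (simp add: prob_space)
  finally show ?case using Suc by simp
qed simp

text \<open>A discrete Tanaka formula: on the integers
  \<open>\<bar>x + 1\<bar> + \<bar>x - 1\<bar>\<close> exceeds \<open>2 * \<bar>x\<bar>\<close> only
  at \<open>x = 0\<close>, and there by 2.\<close>

lemma expectation_abs_walk_Suc:
  "expectation (\<lambda>\<omega>. \<bar>rwalk (Suc k) \<omega>\<bar>) =
   expectation (\<lambda>\<omega>. \<bar>rwalk k \<omega>\<bar>) + expectation (\<lambda>\<omega>. of_bool (walk k \<omega> = 0))"
proof -
  have eq: "\<bar>real_of_int (x + 1)\<bar> + \<bar>real_of_int (x - 1)\<bar> = 2 * (\<bar>real_of_int x\<bar> + of_bool (x = 0))" for x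
    by (cases x "0::int" rule: linorder_cases) auto
  have "expectation (\<lambda>\<omega>. \<bar>rwalk (Suc k) \<omega>\<bar>) =
     (expectation (\<lambda>\<omega>. \<bar>real_of_int (walk k \<omega> + 1)\<bar>) + expectation (\<lambda>\<omega>. \<bar>real_of_int (walk k \<omega> - 1)\<bar>)) / 2"
    by (rule expectation_walk_Suc)
  also have "\<dots> = expectation (\<lambda>\<omega>. \<bar>real_of_int (walk k \<omega> + 1)\<bar> + \<bar>real_of_int (walk k \<omega> - 1)\<bar>) / 2"
    using integrable_walk[of "\<lambda>x. \<bar>real_of_int (x + 1)\<bar>" k] integrable_walk[of "\<lambda>x. \<bar>real_of_int (x - 1)\<bar>" k]
    by (subst Bochner_Integration.integral_add) auto
  also have "\<dots> = expectation (\<lambda>\<omega>. \<bar>rwalk k \<omega>\<bar> + of_bool (walk k \<omega> = 0))"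
    unfolding eq by (simp only: integral_mult_right_zero)
  also have "\<dots> = expectation (\<lambda>\<omega>. \<bar>rwalk k \<omega>\<bar>) + expectation (\<lambda>\<omega>. of_bool (walk k \<omega> = 0))"
    using integrable_walk[of "\<lambda>x. \<bar>real_of_int x\<bar>" k] integrable_walk[of "\<lambda>x. of_bool (x = 0)" k]
    by (intro Bochner_Integration.integral_add) auto
  finally show ?thesis .
qed

lemma prob_walk_0:
  "expectation (\<lambda>\<omega>. of_bool (walk (2 * m) \<omega> = 0)) = real ((2 * m) choose m) / 4 ^ m"
  "expectation (\<lambda>\<omega>. of_bool (walk (Suc (2 * m)) \<omega> = 0)) = (0 :: real)"
proof -
  have "(\<Sum>i\<le>2 * m. real ((2 * m) choose i) * of_bool (2 * int i - int (2 * m) = 0))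
      = (\<Sum>i\<le>2 * m. of_bool (i = m) * real ((2 * m) choose i))"
    by (intro sum.cong) auto
  thus "expectation (\<lambda>\<omega>. of_bool (walk (2 * m) \<omega> = 0)) = real ((2 * m) choose m) / 4 ^ m"
    using expectation_walk[of "\<lambda>x. of_bool (x = 0)" "2 * m"] by (simp add: power_mult)
  have "(\<Sum>i\<le>Suc (2 * m). real (Suc (2 * m) choose i) * of_bool (2 * int i - int (Suc (2 * m)) = 0)) = 0"
    by (intro sum.neutral) (auto, presburger)
  thus "expectation (\<lambda>\<omega>. of_bool (walk (Suc (2 * m)) \<omega> = 0)) = (0 :: real)"
    using expectation_walk[of "\<lambda>x. of_bool (x = 0)" "Suc (2 * m)"] by simp
qed

text \<open>Two Tanaka steps at a time: the step from time \<open>2 * m\<close> gains the return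
  probability, and the step from the following odd time gains nothing by parity. The recursion of
  the central binomial coefficients sums these gains.\<close>

lemma expectation_abs_walk:
  "expectation (\<lambda>\<omega>. \<bar>rwalk (2 * m) \<omega>\<bar>) = 2 * real m * real ((2 * m) choose m) / 4 ^ m"
proof (induction m)
  case (Suc m)
  note * = central_binomial_Suc[of m]
  have "2 * real (Suc m) * real ((2 * Suc m) choose Suc m) / 4 ^ Suc m = 4 * (2 * real m + 1) * real ((2 * m) choose m) / 4 ^ Suc m"
    using * by (simp only: mult.assoc)
  also have "\<dots> = (2 * real m + 1) * real ((2 * m) choose m) / 4 ^ m" by (simp add: field_simps)
  also have "\<dots> = 2 * real m * real ((2 * m) choose m) / 4 ^ m + real ((2 * m) choose m) / 4 ^ m"
    by (simp add: field_simps)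
  also have "\<dots> = expectation (\<lambda>\<omega>. \<bar>rwalk (2 * Suc m) \<omega>\<bar>)"
    using Suc expectation_abs_walk_Suc[of "2 * m"] expectation_abs_walk_Suc[of "Suc (2 * m)"] prob_walk_0[of m]
    by simp
  finally show ?case ..
qed simp

section \<open>Doob's maximal inequality\<close>

primrec walk_max :: "nat \<Rightarrow> 'a \<Rightarrow> int" where
  "walk_max 0 \<omega> = 0"
| "walk_max (Suc k) \<omega> = max (walk_max k \<omega>) (walk (Suc k) \<omega>)"

abbreviation rmax :: "nat \<Rightarrow> 'a \<Rightarrow> real" where
  "rmax k \<omega> \<equiv> real_of_int (walk_max k \<omega>)"

lemma walk_le_walk_max: "l \<le> k \<Longrightarrow> walk l \<omega> \<le> walk_max k \<omega>"
  by (induction k) (auto simp: le_Suc_eq)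

lemma walk_max_nonneg: "0 \<le> walk_max k \<omega>"
  using walk_le_walk_max[of 0 k \<omega>] by simp

lemma determined_walk_max: "k \<le> k' \<Longrightarrow> determined k' (walk_max k)"
proof (induction k)
  case 0
  then show ?case using determined_const[of k' "0::int"] by (simp add: walk_max_def)
next
  case (Suc k)
  have "walk_max (Suc k) = (\<lambda>\<omega>. max (walk_max k \<omega>) (walk (Suc k) \<omega>))" by (rule ext) simp
  thus ?case using determined_compose2[of k' "walk_max k" "walk (Suc k)" max] Suc determined_walk[of "Suc k" k'] by simp
qed

lemma integrable_walk_max:
  fixes f :: "int \<Rightarrow> int \<Rightarrow> real"
  shows "integrable M (\<lambda>\<omega>. f (walk_max k \<omega>) (walk k \<omega>))"
  by (rule integrable_determined[OF determined_compose2[OF determined_walk_max[OF order_refl] determined_walk[OF order_refl]]])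

text \<open>The pathwise form of Doob's inequality: raising the maximum to the current value
  replaces \<open>m\<^sup>2 - 2 m s\<close> by \<open>- s\<^sup>2\<close>, which is at most the former.\<close>

lemma walk_max_supermartingale:
  "expectation (\<lambda>\<omega>. (rmax k \<omega>)\<^sup>2 - 2 * rmax k \<omega> * rwalk k \<omega>) \<le> 0"
proof (induction k)
  case (Suc k)
  have dm: "determined k (\<lambda>\<omega>. 2 * rmax k \<omega> * real_of_int (\<sigma> k))"
    by (rule determined_compose[OF determined_walk_max[OF order_refl]])
  have int: "integrable M (\<lambda>\<omega>. (rmax k \<omega>)\<^sup>2 - 2 * rmax k \<omega> * rwalk k \<omega>)"
    using integrable_walk_max[of "\<lambda>x y. (real_of_int x)\<^sup>2 - 2 * real_of_int x * real_of_int y" k] by simp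
  have int2: "integrable M (\<lambda>\<omega>. (rmax k \<omega>)\<^sup>2 - 2 * rmax k \<omega> * rwalk (Suc k) \<omega>)"
  proof (rule integrable_determined[of "Suc k"])
    show "determined (Suc k) (\<lambda>\<omega>. (rmax k \<omega>)\<^sup>2 - 2 * rmax k \<omega> * rwalk (Suc k) \<omega>)"
      using determined_compose2[of "Suc k" "walk_max k" "walk (Suc k)" "\<lambda>x y. (real_of_int x)\<^sup>2 - 2 * real_of_int x * real_of_int y"]
        determined_walk_max[of k "Suc k"] determined_walk[of "Suc k" "Suc k"] by simp
  qed
  have "expectation (\<lambda>\<omega>. (rmax (Suc k) \<omega>)\<^sup>2 - 2 * rmax (Suc k) \<omega> * rwalk (Suc k) \<omega>)
    \<le> expectation (\<lambda>\<omega>. (rmax k \<omega>)\<^sup>2 - 2 * rmax k \<omega> * rwalk (Suc k) \<omega>)"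
  proof (rule integral_mono[OF integrable_walk_max[of "\<lambda>x y. (real_of_int x)\<^sup>2 - 2 * real_of_int x * real_of_int y"] int2])
    fix \<omega>
    have "0 \<le> (rmax k \<omega> - rwalk (Suc k) \<omega>)\<^sup>2" by simp
    thus "(rmax (Suc k) \<omega>)\<^sup>2 - 2 * rmax (Suc k) \<omega> * rwalk (Suc k) \<omega>
      \<le> (rmax k \<omega>)\<^sup>2 - 2 * rmax k \<omega> * rwalk (Suc k) \<omega>"
      by (auto simp: max_def power2_eq_square algebra_simps)
  qed
  also have "\<dots> = expectation (\<lambda>\<omega>. ((rmax k \<omega>)\<^sup>2 - 2 * rmax k \<omega> * rwalk k \<omega>) - 2 * rmax k \<omega> * real_of_int (\<sigma> k) * real_of_int (Z (j k) \<omega>))"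
    by (simp add: walk_Suc algebra_simps)
  also have "\<dots> = expectation (\<lambda>\<omega>. (rmax k \<omega>)\<^sup>2 - 2 * rmax k \<omega> * rwalk k \<omega>)
     - expectation (\<lambda>\<omega>. 2 * rmax k \<omega> * real_of_int (\<sigma> k) * real_of_int (Z (j k) \<omega>))"
  proof (rule Bochner_Integration.integral_diff[OF int])
    have "integrable M (\<lambda>\<omega>. ((rmax k \<omega>)\<^sup>2 - 2 * rmax k \<omega> * rwalk k \<omega>) - ((rmax k \<omega>)\<^sup>2 - 2 * rmax k \<omega> * rwalk (Suc k) \<omega>))"
      by (rule Bochner_Integration.integrable_diff[OF int int2])
    thus "integrable M (\<lambda>\<omega>. 2 * rmax k \<omega> * real_of_int (\<sigma> k) * real_of_int (Z (j k) \<omega>))"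
      by (simp add: walk_Suc algebra_simps)
  qed
  also have "\<dots> \<le> 0" using Suc expectation_determined_times[OF dm] by simp
  finally show ?case .
qed simp

lemma expectation_walk_max_square: "expectation (\<lambda>\<omega>. (rmax k \<omega>)\<^sup>2) \<le> 4 * real k"
proof -
  note int = integrable_walk_max[of "\<lambda>x y. (real_of_int x)\<^sup>2 - 2 * real_of_int x * real_of_int y" k]
    integrable_walk_max[of "\<lambda>x y. (real_of_int y)\<^sup>2" k] integrable_walk_max[of "\<lambda>x y. (real_of_int x)\<^sup>2" k]
  \<comment> \<open>Since \<open>0 \<le> (m - 2 * s)\<^sup>2\<close>, the square of the maximum
    \<open>m\<close> is at most \<open>2 * (m\<^sup>2 - 2 * m * s) + 4 * s\<^sup>2\<close>, where
    the first summand has nonpositive mean.\<close>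
  have "expectation (\<lambda>\<omega>. (rmax k \<omega>)\<^sup>2) \<le> expectation (\<lambda>\<omega>. 2 * ((rmax k \<omega>)\<^sup>2 - 2 * rmax k \<omega> * rwalk k \<omega>) + 4 * (rwalk k \<omega>)\<^sup>2)"
  proof (rule integral_mono)
    show "(rmax k \<omega>)\<^sup>2 \<le> 2 * ((rmax k \<omega>)\<^sup>2 - 2 * rmax k \<omega> * rwalk k \<omega>) + 4 * (rwalk k \<omega>)\<^sup>2" for \<omega>
      using zero_le_power2[of "rmax k \<omega> - 2 * rwalk k \<omega>"] by (simp add: power2_eq_square algebra_simps)
    show "integrable M (\<lambda>\<omega>. 2 * ((rmax k \<omega>)\<^sup>2 - 2 * rmax k \<omega> * rwalk k \<omega>) + 4 * (rwalk k \<omega>)\<^sup>2)"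
      by (intro Bochner_Integration.integrable_add integrable_mult_right int)
  qed (use int in auto)
  also have "\<dots> = 2 * expectation (\<lambda>\<omega>. (rmax k \<omega>)\<^sup>2 - 2 * rmax k \<omega> * rwalk k \<omega>) + 4 * expectation (\<lambda>\<omega>. (rwalk k \<omega>)\<^sup>2)"
    using int by (subst Bochner_Integration.integral_add)
      (simp_all only: integral_mult_right_zero integrable_mult_right)
  also have "\<dots> \<le> 4 * real k"
    using walk_max_supermartingale[of k] expectation_walk_square[of k] by simp
  finally show ?thesis .
qed

lemma expectation_walk_max: "expectation (\<lambda>\<omega>. rmax k \<omega>) \<le> 2 * sqrt (real k)"
proof (cases "k = 0")
  case False
  \<comment> \<open>This \<open>c\<close> minimises \<open>c / 2 + 4 * k / (2 * c)\<close>, the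
    bound for the mean that comes from \<open>0 \<le> (m - c)\<^sup>2\<close> and the second
    moment.\<close>
  define c where "c = 2 * sqrt (real k)"
  have c: "c > 0" "c * c = 4 * real k" using False by (auto simp: c_def)
  have "expectation (\<lambda>\<omega>. rmax k \<omega>) \<le> expectation (\<lambda>\<omega>. c / 2 + (rmax k \<omega>)\<^sup>2 / (2 * c))"
  proof (rule integral_mono)
    show "rmax k \<omega> \<le> c / 2 + (rmax k \<omega>)\<^sup>2 / (2 * c)" for \<omega>
      using c(1) zero_le_power2[of "rmax k \<omega> - c"]
      by (simp add: field_simps power2_eq_square)
  qed (use integrable_walk_max[of "\<lambda>x y. real_of_int x" k] integrable_walk_max[of "\<lambda>x y. (real_of_int x)\<^sup>2" k] in auto)
  also have "\<dots> = c / 2 + expectation (\<lambda>\<omega>. (rmax k \<omega>)\<^sup>2) / (2 * c)"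
    using integrable_walk_max[of "\<lambda>x y. (real_of_int x)\<^sup>2" k] by (subst Bochner_Integration.integral_add) (auto simp: prob_space)
  also have "\<dots> \<le> c / 2 + (c * c) / (2 * c)"
    using expectation_walk_max_square[of k] c by (intro add_left_mono divide_right_mono) auto
  also have "\<dots> = c" using c(1) by simp
  finally show ?thesis by (simp add: c_def)
qed simp

end

lemma fair_sign_sequence_uminus: "fair_sign_sequence M Z I j \<sigma> \<Longrightarrow> fair_sign_sequence M Z I j (\<lambda>l. - \<sigma> l)"
  by (auto simp: fair_sign_sequence_def fair_sign_sequence_axioms_def)

text \<open>The bound is one integrable majorant \<open>W\<close>, valid for all
  \<open>l \<le> k\<close> at every outcome, because \<open>l\<close> will be a random odometer that
  depends on the same signs. The maxima of the walk and of its negative add up to such a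
  majorant.\<close>

lemma (in fair_sign_sequence) maximal_inequality:
  obtains W :: "'a \<Rightarrow> real" where "integrable M W" "expectation W \<le> 4 * sqrt (real k)"
    "\<And>l \<omega>. l \<le> k \<Longrightarrow> \<bar>rwalk l \<omega>\<bar> \<le> W \<omega>"
proof -
  interpret minus: fair_sign_sequence M Z I j "\<lambda>l. - \<sigma> l"
    by (rule fair_sign_sequence_uminus) unfold_locales
  have walk: "minus.walk l \<omega> = - walk l \<omega>" for l \<omega> by (simp add: minus.walk_def walk_def sum_negf)
  show ?thesis
  proof (rule that[of "\<lambda>\<omega>. rmax k \<omega> + real_of_int (minus.walk_max k \<omega>)"])
    note int = integrable_walk_max[of "\<lambda>x y. real_of_int x" k] minus.integrable_walk_max[of "\<lambda>x y. real_of_int x" k]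
    show "integrable M (\<lambda>\<omega>. rmax k \<omega> + real_of_int (minus.walk_max k \<omega>))"
      using int by simp
    show "expectation (\<lambda>\<omega>. rmax k \<omega> + real_of_int (minus.walk_max k \<omega>)) \<le> 4 * sqrt (real k)"
      using int expectation_walk_max[of k] minus.expectation_walk_max[of k] by simp
    fix l \<omega> assume "l \<le> k"
    thus "\<bar>rwalk l \<omega>\<bar> \<le> rmax k \<omega> + real_of_int (minus.walk_max k \<omega>)"
      using walk_le_walk_max[of l k \<omega>] minus.walk_le_walk_max[of l k \<omega>] walk_max_nonneg[of k \<omega>] minus.walk_max_nonneg[of k \<omega>]
      unfolding walk by linarith
  qed
qed

section \<open>Random stacks\<close>

abbreviation stacks_at :: "(int \<Rightarrow> nat \<Rightarrow> 'a \<Rightarrow> int) \<Rightarrow> 'a \<Rightarrow> stack" where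
  "stacks_at X \<omega> \<equiv> (\<lambda>z k. X z k \<omega>)"

definition joint_stack :: "(int \<Rightarrow> nat \<Rightarrow> 'a \<Rightarrow> int) \<Rightarrow> (int \<Rightarrow> nat \<Rightarrow> 'a \<Rightarrow> int) \<Rightarrow> (int \<times> nat) + (int \<times> nat) \<Rightarrow> 'a \<Rightarrow> int" where
  "joint_stack X Y = case_sum (\<lambda>(x, k). X x k) (\<lambda>(x, k). Y x k)"

definition stack_index :: "((int \<times> nat) + (int \<times> nat)) set" where
  "stack_index = (UNIV \<times> {1..}) <+> (UNIV \<times> {1..})"

lemma joint_stack_simps [simp]:
  "joint_stack X Y (Inl (x, k)) = X x k" "joint_stack X Y (Inr (x, k)) = Y x k"
  by (simp_all add: joint_stack_def)

locale random_stack_pair =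
  fixes M :: "'a measure" and X Y :: "int \<Rightarrow> nat \<Rightarrow> 'a \<Rightarrow> int"
  assumes random_stacks: "random_stacks M X Y"
begin

abbreviation process :: "nat \<Rightarrow> 'a \<Rightarrow> nat \<Rightarrow> ow_state" where
  "process n \<omega> \<equiv> ow_process n (stacks_at X \<omega>) (stacks_at Y \<omega>)"

abbreviation odo :: "nat \<Rightarrow> int \<Rightarrow> 'a \<Rightarrow> nat" where
  "odo n y \<omega> \<equiv> odometer n (stacks_at X \<omega>) (stacks_at Y \<omega>) y"

sublocale fair_signs M "joint_stack X Y" stack_index
proof -
  interpret prob_space M using random_stacks by (simp add: random_stacks_def)
  show "fair_signs M (joint_stack X Y) stack_index"
  proof unfold_locales
    show "indep_vars (\<lambda>_. count_space UNIV) (joint_stack X Y) stack_index"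
      using random_stacks by (simp add: random_stacks_def joint_stack_def stack_index_def)
    fix i assume "i \<in> stack_index"
    thus "distr M (count_space UNIV) (joint_stack X Y i) = measure_pmf (pmf_of_set {1, -1})"
      using random_stacks by (auto simp: random_stacks_def joint_stack_def stack_index_def)
  qed
qed

section \<open>Measurability and almost sure stopping\<close>

lemma measurable_stack [measurable]:
  "X x (Suc k) \<in> M \<rightarrow>\<^sub>M count_space UNIV" "Y x (Suc k) \<in> M \<rightarrow>\<^sub>M count_space UNIV"
  using measurable_Z[of "Inl (x, Suc k)"] measurable_Z[of "Inr (x, Suc k)"]
  by (auto simp: joint_stack_def stack_index_def)

lemma AE_sign_stack: "AE \<omega> in M. sign_stack (stacks_at X \<omega>) \<and> sign_stack (stacks_at Y \<omega>)"
proof -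
  have "AE \<omega> in M. \<forall>i\<in>stack_index. joint_stack X Y i \<omega> \<in> {1, -1}"
    by (rule AE_Z_all) auto
  thus ?thesis
  proof eventually_elim
    case (elim \<omega>)
    have "X x k \<omega> \<in> {1, -1}" "Y x k \<omega> \<in> {1, -1}" if "k \<ge> 1" for x k
      using elim[rule_format, of "Inl (x, k)"] elim[rule_format, of "Inr (x, k)"] that
      by (auto simp: joint_stack_def stack_index_def)
    thus ?case unfolding sign_stack_def by blast
  qed
qed

text \<open>Once the past moves are frozen to a fixed list, the next move reads fixed stack entries;
  there are only countably many lists to freeze.\<close>

lemma measurable_moves:
  "(\<lambda>\<omega>. moves n (stacks_at X \<omega>) (stacks_at Y \<omega>) t) \<in> M \<rightarrow>\<^sub>M count_space UNIV"
proof (induction t)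
  case (Suc t)
  have *: "(\<lambda>\<omega>. ps @ [next_move (stacks_at X \<omega>) (stacks_at Y \<omega>) (run n ps)]) \<in> M \<rightarrow>\<^sub>M count_space UNIV" for ps
  proof -
    define x k where "x = leftmost (run n ps)" and "k = fired (run n ps) x"
    have "(\<lambda>\<omega>. ps @ [(X x (Suc k) \<omega>, Y x (Suc k) \<omega>)]) \<in> M \<rightarrow>\<^sub>M count_space UNIV"
      by (rule measurable_compose_countable[where f = "\<lambda>a \<omega>. ps @ [(a, Y x (Suc k) \<omega>)]", OF _ measurable_stack(1)])
         (rule measurable_compose[OF measurable_stack(2)], simp)
    thus ?thesis by (simp add: next_move_def Let_def x_def k_def)
  qed
  show ?case unfolding moves.simps
    by (rule measurable_compose_countable[OF * Suc])
qed simp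

lemma measurable_process_fun:
  "(\<lambda>\<omega>. h (process n \<omega> t)) \<in> M \<rightarrow>\<^sub>M count_space UNIV"
  unfolding ow_process_eq_run by (rule measurable_compose[OF measurable_moves]) simp

text \<open>A prescribed list of moves determines the trajectory, hence the stack entries it reads, and
  these are pairwise distinct; no Markov property is needed.\<close>

lemma prob_moves_le:
  assumes ps: "ps \<in> unstopped_moves n T"
  shows "prob {\<omega> \<in> space M. moves n (stacks_at X \<omega>) (stacks_at Y \<omega>) T = ps} \<le> (1 / 4) ^ T"
proof -
  have len: "length ps = T" and set: "set ps \<subseteq> {1, -1} \<times> {1, -1}" and ns: "\<not> stopped (run n ps)"
    using ps by (auto simp: unstopped_moves_def)
  define key where "key = stack_key n ps"
  have inj: "inj_on key {..<T}" using inj_on_stack_key[OF ns] by (simp add: key_def len)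
  \<comment> \<open>Each move reads one oil entry and one water entry, so \<open>T\<close> moves
    prescribe \<open>2 * T\<close> independent signs.\<close>
  define J where "J = (Inl ` key ` {..<T} \<union> Inr ` key ` {..<T} :: ((int \<times> nat) + (int \<times> nat)) set)"
  define v where "v = case_sum (\<lambda>q. fst (ps ! the_inv_into {..<T} key q)) (\<lambda>q. snd (ps ! the_inv_into {..<T} key q))"
  have v: "v (Inl (key i)) = fst (ps ! i)" "v (Inr (key i)) = snd (ps ! i)" if "i < T" for i
    using the_inv_into_f_f[OF inj, of i] that by (simp_all add: v_def)
  have "card J = T + T"
    unfolding J_def using inj
    by (subst card_Un_disjoint) (auto simp: card_image inj_on_def)
  have JI: "J \<subseteq> stack_index" by (auto simp: J_def stack_index_def key_def stack_key_def Let_def)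
  have "{\<omega> \<in> space M. moves n (stacks_at X \<omega>) (stacks_at Y \<omega>) T = ps} \<subseteq>
     {\<omega> \<in> space M. \<forall>i\<in>J. joint_stack X Y i \<omega> = v i}"
  proof safe
    fix \<omega> q assume eq: "ps = moves n (stacks_at X \<omega>) (stacks_at Y \<omega>) T" and "q \<in> J"
    then obtain i where i: "i < T" "q = Inl (key i) \<or> q = Inr (key i)" by (auto simp: J_def)
    have "ps ! i = (X (fst (key i)) (snd (key i)) \<omega>, Y (fst (key i)) (snd (key i)) \<omega>)"
      unfolding key_def by (rule moves_nth[OF eq[symmetric] i(1)])
    thus "joint_stack X Y q \<omega> = v q" using i v by (auto simp: joint_stack_def case_prod_beta)
  qed
  hence "prob {\<omega> \<in> space M. moves n (stacks_at X \<omega>) (stacks_at Y \<omega>) T = ps} \<le>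
     prob {\<omega> \<in> space M. \<forall>i\<in>J. joint_stack X Y i \<omega> = v i}"
  proof (rule finite_measure_mono)
    have "countable J" by simp
    thus "{\<omega> \<in> space M. \<forall>i\<in>J. joint_stack X Y i \<omega> = v i} \<in> events"
      using JI measurable_Z by (intro sets.sets_Collect_countable_All') auto
  qed
  also have "\<dots> = (1 / 2) ^ card J"
  proof (rule prob_pattern[OF _ JI])
    show "finite J" by (simp add: J_def)
    fix q assume "q \<in> J"
    then obtain i where i: "i < T" "q = Inl (key i) \<or> q = Inr (key i)" by (auto simp: J_def)
    have "ps ! i \<in> {1, -1} \<times> {1, -1}" using set i len by (meson nth_mem subsetD)
    thus "v q \<in> {1, -1}" using i v by auto
  qed
  also have "\<dots> = (1 / 4) ^ T" unfolding \<open>card J = T + T\<close> by (simp add: power_add flip: power_mult_distrib)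
  finally show ?thesis .
qed

lemma prob_not_stopped_le:
  "prob {\<omega> \<in> space M. \<not> stopped (process n \<omega> T)}
     \<le> real (card (unstopped_moves n T)) / 4 ^ T"
proof -
  let ?A = "\<lambda>ps. {\<omega> \<in> space M. moves n (stacks_at X \<omega>) (stacks_at Y \<omega>) T = ps}"
  have A: "?A ps \<in> events" for ps
    using measurable_sets[OF measurable_moves, of "{ps}" n T] by (simp add: vimage_def Int_def conj_commute)
  have "prob {\<omega> \<in> space M. \<not> stopped (process n \<omega> T)}
      \<le> prob (\<Union>ps\<in>unstopped_moves n T. ?A ps)"
  proof (rule finite_measure_mono_AE)
    show "AE \<omega> in M. \<omega> \<in> {\<omega> \<in> space M. \<not> stopped (process n \<omega> T)}
        \<longrightarrow> \<omega> \<in> (\<Union>ps\<in>unstopped_moves n T. ?A ps)"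
      using AE_sign_stack
    proof eventually_elim
      case (elim \<omega>)
      have "set (moves n (stacks_at X \<omega>) (stacks_at Y \<omega>) T) \<subseteq> {1, -1} \<times> {1, -1}"
        using elim by (intro set_moves_subset) auto
      thus ?case by (auto simp: unstopped_moves_def ow_process_eq_run)
    qed
    show "(\<Union>ps\<in>unstopped_moves n T. ?A ps) \<in> events" using A by auto
  qed
  also have "\<dots> \<le> (\<Sum>ps\<in>unstopped_moves n T. prob (?A ps))"
    using A by (intro finite_measure_subadditive_finite) auto
  also have "\<dots> \<le> (\<Sum>ps\<in>unstopped_moves n T. (1 / 4) ^ T)"
    by (intro sum_mono prob_moves_le)
  also have "\<dots> = real (card (unstopped_moves n T)) / 4 ^ T" by (simp add: power_one_over)
  finally show ?thesis .
qed

lemma AE_stops: "AE \<omega> in M. \<exists>t. stopped (process n \<omega> t)"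
proof -
  let ?S = "\<lambda>t. {\<omega> \<in> space M. \<not> stopped (process n \<omega> t)}"
  define N where "N = {\<omega> \<in> space M. \<forall>t. \<not> stopped (process n \<omega> t)}"
  have [measurable]: "Measurable.pred M (\<lambda>\<omega>. stopped (process n \<omega> t))" for t
    by (rule measurable_process_fun)
  have S: "?S t \<in> events" for t by measurable
  have N: "N \<in> events" unfolding N_def by measurable
  have le: "prob N \<le> real (card (unstopped_moves n (m * Suc (n\<^sup>2)))) / 4 ^ (m * Suc (n\<^sup>2))" for m
  proof -
    have "prob N \<le> prob (?S (m * Suc (n\<^sup>2)))" by (rule finite_measure_mono[OF _ S]) (auto simp: N_def)
    thus ?thesis using prob_not_stopped_le order_trans by blast
  qed
  have "prob N \<le> 0"
    by (rule tendsto_lowerbound[OF card_unstopped_moves_tendsto_0 always_eventually[OF allI[OF le]]])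
       (rule sequentially_bot)
  hence "prob N = 0" using measure_nonneg[of M N] by simp
  thus ?thesis using N by (intro AE_I[of _ _ N]) (auto simp: N_def emeasure_eq_measure)
qed

lemma measurable_random_odometer [measurable]: "random_odometer n X Y x \<in> borel_measurable M"
proof -
  \<comment> \<open>This turns the infimum in \<open>enat\<close> into a condition on the finitely
    many states up to time \<open>t\<close>; the odometer becomes the cardinality of a random set of
    times with measurable membership.\<close>
  have lt: "enat t < stop_time n X' Y' \<longleftrightarrow> (\<forall>s\<le>t. \<not> stopped (ow_process n X' Y' s))" for X' Y' t
  proof
    assume "enat t < stop_time n X' Y'"
    hence "enat t < enat s" if "stopped (ow_process n X' Y' s)" for s
      unfolding stop_time_def using that by (auto dest!: less_INF_D)
    thus "\<forall>s\<le>t. \<not> stopped (ow_process n X' Y' s)" by fastforce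
  next
    assume *: "\<forall>s\<le>t. \<not> stopped (ow_process n X' Y' s)"
    have "enat (Suc t) \<le> stop_time n X' Y'"
      unfolding stop_time_def using * by (intro INF_greatest) (auto simp: not_less_eq_eq[symmetric])
    thus "enat t < stop_time n X' Y'" using less_le_trans[of "enat t" "enat (Suc t)"] by simp
  qed
  have [measurable]: "Measurable.pred M (\<lambda>\<omega>. stopped (process n \<omega> t))" for t
    by (rule measurable_process_fun)
  have [measurable]: "Measurable.pred M (\<lambda>\<omega>. leftmost (process n \<omega> t) = x)" for t
    by (rule measurable_process_fun)
  have "(\<lambda>\<omega>. card {t. (\<forall>s\<in>{..t}. \<not> stopped (process n \<omega> s)) \<and>
      leftmost (process n \<omega> t) = x}) \<in> M \<rightarrow>\<^sub>M count_space UNIV"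
    by measurable
  from measurable_compose[OF this, of real borel] show ?thesis
    by (simp add: random_odometer_def[abs_def] odometer_def lt firing_site_def Ball_def)
qed

section \<open>Maximal inequalities and moments for the stacks of a site\<close>

lemma stack_maximal_inequality:
  obtains W :: "'a \<Rightarrow> real" where "integrable M W" "expectation W \<le> 8 * sqrt (real k)"
    "\<And>l \<omega>. l \<le> k \<Longrightarrow> 
      \<bar>real_of_int (stack_sum (stacks_at X \<omega>) x (p + l)) - real_of_int (stack_sum (stacks_at X \<omega>) x p)\<bar>
      + \<bar>real_of_int (stack_sum (stacks_at Y \<omega>) x (p + l)) - real_of_int (stack_sum (stacks_at Y \<omega>) x p)\<bar> \<le> W \<omega>"
proof -
  interpret SX: fair_sign_sequence M "joint_stack X Y" stack_index "\<lambda>l. Inl (x, Suc (p + l))" "\<lambda>_. 1"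
    by unfold_locales (auto simp: stack_index_def inj_def)
  interpret SY: fair_sign_sequence M "joint_stack X Y" stack_index "\<lambda>l. Inr (x, Suc (p + l))" "\<lambda>_. 1"
    by unfold_locales (auto simp: stack_index_def inj_def)
  have wX: "real_of_int (SX.walk l \<omega>) = real_of_int (stack_sum (stacks_at X \<omega>) x (p + l)) - real_of_int (stack_sum (stacks_at X \<omega>) x p)" for l \<omega>
    by (induction l) (simp_all add: SX.walk_Suc stack_sum_Suc)
  have wY: "real_of_int (SY.walk l \<omega>) = real_of_int (stack_sum (stacks_at Y \<omega>) x (p + l)) - real_of_int (stack_sum (stacks_at Y \<omega>) x p)" for l \<omega>
    by (induction l) (simp_all add: SY.walk_Suc stack_sum_Suc)
  obtain W1 where W1: "integrable M W1" "expectation W1 \<le> 4 * sqrt (real k)" "\<And>l \<omega>. l \<le> k \<Longrightarrow> \<bar>real_of_int (SX.walk l \<omega>)\<bar> \<le> W1 \<omega>"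
    using SX.maximal_inequality[of k] by blast
  obtain W2 where W2: "integrable M W2" "expectation W2 \<le> 4 * sqrt (real k)" "\<And>l \<omega>. l \<le> k \<Longrightarrow> \<bar>real_of_int (SY.walk l \<omega>)\<bar> \<le> W2 \<omega>"
    using SY.maximal_inequality[of k] by blast
  show ?thesis
  proof (rule that[of "\<lambda>\<omega>. W1 \<omega> + W2 \<omega>"])
    show "integrable M (\<lambda>\<omega>. W1 \<omega> + W2 \<omega>)" "expectation (\<lambda>\<omega>. W1 \<omega> + W2 \<omega>) \<le> 8 * sqrt (real k)"
      using W1 W2 by simp_all
  qed (unfold wX[symmetric] wY[symmetric], intro add_mono W1(3) W2(3))
qed

definition stack_diff :: "int \<Rightarrow> nat \<Rightarrow> 'a \<Rightarrow> real" where
  "stack_diff x m \<omega> = real_of_int (stack_sum (stacks_at X \<omega>) x m) - real_of_int (stack_sum (stacks_at Y \<omega>) x m)"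

definition stack_total :: "int \<Rightarrow> nat \<Rightarrow> 'a \<Rightarrow> real" where
  "stack_total x m \<omega> = real_of_int (stack_sum (stacks_at X \<omega>) x m) + real_of_int (stack_sum (stacks_at Y \<omega>) x m)"

lemma stack_total_maximal:
  "\<exists>W. integrable M W \<and> expectation W \<le> 8 * sqrt (real k) \<and> (\<forall>\<omega>. W \<omega> \<ge> 0) \<and>
    (\<forall>m \<omega>. m \<le> k \<longrightarrow> \<bar>stack_total x m \<omega>\<bar> \<le> W \<omega>)"
proof -
  obtain W where W: "integrable M W" "expectation W \<le> 8 * sqrt (real k)" "\<And>l \<omega>. l \<le> k \<Longrightarrow> 
      \<bar>real_of_int (stack_sum (stacks_at X \<omega>) x (0 + l)) - real_of_int (stack_sum (stacks_at X \<omega>) x 0)\<bar>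
      + \<bar>real_of_int (stack_sum (stacks_at Y \<omega>) x (0 + l)) - real_of_int (stack_sum (stacks_at Y \<omega>) x 0)\<bar> \<le> W \<omega>"
    using stack_maximal_inequality[of k x 0] by blast
  have "\<bar>stack_total x m \<omega>\<bar> \<le> W \<omega>" if "m \<le> k" for m \<omega>
    using W(3)[OF that, of \<omega>] by (simp add: stack_total_def)
  moreover have "W \<omega> \<ge> 0" for \<omega> using W(3)[of 0 \<omega>] by simp
  ultimately show ?thesis using W(1,2) by blast
qed

text \<open>Prices the replacement of a random index \<open>m\<close> by the fixed
  \<open>m0\<close>. Both are compared with the left end \<open>p\<close> of a window of length
  \<open>2 * d\<close>, which doubles the majorant.\<close>

lemma stack_diff_maximal:
  "\<exists>W. integrable M W \<and> expectation W \<le> 16 * sqrt (2 * real d) \<and> (\<forall>\<omega>. W \<omega> \<ge> 0) \<and>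
    (\<forall>m \<omega>. \<bar>int m - int m0\<bar> \<le> int d \<longrightarrow> \<bar>stack_diff x m \<omega> - stack_diff x m0 \<omega>\<bar> \<le> W \<omega>)"
proof -
  \<comment> \<open>Subtraction on \<open>nat\<close>: if \<open>d\<close> exceeds
    \<open>m0\<close>, the window starts at 0, and it still contains every index within
    \<open>d\<close> of \<open>m0\<close>.\<close>
  define p where "p = m0 - d"
  obtain W where W: "integrable M W" "expectation W \<le> 8 * sqrt (real (2 * d))" "\<And>l \<omega>. l \<le> 2 * d \<Longrightarrow> 
      \<bar>real_of_int (stack_sum (stacks_at X \<omega>) x (p + l)) - real_of_int (stack_sum (stacks_at X \<omega>) x p)\<bar>
      + \<bar>real_of_int (stack_sum (stacks_at Y \<omega>) x (p + l)) - real_of_int (stack_sum (stacks_at Y \<omega>) x p)\<bar> \<le> W \<omega>"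
    using stack_maximal_inequality[of "2 * d" x p] by blast
  have *: "\<bar>stack_diff x m \<omega> - stack_diff x p \<omega>\<bar> \<le> W \<omega>" if "p \<le> m" "m \<le> p + 2 * d" for m \<omega>
  proof -
    have "m - p \<le> 2 * d" "p + (m - p) = m" using that by auto
    thus ?thesis using W(3)[of "m - p" \<omega>] unfolding stack_diff_def by simp
  qed
  show ?thesis
  proof (intro exI[of _ "\<lambda>\<omega>. 2 * W \<omega>"] conjI allI impI)
    show "integrable M (\<lambda>\<omega>. 2 * W \<omega>)" using W by simp
    show "expectation (\<lambda>\<omega>. 2 * W \<omega>) \<le> 16 * sqrt (2 * real d)" using W by simp
    show "2 * W \<omega> \<ge> 0" for \<omega> using W(3)[of 0 \<omega>] by simp
    fix m \<omega> assume "\<bar>int m - int m0\<bar> \<le> int d"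
    hence "p \<le> m" "m \<le> p + 2 * d" by (auto simp: p_def)
    moreover have "p \<le> m0" "m0 \<le> p + 2 * d" by (auto simp: p_def)
    ultimately show "\<bar>stack_diff x m \<omega> - stack_diff x m0 \<omega>\<bar> \<le> 2 * W \<omega>"
      using *[of m \<omega>] *[of m0 \<omega>] by linarith
  qed
qed

end

lemma sum_lessThan_add:
  fixes f :: "nat \<Rightarrow> 'b :: comm_monoid_add"
  shows "(\<Sum>l<a + b. f l) = (\<Sum>l<a. f l) + (\<Sum>l<b. f (a + l))"
  by (induction b) (simp_all add: add.assoc)

lemma stack_sum_lessThan: "stack_sum X x m = (\<Sum>l<m. X x (Suc l))"
  by (induction m) (simp_all add: stack_sum_Suc)

context random_stack_pair begin

text \<open>Each firing contributes two signs to \<open>S\<close>, which is therefore a walk of \<open>2 * (m + m')\<close> steps.\<close>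

lemma stack_diff_moments:
  fixes x y :: int and m m' :: nat
  assumes "x \<noteq> y"
  defines "S \<equiv> \<lambda>\<omega>. stack_diff x m \<omega> - stack_diff y m' \<omega>"
  shows "integrable M S" "integrable M (\<lambda>\<omega>. (S \<omega>)\<^sup>2)"
    "expectation (\<lambda>\<omega>. \<bar>S \<omega>\<bar>) = 2 * mean_abs (m + m')"
    "expectation (\<lambda>\<omega>. (S \<omega>)\<^sup>2) = 2 * real (m + m')"
proof -
  \<comment> \<open>Four consecutive blocks list the entries of \<open>X\<close> and
    \<open>Y\<close> at \<open>x\<close>, then of \<open>X\<close> and \<open>Y\<close> at
    \<open>y\<close>; \<sigma> gives them the signs +, -, -, +. The last branch continues with later
    entries of \<open>X\<close> at \<open>x\<close>, only to make \<open>j\<close> injective on all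
    of \<open>nat\<close>.\<close>
  define j :: "nat \<Rightarrow> (int \<times> nat) + (int \<times> nat)" where "j = (\<lambda>l.
     if l < m then Inl (x, Suc l) else if l < m + m then Inr (x, Suc (l - m))
     else if l < m + m + m' then Inl (y, Suc (l - (m + m)))
     else if l < m + m + m' + m' then Inr (y, Suc (l - (m + m + m')))
     else Inl (x, Suc l))"
  define \<sigma> :: "nat \<Rightarrow> int" where "\<sigma> = (\<lambda>l. if l < m then 1 else if l < m + m + m' then -1 else 1)"
  interpret fair_sign_sequence M "joint_stack X Y" stack_index j \<sigma>
  proof unfold_locales
    show "j l \<in> stack_index" for l by (auto simp: j_def stack_index_def)
    show "inj j" using assms(1) by (rule_tac injI) (auto simp: j_def split: if_splits)
    show "\<sigma> l \<in> {1, -1}" for l by (auto simp: \<sigma>_def)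
  qed
  have S: "S = (\<lambda>\<omega>. real_of_int (walk (2 * (m + m')) \<omega>))"
  proof (rule ext)
    fix \<omega>
    have "walk (m + m + m' + m') \<omega> = stack_sum (stacks_at X \<omega>) x m - stack_sum (stacks_at Y \<omega>) x m
       - stack_sum (stacks_at X \<omega>) y m' + stack_sum (stacks_at Y \<omega>) y m'"
      unfolding walk_def sum_lessThan_add stack_sum_lessThan
      by (simp add: j_def \<sigma>_def sum_negf)
    thus "S \<omega> = real_of_int (walk (2 * (m + m')) \<omega>)"
      by (simp add: S_def stack_diff_def mult_2 add_ac)
  qed
  show "integrable M S" "integrable M (\<lambda>\<omega>. (S \<omega>)\<^sup>2)"
    unfolding S using integrable_walk[of "\<lambda>x. real_of_int x"] integrable_walk[of "\<lambda>x. (real_of_int x)\<^sup>2"] by auto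
  show "expectation (\<lambda>\<omega>. \<bar>S \<omega>\<bar>) = 2 * mean_abs (m + m')"
    unfolding S expectation_abs_walk by (simp add: mean_abs_def)
  show "expectation (\<lambda>\<omega>. (S \<omega>)\<^sup>2) = 2 * real (m + m')"
    unfolding S expectation_walk_square by simp
qed

end

section \<open>Test functions\<close>

text \<open>Unnormalised, with slopes of size 1 and height \<open>H\<close>: it is integer valued
  and its discrete Laplacian consists of three atoms.\<close>

definition tent :: "int \<Rightarrow> int \<Rightarrow> int \<Rightarrow> int" where
  "tent c H y = max 0 (H - \<bar>y - c\<bar>)"

lemma tent_laplacian:
  assumes "H \<ge> 1"
  shows "tent c H (y + 1) + tent c H (y - 1) - 2 * tent c H y = of_bool (y = c + H) + of_bool (y = c - H) - 2 * of_bool (y = c)"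
proof -
  consider "y < c - H" | "y = c - H" | "c - H < y" "y < c" | "y = c" | "c < y" "y < c + H" | "y = c + H" | "c + H < y"
    by linarith
  thus ?thesis by cases (use assms in \<open>auto simp: tent_def\<close>)
qed

lemma tent_gradient: "\<bar>tent c H (y + 1) - tent c H (y - 1)\<bar> \<le> 2"
  by (auto simp: tent_def)

lemma tent_bounds: "H \<ge> 0 \<Longrightarrow> 0 \<le> tent c H y" "H \<ge> 0 \<Longrightarrow> tent c H y \<le> H"
  by (auto simp: tent_def)

text \<open>It rises from \<open>a\<close> to \<open>b\<close> and stays at \<open>b - a\<close>
  afterwards. Its Laplacian is a dipole, which isolates the increment of the odometer between two
  sites.\<close>

definition ramp :: "int \<Rightarrow> int \<Rightarrow> int \<Rightarrow> int" where
  "ramp a b y = max 0 (min (b - a) (y - a))"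

lemma ramp_laplacian:
  assumes "a < b"
  shows "ramp a b (y + 1) + ramp a b (y - 1) - 2 * ramp a b y = of_bool (y = a) - of_bool (y = b)"
proof -
  consider "y < a" | "y = a" | "a < y" "y < b" | "y = b" | "b < y" by linarith
  thus ?thesis by cases (use assms in \<open>auto simp: ramp_def\<close>)
qed

lemma ramp_gradient: "a \<le> b \<Longrightarrow> \<bar>ramp a b (y + 1) - ramp a b (y - 1)\<bar> \<le> 2"
  by (auto simp: ramp_def)

lemma ramp_gradient_eq_0: "a \<le> b \<Longrightarrow> y \<notin> {a..b} \<Longrightarrow> ramp a b (y + 1) - ramp a b (y - 1) = 0"
  by (auto simp: ramp_def)

lemma ramp_bounds: "a \<le> b \<Longrightarrow> 0 \<le> ramp a b y" "a \<le> b \<Longrightarrow> ramp a b y \<le> b - a"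
  by (auto simp: ramp_def)

section \<open>Tent and ramp identities for the random odometer\<close>

context random_stack_pair begin

abbreviation site_diff :: "(int \<Rightarrow> nat) \<Rightarrow> int \<Rightarrow> 'a \<Rightarrow> real" where
  "site_diff m y \<omega> \<equiv> stack_diff (y - 1) (m (y - 1)) \<omega> - stack_diff (y + 1) (m (y + 1)) \<omega>"

definition test_identity :: "nat \<Rightarrow> nat \<Rightarrow> (int \<Rightarrow> int) \<Rightarrow> 'a \<Rightarrow> bool" where
  "test_identity n r \<phi> \<omega> \<longleftrightarrow>
     (\<Sum>y=-int r..int r. real_of_int (\<phi> y) * (\<bar>site_diff (\<lambda>y. odo n y \<omega>) y \<omega>\<bar> / 2)) = 2 * real n * real_of_int (\<phi> 0)
      + (\<Sum>y=-int r..int r. real_of_int (\<phi> (y + 1) + \<phi> (y - 1) - 2 * \<phi> y) * real (odo n y \<omega>))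
      + (\<Sum>y=-int r..int r. real_of_int (\<phi> (y + 1) - \<phi> (y - 1)) * stack_total y (odo n y \<omega>) \<omega>) / 2"

text \<open>The identity is pathwise, so one null set and one \<open>r0\<close> serve all test
  functions.\<close>

lemma AE_test_identity:
  "AE \<omega> in M. \<exists>r0. \<forall>r\<ge>r0. (\<forall>\<phi>. test_identity n r \<phi> \<omega>)
    \<and> (\<Sum>y=-int r..int r. \<bar>site_diff (\<lambda>y. odo n y \<omega>) y \<omega>\<bar> / 2) = 2 * real n"
  using AE_sign_stack AE_stops[of n]
proof eventually_elim
  case (elim \<omega>)
  show ?case
  proof (rule odometer_identity[of "stacks_at X \<omega>" "stacks_at Y \<omega>" n], goal_cases)
    case (4 r0)
    show ?case
    proof (intro exI[of _ r0] allI impI conjI)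
      fix r \<phi> assume "r0 \<le> r"
      from 4(1)[OF this, of "\<lambda>y. real_of_int (\<phi> y)"] show "test_identity n r \<phi> \<omega>"
        by (simp add: test_identity_def stack_diff_def stack_total_def abs_divide)
    next
      fix r assume "r0 \<le> r"
      from 4(2)[OF this] show "(\<Sum>y=-int r..int r. \<bar>site_diff (\<lambda>y. odo n y \<omega>) y \<omega>\<bar> / 2) = 2 * real n"
        by (simp add: stack_diff_def abs_divide)
    qed
  qed (use elim in auto)
qed

lemma gradient_sum_le:
  fixes \<psi> :: "int \<Rightarrow> int" and f :: "int \<Rightarrow> real"
  assumes "finite A" "B \<subseteq> A" "\<And>y. \<bar>\<psi> y\<bar> \<le> 2" "\<And>y. y \<notin> B \<Longrightarrow> \<psi> y = 0"
  shows "\<bar>(\<Sum>y\<in>A. real_of_int (\<psi> y) * f y) / 2\<bar> \<le> (\<Sum>y\<in>B. \<bar>f y\<bar>)"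
proof -
  have "(\<Sum>y\<in>A. real_of_int (\<psi> y) * f y) = (\<Sum>y\<in>B. real_of_int (\<psi> y) * f y)"
    using assms by (intro sum.mono_neutral_right) auto
  also have "\<bar>\<dots>\<bar> \<le> (\<Sum>y\<in>B. \<bar>real_of_int (\<psi> y) * f y\<bar>)" by (rule sum_abs)
  also have "\<dots> \<le> (\<Sum>y\<in>B. 2 * \<bar>f y\<bar>)"
  proof (rule sum_mono)
    fix y
    have "\<bar>real_of_int (\<psi> y)\<bar> \<le> 2" using assms(3)[of y] by linarith
    thus "\<bar>real_of_int (\<psi> y) * f y\<bar> \<le> 2 * \<bar>f y\<bar>" unfolding abs_mult by (rule mult_right_mono) simp
  qed
  finally show ?thesis by (simp flip: sum_distrib_left)
qed

lemma AE_tent_identity: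
  assumes "H \<ge> 1"
  shows "AE \<omega> in M. \<bar>(\<Sum>y=c-H..c+H. real_of_int (tent c H y) * (\<bar>site_diff (\<lambda>y. odo n y \<omega>) y \<omega>\<bar> / 2))
     - (2 * real n * real_of_int (tent c H 0) + real (odo n (c + H) \<omega>) + real (odo n (c - H) \<omega>) - 2 * real (odo n c \<omega>))\<bar>
     \<le> (\<Sum>y=c-H..c+H. \<bar>stack_total y (odo n y \<omega>) \<omega>\<bar>)"
  using AE_test_identity[of n]
proof eventually_elim
  case (elim \<omega>)
  then obtain r0 where r0: "\<And>r \<phi>. r \<ge> r0 \<Longrightarrow> test_identity n r \<phi> \<omega>"
    by blast
  \<comment> \<open>Large enough for the identity to hold and for the window to contain the support
    of the tent and the three atoms of its Laplacian.\<close>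
  define r where "r = r0 + nat (\<bar>c\<bar> + H)"
  define A where "A = {-int r..int r}"
  have sub: "{c-H..c+H} \<subseteq> A" and mem: "c \<in> A" "c + H \<in> A" "c - H \<in> A" and fin: "finite A"
    using assms by (auto simp: A_def r_def)
  have "(\<Sum>y\<in>A. real_of_int (tent c H y) * (\<bar>site_diff (\<lambda>y. odo n y \<omega>) y \<omega>\<bar> / 2))
     = (\<Sum>y=c-H..c+H. real_of_int (tent c H y) * (\<bar>site_diff (\<lambda>y. odo n y \<omega>) y \<omega>\<bar> / 2))"
    using sub fin assms by (intro sum.mono_neutral_right) (auto simp: tent_def)
  moreover have "(\<Sum>y\<in>A. real_of_int (tent c H (y + 1) + tent c H (y - 1) - 2 * tent c H y) * real (odo n y \<omega>))
     = real (odo n (c + H) \<omega>) + real (odo n (c - H) \<omega>) - 2 * real (odo n c \<omega>)"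
    unfolding tent_laplacian[OF assms] using mem fin
    by (simp add: left_diff_distrib distrib_right sum.distrib sum_subtractf mult.assoc flip: sum_distrib_left)
  moreover have "\<bar>(\<Sum>y\<in>A. real_of_int (tent c H (y + 1) - tent c H (y - 1)) * stack_total y (odo n y \<omega>) \<omega>) / 2\<bar>
     \<le> (\<Sum>y=c-H..c+H. \<bar>stack_total y (odo n y \<omega>) \<omega>\<bar>)"
    by (rule gradient_sum_le[OF fin sub tent_gradient]) (use assms in \<open>auto simp: tent_def\<close>)
  ultimately show ?case using r0[of r "tent c H", unfolded test_identity_def, folded A_def] by (simp add: r_def)
qed

text \<open>The particle sum and the source term both lie between 0 and
  \<open>2 * n * (b - a)\<close>, because the total mass is \<open>2 * n\<close> and the ramp is at
  most \<open>b - a\<close>; hence so does the absolute value of their difference. The Lipschitz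
  constant 2 of \<open>w\<close> originates here.\<close>

lemma AE_ramp_bound:
  assumes "a < b"
  shows "AE \<omega> in M. \<bar>real (odo n a \<omega>) - real (odo n b \<omega>)\<bar>
     \<le> 2 * real n * real_of_int (b - a) + (\<Sum>y=a..b. \<bar>stack_total y (odo n y \<omega>) \<omega>\<bar>)"
  using AE_test_identity[of n]
proof eventually_elim
  case (elim \<omega>)
  then obtain r0 where r0: "\<And>r \<phi>. r \<ge> r0 \<Longrightarrow> test_identity n r \<phi> \<omega>"
     "\<And>r. r \<ge> r0 \<Longrightarrow> (\<Sum>y=-int r..int r. \<bar>site_diff (\<lambda>y. odo n y \<omega>) y \<omega>\<bar> / 2) = 2 * real n"
    by blast
  define r where "r = r0 + nat (\<bar>a\<bar> + \<bar>b\<bar>)"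
  define A where "A = {-int r..int r}"
  have sub: "{a..b} \<subseteq> A" and mem: "a \<in> A" "b \<in> A" and fin: "finite A"
    using assms by (auto simp: A_def r_def)
  have "a \<le> b" using assms by simp
  note rb = ramp_bounds[OF this]
  let ?T = "\<Sum>y\<in>A. real_of_int (ramp a b y) * (\<bar>site_diff (\<lambda>y. odo n y \<omega>) y \<omega>\<bar> / 2)"
  have T0: "0 \<le> ?T" using rb(1) by (intro sum_nonneg) (auto intro!: mult_nonneg_nonneg divide_nonneg_nonneg)
  have "?T \<le> (\<Sum>y\<in>A. real_of_int (b - a) * (\<bar>site_diff (\<lambda>y. odo n y \<omega>) y \<omega>\<bar> / 2))"
    using rb(2) by (intro sum_mono mult_right_mono) (auto simp only: of_int_le_iff abs_ge_zero intro!: divide_nonneg_nonneg)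
  also have "\<dots> = 2 * real n * real_of_int (b - a)"
  proof -
    have "(\<Sum>y\<in>A. \<bar>site_diff (\<lambda>y. odo n y \<omega>) y \<omega>\<bar> / 2) = 2 * real n"
      unfolding A_def by (rule r0(2)) (simp add: r_def)
    thus ?thesis unfolding sum_distrib_left[symmetric] by (simp only: mult.commute)
  qed
  finally have T1: "?T \<le> 2 * real n * real_of_int (b - a)" .
  have "(\<Sum>y\<in>A. real_of_int (ramp a b (y + 1) + ramp a b (y - 1) - 2 * ramp a b y) * real (odo n y \<omega>))
     = real (odo n a \<omega>) - real (odo n b \<omega>)"
    unfolding ramp_laplacian[OF assms] using mem fin
    by (simp add: left_diff_distrib sum_subtractf)
  moreover have "\<bar>(\<Sum>y\<in>A. real_of_int (ramp a b (y + 1) - ramp a b (y - 1)) * stack_total y (odo n y \<omega>) \<omega>) / 2\<bar>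
     \<le> (\<Sum>y=a..b. \<bar>stack_total y (odo n y \<omega>) \<omega>\<bar>)"
    by (rule gradient_sum_le[OF fin sub ramp_gradient[OF \<open>a \<le> b\<close>] ramp_gradient_eq_0[OF \<open>a \<le> b\<close>]])
  moreover have "0 \<le> 2 * real n * real_of_int (ramp a b 0)" using rb(1)[of 0] by simp
  moreover have "2 * real n * real_of_int (ramp a b 0) \<le> 2 * real n * real_of_int (b - a)"
    using rb(2)[of 0] by (intro mult_left_mono) auto
  moreover have "r0 \<le> r" by (simp add: r_def)
  ultimately show ?case using T0 T1 r0(1)[of r "ramp a b", unfolded test_identity_def, folded A_def] by linarith
qed

text \<open>Off \<open>B\<close> the odometer stays within \<open>d\<close> of the deterministic
  \<open>m\<close> and below \<open>K\<close>, so the stack sums can be replaced by majorants before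
  means are taken. The increment of \<open>m\<close> is a constant, and integrating it over the
  complement of \<open>B\<close> produces the factor \<open>1 - prob B\<close>.\<close>

lemma ramp_deviation:
  fixes a b :: int and m :: "int \<Rightarrow> nat"
  assumes "a < b" and B: "B \<in> events"
    and near: "AE \<omega> in M. \<omega> \<notin> B \<longrightarrow> (\<forall>y\<in>{a..b}. \<bar>int (odo n y \<omega>) - int (m y)\<bar> \<le> int d \<and> odo n y \<omega> \<le> K)"
  shows "(1 - prob B) * \<bar>real (m a) - real (m b)\<bar>
     \<le> 2 * real n * real_of_int (b - a) + 2 * real d + 8 * sqrt (real K) * real_of_int (b - a + 1)"
proof -
  define \<Delta> where "\<Delta> = \<bar>real (m a) - real (m b)\<bar>"
  obtain V where V: "\<And>y. integrable M (V y)" "\<And>y. expectation (V y) \<le> 8 * sqrt (real K)" "\<And>y \<omega>. V y \<omega> \<ge> 0"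
    "\<And>y m \<omega>. m \<le> K \<Longrightarrow> \<bar>stack_total y m \<omega>\<bar> \<le> V y \<omega>"
    using stack_total_maximal[of K] by metis
  have "(1 - prob B) * \<Delta> = expectation (\<lambda>\<omega>. \<Delta> * indicator (space M - B) \<omega>)"
    using B by (simp add: prob_compl Int_absorb2 sets.sets_into_space mult.commute)
  also have "\<dots> \<le> expectation (\<lambda>\<omega>. (2 * real n * real_of_int (b - a) + 2 * real d) + (\<Sum>y=a..b. V y \<omega>))"
  proof (rule integral_mono_AE)
    show "integrable M (\<lambda>\<omega>. \<Delta> * indicator (space M - B) \<omega>)" using B by (intro integrable_mult_right integrable_real_indicator) (auto simp: emeasure_eq_measure)
    show "integrable M (\<lambda>\<omega>. (2 * real n * real_of_int (b - a) + 2 * real d) + (\<Sum>y=a..b. V y \<omega>))" using V(1) by simp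
    show "AE \<omega> in M. \<Delta> * indicator (space M - B) \<omega> \<le> (2 * real n * real_of_int (b - a) + 2 * real d) + (\<Sum>y=a..b. V y \<omega>)"
      using near AE_ramp_bound[OF \<open>a < b\<close>, of n]
    proof eventually_elim
      case (elim \<omega>)
      have nn: "0 \<le> (2 * real n * real_of_int (b - a) + 2 * real d) + (\<Sum>y=a..b. V y \<omega>)"
        using \<open>a < b\<close> V(3) by (intro add_nonneg_nonneg sum_nonneg) auto
      show ?case
      proof (cases "\<omega> \<in> space M - B")
        case True
        hence near: "\<bar>int (odo n y \<omega>) - int (m y)\<bar> \<le> int d" "odo n y \<omega> \<le> K" if "y \<in> {a..b}" for y
          using elim that by auto
        have "(\<Sum>y=a..b. \<bar>stack_total y (odo n y \<omega>) \<omega>\<bar>) \<le> (\<Sum>y=a..b. V y \<omega>)"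
          using near V(4) by (intro sum_mono) auto
        moreover have "\<bar>int (odo n a \<omega>) - int (m a)\<bar> \<le> int d" "\<bar>int (odo n b \<omega>) - int (m b)\<bar> \<le> int d"
          using near \<open>a < b\<close> by auto
        ultimately have "\<Delta> \<le> (2 * real n * real_of_int (b - a) + 2 * real d) + (\<Sum>y=a..b. V y \<omega>)"
          using elim(2) unfolding \<Delta>_def by linarith
        thus ?thesis using True by simp
      next
        case False
        thus ?thesis using nn by simp
      qed
    qed
  qed
  also have "\<dots> = (2 * real n * real_of_int (b - a) + 2 * real d) + (\<Sum>y=a..b. expectation (V y))"
    using V(1) by (simp add: prob_space)
  also have "(\<Sum>y=a..b. expectation (V y)) \<le> (\<Sum>y=a..b. 8 * sqrt (real K))"
    by (intro sum_mono V)
  also have "\<dots> = 8 * sqrt (real K) * real_of_int (b - a + 1)" using \<open>a < b\<close> by simp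
  finally show ?thesis by (simp add: \<Delta>_def)
qed

text \<open>On the exceptional event \<open>B\<close> the sum is controlled by its second moment, through
  \<open>D \<le> (\<theta> D\<^sup>2 + 1 / \<theta>) / 2\<close>.\<close>

lemma tent_deviation:
  fixes c H :: int and m :: "int \<Rightarrow> nat" and \<theta> :: real
  assumes "H \<ge> 1" and B: "B \<in> events" and "\<theta> > 0"
    and near: "AE \<omega> in M. \<omega> \<notin> B \<longrightarrow> (\<forall>y\<in>{c-H-1..c+H+1}. \<bar>int (odo n y \<omega>) - int (m y)\<bar> \<le> int d \<and> odo n y \<omega> \<le> K)"
    and mK: "\<And>y. y \<in> {c-H-1..c+H+1} \<Longrightarrow> m y \<le> K"
  defines "T \<equiv> 2 * real n * real_of_int (tent c H 0) + real (m (c + H)) + real (m (c - H)) - 2 * real (m c)"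
  shows "\<bar>(\<Sum>y=c-H..c+H. real_of_int (tent c H y) * mean_abs (m (y - 1) + m (y + 1))) - T\<bar>
    \<le> 4 * real d + prob B * \<bar>T\<bar> + real_of_int (2 * H + 1) * (8 * sqrt (real K))
      + real_of_int (2 * H + 1) * real_of_int H * (16 * sqrt (2 * real d) + (\<theta> * real K + prob B / \<theta>) / 2)"
proof -
  define A where "A = {c-H..c+H}"
  define D where "D = (\<lambda>y \<omega>. \<bar>site_diff m y \<omega>\<bar> / 2)"
  define Z where "Z = (\<lambda>\<omega>. \<Sum>y\<in>A. real_of_int (tent c H y) * D y \<omega>)"
  note tb = tent_bounds[of H c]
  have t0: "0 \<le> real_of_int (tent c H y)" "real_of_int (tent c H y) \<le> real_of_int H" for y
    using tb[of y] \<open>H \<ge> 1\<close> by auto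
  have cardA: "real (card A) = real_of_int (2 * H + 1)" "finite A" using \<open>H \<ge> 1\<close> by (simp_all add: A_def)
  obtain V where V: "\<And>y. integrable M (V y)" "\<And>y. expectation (V y) \<le> 8 * sqrt (real K)" "\<And>y \<omega>. V y \<omega> \<ge> 0"
    "\<And>y m \<omega>. m \<le> K \<Longrightarrow> \<bar>stack_total y m \<omega>\<bar> \<le> V y \<omega>"
    using stack_total_maximal[of K] by metis
  obtain W where W: "\<And>y. integrable M (W y)" "\<And>y. expectation (W y) \<le> 16 * sqrt (2 * real d)" "\<And>y \<omega>. W y \<omega> \<ge> 0"
    "\<And>y k \<omega>. \<bar>int k - int (m y)\<bar> \<le> int d \<Longrightarrow> \<bar>stack_diff y k \<omega> - stack_diff y (m y) \<omega>\<bar> \<le> W y \<omega>"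
    using stack_diff_maximal[of d "m y" y for y] by metis
  note mom = stack_diff_moments[of "y - 1" "y + 1" "m (y - 1)" "m (y + 1)" for y, simplified]
  have D_int: "integrable M (D y)" and D2_int: "integrable M (\<lambda>\<omega>. (D y \<omega>)\<^sup>2)"
    and ED: "expectation (D y) = mean_abs (m (y - 1) + m (y + 1))"
    and ED2: "expectation (\<lambda>\<omega>. (D y \<omega>)\<^sup>2) = (real (m (y - 1)) + real (m (y + 1))) / 2" for y
    using mom[of y] by (simp_all add: D_def power_divide)
  have Z_int: "integrable M Z" unfolding Z_def using D_int by simp
  have EZ: "expectation Z = (\<Sum>y\<in>A. real_of_int (tent c H y) * mean_abs (m (y - 1) + m (y + 1)))"
    unfolding Z_def using D_int by (simp add: ED)
  \<comment> \<open>\<open>R\<close> bounds the error off \<open>B\<close>: the shift of the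
    odometer at the atoms of the Laplacian, whose weights 1, 1, 2 give \<open>4 * d\<close>, then
    the gradient term, then the passage from the odometer to \<open>m\<close> inside the stack
    differences. \<open>Q\<close> bounds the error on \<open>B\<close>.\<close>
  define R where "R = (\<lambda>\<omega>. 4 * real d + (\<Sum>y\<in>A. V y \<omega>) + (\<Sum>y\<in>A. real_of_int H * ((W (y - 1) \<omega> + W (y + 1) \<omega>) / 2)))"
  define Q where "Q = (\<lambda>\<omega>. \<bar>T\<bar> * indicator B \<omega> + (\<Sum>y\<in>A. real_of_int H * ((\<theta> * (D y \<omega>)\<^sup>2 + indicator B \<omega> / \<theta>) / 2)))"
  have R_int: "integrable M R" unfolding R_def using V(1) W(1) by simp
  have B_int: "integrable M (indicator B :: 'a \<Rightarrow> real)" using B by (intro integrable_real_indicator) (auto simp: emeasure_eq_measure)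
  have Q_int: "integrable M Q" unfolding Q_def using D2_int B_int by simp
  have "\<bar>expectation Z - T\<bar> = \<bar>expectation (\<lambda>\<omega>. Z \<omega> - T)\<bar>" using Z_int by (simp add: prob_space)
  also have "\<dots> \<le> expectation (\<lambda>\<omega>. \<bar>Z \<omega> - T\<bar>)" by (rule integral_abs_bound)
  also have "\<dots> \<le> expectation (\<lambda>\<omega>. R \<omega> + Q \<omega>)"
  proof (rule integral_mono_AE)
    show "integrable M (\<lambda>\<omega>. \<bar>Z \<omega> - T\<bar>)" using Z_int by simp
    show "integrable M (\<lambda>\<omega>. R \<omega> + Q \<omega>)" using R_int Q_int by simp
    show "AE \<omega> in M. \<bar>Z \<omega> - T\<bar> \<le> R \<omega> + Q \<omega>"
      using near AE_tent_identity[OF \<open>H \<ge> 1\<close>, of c n]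
    proof eventually_elim
      case (elim \<omega>)
      have D0: "D y \<omega> \<ge> 0" for y by (simp add: D_def)
      have R0: "R \<omega> \<ge> 0" unfolding R_def using V(3) W(3) \<open>H \<ge> 1\<close>
        by (intro add_nonneg_nonneg sum_nonneg mult_nonneg_nonneg divide_nonneg_nonneg) auto
      have Q0: "Q \<omega> \<ge> 0" unfolding Q_def using \<open>H \<ge> 1\<close> \<open>\<theta> > 0\<close>
        by (intro add_nonneg_nonneg sum_nonneg mult_nonneg_nonneg divide_nonneg_nonneg) auto
      show ?case
      proof (cases "\<omega> \<in> B")
        case True
        have "\<bar>Z \<omega> - T\<bar> \<le> \<bar>T\<bar> + Z \<omega>"
          using sum_nonneg[of A "\<lambda>y. real_of_int (tent c H y) * D y \<omega>"] t0 D0 by (simp add: Z_def)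
        also have "Z \<omega> \<le> (\<Sum>y\<in>A. real_of_int H * ((\<theta> * (D y \<omega>)\<^sup>2 + 1 / \<theta>) / 2))"
          unfolding Z_def
        proof (rule sum_mono)
          fix y
          have "0 \<le> (\<theta> * D y \<omega> - 1)\<^sup>2 / \<theta>" using \<open>\<theta> > 0\<close> by simp
          hence "D y \<omega> \<le> (\<theta> * (D y \<omega>)\<^sup>2 + 1 / \<theta>) / 2" using \<open>\<theta> > 0\<close>
            by (simp add: power2_eq_square field_simps)
          thus "real_of_int (tent c H y) * D y \<omega> \<le> real_of_int H * ((\<theta> * (D y \<omega>)\<^sup>2 + 1 / \<theta>) / 2)"
            using t0[of y] D0[of y] \<open>H \<ge> 1\<close> by (intro mult_mono) auto
        qed
        also have "\<bar>T\<bar> + \<dots> = Q \<omega>" using True by (simp add: Q_def)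
        finally show ?thesis using R0 by simp
      next
        case False
        hence nr: "\<bar>int (odo n y \<omega>) - int (m y)\<bar> \<le> int d" "odo n y \<omega> \<le> K" if "y \<in> {c-H-1..c+H+1}" for y
          using elim that by auto
        define D' where "D' = (\<lambda>y. \<bar>site_diff (\<lambda>y. odo n y \<omega>) y \<omega>\<bar> / 2)"
        define T' where "T' = 2 * real n * real_of_int (tent c H 0) + real (odo n (c + H) \<omega>) + real (odo n (c - H) \<omega>) - 2 * real (odo n c \<omega>)"
        have "(\<Sum>y\<in>A. \<bar>stack_total y (odo n y \<omega>) \<omega>\<bar>) \<le> (\<Sum>y\<in>A. V y \<omega>)"
          using nr V(4) by (intro sum_mono) (auto simp: A_def)
        hence 1: "\<bar>(\<Sum>y\<in>A. real_of_int (tent c H y) * D' y) - T'\<bar> \<le> (\<Sum>y\<in>A. V y \<omega>)"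
          using elim(2) unfolding D'_def T'_def A_def by linarith
        have 2: "\<bar>T' - T\<bar> \<le> 4 * real d"
          using nr(1)[of "c + H"] nr(1)[of "c - H"] nr(1)[of c] \<open>H \<ge> 1\<close> unfolding T_def T'_def by auto
        have "\<bar>Z \<omega> - (\<Sum>y\<in>A. real_of_int (tent c H y) * D' y)\<bar> = \<bar>\<Sum>y\<in>A. real_of_int (tent c H y) * (D y \<omega> - D' y)\<bar>"
          unfolding Z_def by (simp add: right_diff_distrib sum_subtractf)
        also have "\<dots> \<le> (\<Sum>y\<in>A. \<bar>real_of_int (tent c H y) * (D y \<omega> - D' y)\<bar>)" by (rule sum_abs)
        also have "\<dots> \<le> (\<Sum>y\<in>A. real_of_int H * ((W (y - 1) \<omega> + W (y + 1) \<omega>) / 2))"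
        proof (rule sum_mono)
          fix y assume "y \<in> A"
          hence "\<bar>stack_diff (y - 1) (odo n (y - 1) \<omega>) \<omega> - stack_diff (y - 1) (m (y - 1)) \<omega>\<bar> \<le> W (y - 1) \<omega>"
            "\<bar>stack_diff (y + 1) (odo n (y + 1) \<omega>) \<omega> - stack_diff (y + 1) (m (y + 1)) \<omega>\<bar> \<le> W (y + 1) \<omega>"
            by (intro W(4) nr(1); simp add: A_def)+
          moreover have "\<bar>\<bar>a - b\<bar> / 2 - \<bar>a' - b'\<bar> / 2\<bar> \<le> (p + q) / 2" if "\<bar>a' - a\<bar> \<le> p" "\<bar>b' - b\<bar> \<le> q" for a b a' b' p q :: real
          proof -
            have "\<bar>a - b - (a' - b')\<bar> \<le> p + q" using that by linarith
            with abs_triangle_ineq3[of "a - b" "a' - b'"] have "\<bar>\<bar>a - b\<bar> - \<bar>a' - b'\<bar>\<bar> \<le> p + q" by (rule order_trans)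
            thus ?thesis unfolding diff_divide_distrib[symmetric] abs_divide by simp
          qed
          ultimately have "\<bar>D y \<omega> - D' y\<bar> \<le> (W (y - 1) \<omega> + W (y + 1) \<omega>) / 2" unfolding D_def D'_def by blast
          thus "\<bar>real_of_int (tent c H y) * (D y \<omega> - D' y)\<bar> \<le> real_of_int H * ((W (y - 1) \<omega> + W (y + 1) \<omega>) / 2)"
            unfolding abs_mult using t0[of y] by (intro mult_mono) auto
        qed
        finally have 3: "\<bar>Z \<omega> - (\<Sum>y\<in>A. real_of_int (tent c H y) * D' y)\<bar> \<le> (\<Sum>y\<in>A. real_of_int H * ((W (y - 1) \<omega> + W (y + 1) \<omega>) / 2))" .
        have "\<bar>Z \<omega> - T\<bar> \<le> R \<omega>" unfolding R_def using 1 2 3 by linarith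
        thus ?thesis using Q0 by simp
      qed
    qed
  qed
  also have "\<dots> = expectation R + expectation Q" using R_int Q_int by simp
  also have "expectation R = 4 * real d + (\<Sum>y\<in>A. expectation (V y)) + (\<Sum>y\<in>A. real_of_int H * ((expectation (W (y - 1)) + expectation (W (y + 1))) / 2))"
    unfolding R_def using V(1) W(1) by (simp add: prob_space)
  also have "\<dots> \<le> 4 * real d + (\<Sum>y\<in>A. 8 * sqrt (real K)) + (\<Sum>y\<in>A. real_of_int H * (16 * sqrt (2 * real d)))"
  proof (intro add_mono sum_mono mult_left_mono order_refl V(2))
    fix y show "(expectation (W (y - 1)) + expectation (W (y + 1))) / 2 \<le> 16 * sqrt (2 * real d)"
      using W(2)[of "y - 1"] W(2)[of "y + 1"] by simp
  qed (use \<open>H \<ge> 1\<close> in auto)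
  also have "expectation Q = \<bar>T\<bar> * prob B + (\<Sum>y\<in>A. real_of_int H * ((\<theta> * expectation (\<lambda>\<omega>. (D y \<omega>)\<^sup>2) + prob B / \<theta>) / 2))"
    unfolding Q_def using D2_int B_int B by (simp add: Int_absorb2 sets.sets_into_space)
  also have "\<dots> \<le> \<bar>T\<bar> * prob B + (\<Sum>y\<in>A. real_of_int H * ((\<theta> * real K + prob B / \<theta>) / 2))"
  proof (intro add_mono sum_mono mult_left_mono divide_right_mono order_refl)
    fix y assume "y \<in> A"
    hence "m (y - 1) \<le> K" "m (y + 1) \<le> K" by (intro mK; simp add: A_def)+
    thus "expectation (\<lambda>\<omega>. (D y \<omega>)\<^sup>2) \<le> real K" unfolding ED2 by simp
  qed (use \<open>H \<ge> 1\<close> \<open>\<theta> > 0\<close> in auto)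
  finally have "\<bar>expectation Z - T\<bar> \<le> 4 * real d + (\<Sum>y\<in>A. 8 * sqrt (real K)) + (\<Sum>y\<in>A. real_of_int H * (16 * sqrt (2 * real d)))
    + (\<bar>T\<bar> * prob B + (\<Sum>y\<in>A. real_of_int H * ((\<theta> * real K + prob B / \<theta>) / 2)))" by simp
  also have "\<dots> = 4 * real d + prob B * \<bar>T\<bar> + real_of_int (2 * H + 1) * (8 * sqrt (real K))
      + real_of_int (2 * H + 1) * real_of_int H * (16 * sqrt (2 * real d) + (\<theta> * real K + prob B / \<theta>) / 2)"
    unfolding sum_constant cardA(1) by (simp only: distrib_left mult_ac add_ac)
  finally show ?thesis unfolding EZ by (simp add: A_def)
qed

end

section \<open>The limiting differential equation\<close>

text \<open>\<open>D\<close> is nondecreasing by the equation; being bounded, it forces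
  \<open>V\<close> to come arbitrarily close to 0, and then \<open>V\<close> must be nonincreasing.
  Hence the conserved energy \<open>D\<^sup>2 - 16 * (V * sqrt V)\<close> is 0, which makes the
  slope of the fourth root of \<open>V\<close> equal to -1 as long as \<open>V\<close> is
  positive.\<close>

lemma quartic_profile:
  fixes V D :: "real \<Rightarrow> real"
  assumes V: "\<And>x. x \<ge> 0 \<Longrightarrow> (V has_real_derivative D x) (at x)"
    and D: "\<And>x. x \<ge> 0 \<Longrightarrow> (D has_real_derivative 12 * sqrt (V x)) (at x)"
    and nonneg: "\<And>x. x \<ge> 0 \<Longrightarrow> V x \<ge> 0"
    and bounded: "\<And>x. x \<ge> 0 \<Longrightarrow> \<bar>D x\<bar> \<le> B"
  obtains a where "a \<ge> 0" "\<And>x. x \<ge> 0 \<Longrightarrow> V x = (max 0 (a - x)) ^ 4" "D 0 = - 4 * a ^ 3"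
proof -
  have D_mono: "D x \<le> D y" if "0 \<le> x" "x \<le> y" for x y
    using that(2)
  proof (rule DERIV_nonneg_imp_nondecreasing)
    fix z assume "x \<le> z" "z \<le> y"
    thus "\<exists>d. (D has_real_derivative d) (at z) \<and> 0 \<le> d"
      using D[of z] nonneg[of z] that by (intro exI[of _ "12 * sqrt (V z)"]) auto
  qed
  have V_small: "\<exists>x\<ge>x1. V x < \<epsilon>" if "x1 \<ge> 0" "\<epsilon> > 0" for x1 \<epsilon>
  proof (rule ccontr)
    assume "\<not> ?thesis"
    hence ge: "V x \<ge> \<epsilon>" if "x \<ge> x1" for x using that by (auto simp: not_less)
    \<comment> \<open>Over a stretch of this length with \<open>V \<ge> \<epsilon>\<close>,
      \<open>D\<close> would grow by at least \<open>2 * \<bar>B\<bar> + 1\<close>, more than its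
      bound allows.\<close>
    define x where "x = x1 + (2 * \<bar>B\<bar> + 1) / (12 * sqrt \<epsilon>)"
    have "x > x1" using that by (simp add: x_def)
    have "\<exists>z>x1. z < x \<and> D x - D x1 = (x - x1) * (12 * sqrt (V z))"
      by (rule MVT2[OF \<open>x > x1\<close>]) (use D that in auto)
    then obtain z where z: "z > x1" "z < x" "D x - D x1 = (x - x1) * (12 * sqrt (V z))"
      by blast
    have "(x - x1) * (12 * sqrt \<epsilon>) \<le> (x - x1) * (12 * sqrt (V z))"
      using ge[of z] z \<open>x > x1\<close> by (intro mult_left_mono) auto
    moreover have "(x - x1) * (12 * sqrt \<epsilon>) = 2 * \<bar>B\<bar> + 1" using that by (simp add: x_def)
    ultimately have "D x - D x1 \<ge> 2 * \<bar>B\<bar> + 1" using z by simp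
    moreover have "\<bar>D x\<bar> \<le> B" "\<bar>D x1\<bar> \<le> B" using bounded[of x] bounded[of x1] that \<open>x > x1\<close> by auto
    ultimately show False by linarith
  qed
  have D_le: "D x \<le> 0" if "x \<ge> 0" for x
  proof (rule ccontr)
    assume "\<not> ?thesis"
    hence d: "D x > 0" by simp
    \<comment> \<open>As \<open>D\<close> is nondecreasing, \<open>V\<close> has gained at least 1
      from this point on, so it can no longer fall below 1.\<close>
    define x1 where "x1 = x + 1 / D x"
    have "x1 \<ge> 0" using that d by (simp add: x1_def)
    then obtain y where y: "y \<ge> x1" "V y < 1" using V_small[of x1 1] by auto
    have "1 / D x > 0" using d by simp
    hence "y > x" using y unfolding x1_def by linarith
    then have "\<exists>z>x. z < y \<and> V y - V x = (y - x) * D z"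
      by (rule MVT2) (use V that in auto)
    then obtain z where z: "z > x" "z < y" "V y - V x = (y - x) * D z" by blast
    have "1 / D x \<le> y - x" using y by (simp add: x1_def)
    hence "1 \<le> (y - x) * D x" using d by (simp add: field_simps)
    also have "\<dots> \<le> (y - x) * D z" using D_mono[of x z] that z by (intro mult_left_mono) auto
    finally have "V y \<ge> 1" using z nonneg[OF that] by simp
    with y show False by simp
  qed
  have V_anti: "V y \<le> V x" if "0 \<le> x" "x \<le> y" for x y
    using that(2)
  proof (rule DERIV_nonpos_imp_nonincreasing)
    fix z assume "x \<le> z" "z \<le> y"
    thus "\<exists>d. (V has_real_derivative d) (at z) \<and> d \<le> 0"
      using V[of z] D_le[of z] that by auto
  qed
  have D_small: "\<exists>x\<ge>0. D x > - \<epsilon>" if "\<epsilon> > 0" for \<epsilon>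
  proof (rule ccontr)
    assume "\<not> ?thesis"
    hence le: "D x \<le> - \<epsilon>" if "x \<ge> 0" for x using that by (auto simp: not_less)
    define x where "x = (V 0 + 1) / \<epsilon>"
    have "x > 0" using that nonneg[of 0] by (simp add: x_def)
    then have "\<exists>z>0. z < x \<and> V x - V 0 = (x - 0) * D z"
      by (rule MVT2) (use V in auto)
    then obtain z where z: "z > 0" "z < x" "V x - V 0 = (x - 0) * D z" by blast
    have "(x - 0) * D z \<le> (x - 0) * (- \<epsilon>)" using le[of z] z \<open>x > 0\<close> by (intro mult_left_mono) auto
    also have "\<dots> = - V 0 - 1" using that by (simp add: x_def)
    finally have "V x < 0" using z by simp
    thus False using nonneg[of x] \<open>x > 0\<close> by simp
  qed
  \<comment> \<open>The chain rule for the energy is also applied where \<open>V\<close> vanishes.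
    At \<open>t = 0\<close> the difference quotient is \<open>sqrt h\<close>, which tends to 0 from
    both sides because \<open>sqrt\<close> is extended to negative arguments as an odd
    function.\<close>
  have root_deriv: "((\<lambda>t. t * sqrt t) has_real_derivative 3 / 2 * sqrt t) (at t)" if "t \<ge> 0" for t :: real
  proof (cases "t = 0")
    case True
    have "((\<lambda>h. sqrt h) \<longlongrightarrow> sqrt 0) (at (0::real))"
      by (rule tendsto_real_sqrt[OF tendsto_ident_at])
    hence "((\<lambda>h::real. ((0 + h) * sqrt (0 + h) - 0 * sqrt 0) / h) \<longlongrightarrow> sqrt 0) (at 0)"
      by (rule Lim_transform_eventually) (auto simp: eventually_at intro!: exI[of _ 1])
    thus ?thesis using True by (simp add: DERIV_def)
  next
    case False
    hence "t > 0" using that by simp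
    have "inverse (sqrt t) / 2 * t = (t / sqrt t) / 2" by (simp only: divide_inverse mult_ac)
    also have "t / sqrt t = sqrt t" using \<open>t > 0\<close> by (intro real_div_sqrt) simp
    finally have "1 * sqrt t + inverse (sqrt t) / 2 * t = 3 / 2 * sqrt t" by (simp only: mult_1)
    thus ?thesis
      by (rule DERIV_cong[OF DERIV_mult[OF DERIV_ident DERIV_real_sqrt[OF \<open>t > 0\<close>]]])
  qed
  define en where "en = (\<lambda>x. (D x)\<^sup>2 - 16 * (V x * sqrt (V x)))"
  have "(en has_real_derivative 0) (at x)" if "x \<ge> 0" for x
  proof -
    have "((\<lambda>x. V x * sqrt (V x)) has_real_derivative 3 / 2 * sqrt (V x) * D x) (at x)"
      using DERIV_chain2[OF root_deriv[OF nonneg[OF that]] V[OF that]] .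
    from DERIV_diff[OF DERIV_power[OF D[OF that], of 2] DERIV_cmult[OF this, of 16]]
    show ?thesis by (simp add: en_def mult_ac)
  qed
  hence en_const: "en x = en 0" if "x \<ge> 0" for x
  proof (cases "x = 0")
    case False
    hence "x > 0" using that by simp
    then have "\<exists>z>0. z < x \<and> en x - en 0 = (x - 0) * 0"
      by (rule MVT2) (use \<open>\<And>x. x \<ge> 0 \<Longrightarrow> (en has_real_derivative 0) (at x)\<close> in auto)
    thus ?thesis by auto
  qed simp
  have "en 0 = 0"
  proof (rule ccontr)
    assume "en 0 \<noteq> 0"
    \<comment> \<open>Once \<open>\<bar>D\<bar>\<close> is below \<epsilon> it stays so, since
      \<open>D\<close> is nondecreasing and nonpositive; \<open>V\<close> is then small at some
      later point. There the energy is at most \<open>17 * \<epsilon>\<close>, less than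
      \<open>18 * \<epsilon>\<close>.\<close>
    define \<epsilon> where "\<epsilon> = min 1 (\<bar>en 0\<bar> / 18)"
    have e: "\<epsilon> > 0" "\<epsilon> \<le> 1" "18 * \<epsilon> \<le> \<bar>en 0\<bar>" using \<open>en 0 \<noteq> 0\<close> by (auto simp: \<epsilon>_def)
    obtain x1 where x1: "x1 \<ge> 0" "D x1 > - \<epsilon>" using D_small[OF e(1)] by blast
    obtain x where x: "x \<ge> x1" "V x < \<epsilon>" using V_small[OF x1(1) e(1)] by blast
    have "x \<ge> 0" using x x1 by simp
    have "D x1 \<le> D x" using D_mono[of x1 x] x x1 by simp
    hence "\<bar>D x\<bar> \<le> \<epsilon>" using x1 D_le[OF \<open>x \<ge> 0\<close>] by simp
    hence "(D x)\<^sup>2 \<le> \<epsilon>\<^sup>2" by (metis abs_ge_zero power2_abs power_mono)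
    also have "\<dots> \<le> \<epsilon>" using e by (simp add: power2_eq_square mult_left_le)
    finally have 1: "(D x)\<^sup>2 \<le> \<epsilon>" .
    have "V x * sqrt (V x) \<le> V x * 1" using x e nonneg[OF \<open>x \<ge> 0\<close>] by (intro mult_left_mono) auto
    hence 2: "V x * sqrt (V x) \<le> \<epsilon>" "V x * sqrt (V x) \<ge> 0" using x nonneg[OF \<open>x \<ge> 0\<close>] by auto
    have "\<bar>en x\<bar> \<le> \<epsilon> + 16 * \<epsilon>" unfolding en_def using 1 2 zero_le_power2[of "D x"] by linarith
    thus False using e en_const[OF \<open>x \<ge> 0\<close>] by simp
  qed
  define p where "p = (\<lambda>x. sqrt (sqrt (V x)))"
  have p_nonneg: "p x \<ge> 0" if "x \<ge> 0" for x using nonneg[OF that] by (simp add: p_def)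
  have Vp: "V x = p x ^ 4" if "x \<ge> 0" for x
  proof -
    have "p x ^ 2 = sqrt (V x)" "sqrt (V x) ^ 2 = V x" using nonneg[OF that] by (simp_all add: p_def)
    moreover have "p x ^ 4 = (p x ^ 2) ^ 2" by (simp flip: power_mult)
    ultimately show ?thesis by simp
  qed
  have Dp: "D x = - 4 * p x ^ 3" if "x \<ge> 0" for x
  proof -
    have "sqrt (V x) = p x ^ 2" using nonneg[OF that] by (simp add: p_def)
    hence "(D x)\<^sup>2 = 16 * (p x ^ 4 * p x ^ 2)"
      using en_const[OF that] \<open>en 0 = 0\<close> Vp[OF that] by (simp add: en_def)
    also have "\<dots> = (4 * p x ^ 3)\<^sup>2"
      by (simp add: power_mult_distrib power_mult[symmetric] power_add[symmetric])
    finally have "\<bar>D x\<bar> = \<bar>4 * p x ^ 3\<bar>" by (simp only: power2_eq_iff) auto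
    thus ?thesis using D_le[OF that] p_nonneg[OF that] by simp
  qed
  have p_cont: "continuous_on {0..} p"
    unfolding p_def using V
    by (intro continuous_on_real_sqrt) (auto intro!: continuous_at_imp_continuous_on DERIV_isCont)
  have p_lin: "p x = p 0 - x" if "x \<ge> 0" "V x > 0" for x
  proof (cases "x = 0")
    case False
    hence "x > 0" using that by simp
    have der: "(p has_real_derivative -1) (at y)" if "0 \<le> y" "y \<le> x" for y
    proof -
      have Vy: "V y > 0" using V_anti[of y x] \<open>V x > 0\<close> that by simp
      hence "p y > 0" by (simp add: p_def)
      have "(p has_real_derivative (inverse (sqrt (sqrt (V y))) / 2) * ((inverse (sqrt (V y)) / 2) * D y)) (at y)"
        unfolding p_def using Vy
        by (intro DERIV_chain2[OF DERIV_real_sqrt] V that) auto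
      moreover have "sqrt (V y) = p y ^ 2" using Vy by (simp add: p_def)
      hence "(inverse (sqrt (sqrt (V y))) / 2) * ((inverse (sqrt (V y)) / 2) * D y) = -1"
        using \<open>p y > 0\<close> unfolding Dp[OF that(1)] by (simp add: field_simps power2_eq_square power3_eq_cube)
      ultimately show ?thesis by simp
    qed
    have "\<exists>z>0. z < x \<and> p x - p 0 = (x - 0) * (-1)"
      by (rule MVT2[OF \<open>x > 0\<close>]) (use der in auto)
    thus ?thesis by auto
  qed simp
  show ?thesis
  proof (rule that[of "p 0"])
    show "p 0 \<ge> 0" by (rule p_nonneg) simp
    show "D 0 = - 4 * p 0 ^ 3" by (rule Dp) simp
    fix x :: real assume "x \<ge> 0"
    have "p x = max 0 (p 0 - x)"
    proof (cases "V x > 0")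
      case True
      then show ?thesis using p_lin[OF \<open>x \<ge> 0\<close> True] p_nonneg[OF \<open>x \<ge> 0\<close>] by simp
    next
      case False
      hence "V x = 0" using nonneg[OF \<open>x \<ge> 0\<close>] by simp
      hence px: "p x = 0" by (simp add: p_def)
      have "p 0 \<le> x"
      proof (rule ccontr)
        assume "\<not> p 0 \<le> x"
        hence gt: "p 0 > x" by simp
        \<comment> \<open>If \<open>p\<close> vanished at \<open>x < p 0\<close>, it would take the
          value \<open>(p 0 - x) / 2\<close> at some \<open>y \<le> x\<close>. There
          \<open>V y > 0\<close>, so \<open>p y = p 0 - y \<ge> p 0 - x\<close>, which is
          larger.\<close>
        have "\<exists>y. 0 \<le> y \<and> y \<le> x \<and> p y = (p 0 - x) / 2"
          using gt px \<open>x \<ge> 0\<close> by (intro IVT2') (auto intro!: continuous_on_subset[OF p_cont])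
        then obtain y where y: "0 \<le> y" "y \<le> x" "p y = (p 0 - x) / 2" by blast
        hence "V y > 0" using Vp[of y] gt by simp
        from p_lin[OF y(1) this] y gt show False by simp
      qed
      thus ?thesis using px by simp
    qed
    thus "V x = (max 0 (p 0 - x)) ^ 4" using Vp[OF \<open>x \<ge> 0\<close>] by simp
  qed
qed

text \<open>Subtracting the chord through 0 and 1 leaves an additive function \<open>q\<close> that
  vanishes at the integers. It is bounded on \<open>{0..1}\<close> by continuity, hence everywhere,
  and a bounded additive function is 0.\<close>

lemma continuous_midpoint_affine:
  fixes v :: "real \<Rightarrow> real"
  assumes cont: "continuous_on UNIV v" and mid: "\<And>z h. v (z + h) + v (z - h) = 2 * v z"
  obtains b where "\<And>x. v x = v 0 + b * x"
proof -
  define b where "b = v 1 - v 0"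
  define q where "q = (\<lambda>x. v x - v 0 - b * x)"
  have add: "q (x + y) = q x + q y" for x y
  proof -
    have "(x + y) / 2 + (x - y) / 2 = x" "(x + y) / 2 - (x - y) / 2 = y" "(x + y) / 2 + (x + y) / 2 = x + y"
      by (simp_all add: field_simps)
    hence "v x + v y = 2 * v ((x + y) / 2)" "v (x + y) + v 0 = 2 * v ((x + y) / 2)"
      using mid[of "(x + y) / 2" "(x - y) / 2"] mid[of "(x + y) / 2" "(x + y) / 2"]
      by (simp_all only: diff_self)
    thus ?thesis unfolding q_def distrib_left by argo
  qed
  have q1: "q 1 = 0" by (simp add: q_def b_def)
  have q0: "q 0 = 0" by (simp add: q_def)
  have qneg: "q (- x) = - q x" for x using add[of x "- x"] q0 by simp
  have nat: "q (real n * x) = real n * q x" for n x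
    by (induction n) (simp_all add: q0 add distrib_right)
  have int: "q (of_int k) = 0" for k
    using nat[of "nat \<bar>k\<bar>" 1] q1 qneg[of "of_int k"] by (cases "k \<ge> 0") auto
  have "continuous_on {0..1} q" unfolding q_def
    by (intro continuous_intros continuous_on_subset[OF cont]) auto
  hence "bounded (q ` {0..1})" by (intro compact_imp_bounded compact_continuous_image) auto
  then obtain B where "\<forall>y\<in>q ` {0..1}. norm y \<le> B" by (auto simp only: bounded_iff)
  hence B: "\<bar>q x\<bar> \<le> B" if "x \<in> {0..1}" for x using that by auto
  have qB: "\<bar>q x\<bar> \<le> B" for x
  proof -
    have "q x = q (frac x) + q (of_int \<lfloor>x\<rfloor>)" unfolding add[symmetric] by (simp add: frac_def)
    thus ?thesis using B[of "frac x"] frac_ge_0[of x] frac_lt_1[of x] by (simp add: int)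
  qed
  have q_zero: "q x = 0" for x
  proof (rule ccontr)
    assume "q x \<noteq> 0"
    then obtain n where "real n * \<bar>q x\<bar> > B" using reals_Archimedean3[of "\<bar>q x\<bar>"] by auto
    with qB[of "real n * x"] nat[of n x] show False by (simp add: abs_mult)
  qed
  have "v x = v 0 + b * x" for x using q_zero[of x] unfolding q_def by linarith
  thus ?thesis by (rule that)
qed

lemma antiderivative_real_exists:
  fixes g :: "real \<Rightarrow> real"
  assumes "continuous_on UNIV g"
  obtains G where "\<And>x. (G has_real_derivative g x) (at x)"
proof -
  have "\<exists>F. \<forall>x::real. -\<infinity> < ereal x \<longrightarrow> ereal x < \<infinity> \<longrightarrow> (F has_vector_derivative g x) (at x)"
    using assms by (intro einterval_antiderivative) (auto simp: continuous_on_eq_continuous_at)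
  thus ?thesis using that by (auto simp: has_real_derivative_iff_has_vector_derivative)
qed

text \<open>A second difference of \<open>F\<close> is its second derivative integrated against a
  tent. On the right half the integrand has the primitive \<open>(h - (y - z)) * G y + F y\<close>,
  on the left half \<open>(h + (y - z)) * G y - F y\<close>.\<close>

lemma integral_tent:
  fixes g G F :: "real \<Rightarrow> real"
  assumes G: "\<And>x. (G has_real_derivative g x) (at x)" and F: "\<And>x. (F has_real_derivative G x) (at x)"
    and "h \<ge> 0"
  shows "((\<lambda>y. (h - \<bar>y - z\<bar>) * g y) has_integral (F (z + h) + F (z - h) - 2 * F z)) {z - h..z + h}"
proof -
  have "((\<lambda>y. (h - (y - z)) * g y) has_integral ((h - (z + h - z)) * G (z + h) + F (z + h)) - ((h - (z - z)) * G z + F z)) {z..z + h}"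
    using \<open>h \<ge> 0\<close>
    by (intro fundamental_theorem_of_calculus)
       (auto intro!: derivative_eq_intros DERIV_subset[OF G] DERIV_subset[OF F] simp: has_real_derivative_iff_has_vector_derivative[symmetric])
  hence r: "((\<lambda>y. (h - \<bar>y - z\<bar>) * g y) has_integral F (z + h) - (h * G z + F z)) {z..z + h}"
    by (subst has_integral_cong[where g = "\<lambda>y. (h - (y - z)) * g y"]) auto
  have "((\<lambda>y. (h + (y - z)) * g y) has_integral ((h + (z - z)) * G z - F z) - ((h + (z - h - z)) * G (z - h) - F (z - h))) {z - h..z}"
    using \<open>h \<ge> 0\<close>
    by (intro fundamental_theorem_of_calculus)
       (auto intro!: derivative_eq_intros DERIV_subset[OF G] DERIV_subset[OF F] simp: has_real_derivative_iff_has_vector_derivative[symmetric])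
  hence l: "((\<lambda>y. (h - \<bar>y - z\<bar>) * g y) has_integral (h * G z - F z + F (z - h))) {z - h..z}"
    by (subst has_integral_cong[where g = "\<lambda>y. (h + (y - z)) * g y"]) auto
  have "((\<lambda>y. (h - \<bar>y - z\<bar>) * g y) has_integral (h * G z - F z + F (z - h)) + (F (z + h) - (h * G z + F z))) {z - h..z + h}"
    by (rule has_integral_combine[OF _ _ l r]) (use \<open>h \<ge> 0\<close> in auto)
  thus ?thesis by (simp add: algebra_simps)
qed

text \<open>\<open>weak\<close> presupposes no derivative of \<open>w\<close>. Adding
  \<open>\<bar>x\<bar>\<close> cancels the source at 0, since its second differences are the same
  tents, and subtracting a second antiderivative \<open>F\<close> of the right-hand side leaves an
  affine function. This yields the derivatives of \<open>w\<close> away from 0.\<close>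

lemma profile_unique:
  fixes w :: "real \<Rightarrow> real"
  assumes nonneg: "\<And>x. w x \<ge> 0"
    and lip: "\<And>x y. \<bar>w x - w y\<bar> \<le> B * \<bar>x - y\<bar>"
    and weak: "\<And>z h. h > 0 \<Longrightarrow> w (z + h) + w (z - h) - 2 * w z + 2 * max 0 (h - \<bar>z\<bar>)
       = integral {z - h..z + h} (\<lambda>y. (h - \<bar>y - z\<bar>) * sqrt (2 * w y / pi))"
  shows "w x = (if \<bar>x\<bar> < (18 * pi) powr (1 / 3)
     then 1 / (72 * pi) * ((18 * pi) powr (1 / 3) - \<bar>x\<bar>) ^ 4 else 0)"
proof -
  have cont: "continuous_on UNIV w"
  proof (rule continuous_onI)
    fix x e :: real assume "e > 0"
    have B: "\<bar>w y - w x\<bar> \<le> (\<bar>B\<bar> + 1) * \<bar>y - x\<bar>" for y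
      by (rule order_trans[OF lip mult_right_mono]) auto
    show "\<exists>d>0. \<forall>x'\<in>UNIV. dist x' x < d \<longrightarrow> dist (w x') (w x) \<le> e"
    proof (intro exI conjI ballI impI)
      show "e / (\<bar>B\<bar> + 1) > 0" using \<open>e > 0\<close> by simp
      fix y assume "dist y x < e / (\<bar>B\<bar> + 1)"
      hence "(\<bar>B\<bar> + 1) * \<bar>y - x\<bar> \<le> e" by (simp add: dist_real_def field_simps)
      thus "dist (w y) (w x) \<le> e" using B[of y] by (simp add: dist_real_def)
    qed
  qed
  \<comment> \<open>Chosen so that \<open>V = w / c\<close> satisfies
    \<open>V'' = 12 * sqrt V\<close>, which requires
    \<open>2 / (pi * c) = 12\<^sup>2\<close>.\<close>
  define c where "c = 1 / (72 * pi)"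
  have c: "c > 0" by (simp add: c_def)
  define g where "g = (\<lambda>y. sqrt (2 * w y / pi))"
  have "continuous_on UNIV g" unfolding g_def by (intro continuous_intros cont) auto
  then obtain G where G: "\<And>x. (G has_real_derivative g x) (at x)" by (rule antiderivative_real_exists) blast
  hence "continuous_on UNIV G" by (auto intro!: continuous_at_imp_continuous_on DERIV_isCont)
  then obtain F where F: "\<And>x. (F has_real_derivative G x) (at x)" by (rule antiderivative_real_exists) blast
  hence Fc: "continuous_on UNIV F" by (auto intro!: continuous_at_imp_continuous_on DERIV_isCont)
  define v where "v = (\<lambda>x. w x + \<bar>x\<bar> - F x)"
  have "continuous_on UNIV v" unfolding v_def by (intro continuous_intros cont Fc)
  moreover have mid: "v (z + h) + v (z - h) = 2 * v z" if "h > 0" for z h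
  proof -
    have "w (z + h) + w (z - h) - 2 * w z + 2 * max 0 (h - \<bar>z\<bar>) = F (z + h) + F (z - h) - 2 * F z"
      unfolding weak[OF that] using integral_tent[OF G F, of h z] that by (auto simp: g_def intro: integral_unique)
    moreover have "\<bar>z + h\<bar> + \<bar>z - h\<bar> - 2 * \<bar>z\<bar> = 2 * max 0 (h - \<bar>z\<bar>)" using that by (auto simp: abs_if max_def)
    ultimately show ?thesis by (simp add: v_def)
  qed
  moreover have "v (z + h) + v (z - h) = 2 * v z" for z h
    using mid[of h z] mid[of "- h" z] by (cases h "0::real" rule: linorder_cases) (auto simp: add.commute)
  ultimately obtain b where b: "\<And>x. v x = v 0 + b * x" using continuous_midpoint_affine by blast
  have w_eq: "w x = v 0 + b * x - \<bar>x\<bar> + F x" for x using b[of x] by (simp add: v_def)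
  have half: "\<exists>a\<ge>0. (\<forall>x\<ge>0. w (s * x) = c * (max 0 (a - x)) ^ 4) \<and> s * (b + G 0) - 1 = - 4 * c * a ^ 3"
    if s: "s = 1 \<or> s = -1" for s :: real
  proof -
    \<comment> \<open>Writing \<open>x\<close> for \<open>\<bar>x\<bar>\<close> extends the
      half-line solution across 0, so \<open>V\<close> has a two-sided derivative there;
      \<open>s = -1\<close> reflects the negative half-line. The agreement with
      \<open>w (s * x) / c\<close> is for \<open>x \<ge> 0\<close>.\<close>
    define V where "V = (\<lambda>x. (v 0 + b * (s * x) - x + F (s * x)) / c)"
    define D where "D = (\<lambda>x. (b * s - 1 + s * G (s * x)) / c)"
    have Vw: "V x = w (s * x) / c" if "x \<ge> 0" for x using w_eq[of "s * x"] s that by (auto simp: V_def)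
    have Fs: "((\<lambda>x. F (s * x)) has_real_derivative G (s * x) * s) (at x)" for x
      by (rule DERIV_chain2[OF F]) (auto intro!: derivative_eq_intros)
    have Gs: "((\<lambda>x. G (s * x)) has_real_derivative g (s * x) * s) (at x)" for x
      by (rule DERIV_chain2[OF G]) (auto intro!: derivative_eq_intros)
    have VD: "(V has_real_derivative D x) (at x)" for x
      unfolding V_def D_def
      by (rule DERIV_cong[OF DERIV_cdivide[OF DERIV_add[OF DERIV_diff[OF DERIV_add[OF DERIV_const
              DERIV_cmult[OF DERIV_cmult_Id]] DERIV_ident] Fs]]]) simp
    have DD: "(D has_real_derivative 12 * sqrt (V x)) (at x)" if "x \<ge> 0" for x
    proof -
      have "s * (g (s * x) * s) / c = 12 * sqrt (V x)"
      proof -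
        have "s * (g (s * x) * s) = g (s * x)" using s by auto
        also have "g (s * x) = sqrt ((12 * c)\<^sup>2 * (w (s * x) / c))"
          unfolding g_def by (simp add: c_def power2_eq_square)
        also have "\<dots> = 12 * c * sqrt (V x)" unfolding real_sqrt_mult Vw[OF that] real_sqrt_abs using c by simp
        finally show ?thesis using c by simp
      qed
      moreover have "(D has_real_derivative s * (g (s * x) * s) / c) (at x)"
        unfolding D_def
        by (rule DERIV_cong[OF DERIV_cdivide[OF DERIV_add[OF DERIV_const DERIV_cmult[OF Gs]]]]) simp
      ultimately show ?thesis by simp
    qed
    have Vlip: "\<bar>V x - V y\<bar> \<le> B / c * \<bar>x - y\<bar>" if "x \<ge> 0" "y \<ge> 0" for x y
    proof -
      have "\<bar>V x - V y\<bar> = \<bar>w (s * x) - w (s * y)\<bar> / c"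
        using c by (simp add: Vw that abs_divide flip: diff_divide_distrib)
      also have "\<dots> \<le> B * \<bar>s * x - s * y\<bar> / c" using lip c by (intro divide_right_mono) auto
      also have "\<bar>s * x - s * y\<bar> = \<bar>x - y\<bar>" using s by auto
      finally show ?thesis by simp
    qed
    have bound: "\<bar>D x\<bar> \<le> B / c" if "x \<ge> 0" for x
    proof -
      \<comment> \<open>Only right difference quotients stay inside the half-line, where the
        Lipschitz bound for \<open>V\<close> is available.\<close>
      have "((\<lambda>h. (V (x + h) - V x) / h) \<longlongrightarrow> D x) (at 0)" using VD[of x] by (simp add: DERIV_def)
      hence "((\<lambda>h. (V (x + h) - V x) / h) \<longlongrightarrow> D x) (at_right 0)"
        by (rule filterlim_mono) (auto simp: at_within_le_at)
      hence "((\<lambda>h. \<bar>(V (x + h) - V x) / h\<bar>) \<longlongrightarrow> \<bar>D x\<bar>) (at_right 0)" by (rule tendsto_rabs)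
      moreover have "\<forall>\<^sub>F h in at_right 0. \<bar>(V (x + h) - V x) / h\<bar> \<le> B / c"
        unfolding eventually_at_right_field
      proof (intro exI[of _ 1] conjI allI impI)
        fix h :: real assume "0 < h" "h < 1"
        thus "\<bar>(V (x + h) - V x) / h\<bar> \<le> B / c" using Vlip[of "x + h" x] that
          by (simp add: abs_divide pos_divide_le_eq)
      qed auto
      ultimately show ?thesis by (rule tendsto_upperbound) auto
    qed
    obtain a where a: "a \<ge> 0" "\<And>x. x \<ge> 0 \<Longrightarrow> V x = (max 0 (a - x)) ^ 4" "D 0 = - 4 * a ^ 3"
      by (rule quartic_profile[OF VD DD _ bound]) (use c nonneg in \<open>auto simp: Vw\<close>)
    have "w (s * x) = c * (max 0 (a - x)) ^ 4" if "x \<ge> 0" for x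
      using Vw[OF that] a(2)[OF that] c by (simp add: field_simps)
    moreover have "s * (b + G 0) - 1 = - 4 * c * a ^ 3"
      using a(3) c by (simp add: D_def field_simps)
    ultimately show ?thesis using a(1) by blast
  qed
  obtain a1 where a1: "a1 \<ge> 0" "\<And>x. x \<ge> 0 \<Longrightarrow> w x = c * (max 0 (a1 - x)) ^ 4" "(b + G 0) - 1 = - 4 * c * a1 ^ 3"
    using half[of 1] by auto
  obtain a2 where a2: "a2 \<ge> 0" "\<And>x. x \<ge> 0 \<Longrightarrow> w (- x) = c * (max 0 (a2 - x)) ^ 4" "- (b + G 0) - 1 = - 4 * c * a2 ^ 3"
    using half[of "-1"] by auto
  \<comment> \<open>The common value at 0 makes the two half-widths equal. Adding the two slope
    equations then eliminates \<open>b + G 0\<close> and leaves the jump -2 of the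
    derivative.\<close>
  have "c * a1 ^ 4 = c * a2 ^ 4" using a1(1) a1(2)[of 0] a2(1) a2(2)[of 0] by simp
  hence "a1 ^ 4 = a2 ^ 4" using c by simp
  hence eq: "a2 = a1" using power_eq_imp_eq_base[of a2 4 a1] a1(1) a2(1) by simp
  have "4 * c * a1 ^ 3 = 1" using a1(3) a2(3) eq by simp
  hence "a1 ^ 3 = 18 * pi" by (simp add: c_def field_simps)
  moreover have "((18 * pi) powr (1 / 3)) ^ 3 = 18 * pi"
    by (simp add: powr_powr flip: powr_realpow)
  ultimately have "a1 ^ 3 = ((18 * pi) powr (1 / 3)) ^ 3" by simp
  hence a: "a1 = (18 * pi) powr (1 / 3)"
    using power_eq_imp_eq_base[of a1 3 "(18 * pi) powr (1 / 3)"] a1(1) by simp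
  have "w x = c * (max 0 (a1 - \<bar>x\<bar>)) ^ 4"
    using a1(2)[of x] a2(2)[of "- x"] eq by (cases "x \<ge> 0") auto
  thus ?thesis unfolding a c_def by auto
qed

section \<open>Scaling limits\<close>

lemma abs_sqrt_diff_le: "0 \<le> a \<Longrightarrow> 0 \<le> b \<Longrightarrow> \<bar>sqrt a - sqrt b\<bar> \<le> sqrt \<bar>a - b\<bar>"
proof (induction a b rule: linorder_wlog)
  case (le a b)
  have "sqrt b = sqrt (a + (b - a))" by simp
  also have "\<dots> \<le> sqrt a + sqrt (b - a)" using le by (intro sqrt_add_le_add_sqrt) auto
  finally show ?case using le by (simp add: abs_if)
next
  case (sym a b)
  then show ?case by (simp add: abs_minus_commute)
qed

lemma sqrt_power4: "sqrt (x ^ 4) = x\<^sup>2" for x :: real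
proof -
  have "x ^ 4 = (x\<^sup>2)\<^sup>2" by (simp flip: power_mult)
  thus ?thesis by (simp only: real_sqrt_abs abs_power2)
qed

text \<open>Works cell by cell: \<open>s y\<close> is compared with \<open>f\<close> only on the
  cell of length \<open>1 / N\<close> that starts at \<open>y / N\<close>.\<close>

lemma riemann_sum_bound:
  fixes f :: "real \<Rightarrow> real" and s :: "int \<Rightarrow> real"
  assumes "N > 0" "a \<le> b" and f: "continuous_on UNIV f"
    and close: "\<And>y \<xi>. y \<in> {a..<b} \<Longrightarrow> \<xi> \<in> {of_int y / N..(of_int y + 1) / N} \<Longrightarrow> \<bar>s y - f \<xi>\<bar> \<le> \<epsilon>"
  shows "\<bar>(\<Sum>y\<in>{a..<b}. s y) / N - integral {of_int a / N..of_int b / N} f\<bar> \<le> \<epsilon> * of_int (b - a) / N"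
  using \<open>a \<le> b\<close> close
proof (induction b rule: int_ge_induct)
  case base
  then show ?case by simp
next
  case (step b)
  have int: "f integrable_on {x..y}" for x y
    by (intro integrable_continuous_real continuous_on_subset[OF f]) auto
  have le: "of_int b / N \<le> (of_int b + 1) / N" "of_int a / N \<le> of_int b / N"
    using \<open>N > 0\<close> step.hyps by (auto intro!: divide_right_mono)
  have split: "integral {of_int a / N..of_int (b + 1) / N} f
     = integral {of_int a / N..of_int b / N} f + integral {of_int b / N..(of_int b + 1) / N} f"
    using Henstock_Kurzweil_Integration.integral_combine[OF le(2) le(1) int] by simp
  have len: "(of_int b + 1) / N - of_int b / N = 1 / N" using \<open>N > 0\<close> by (simp add: field_simps)
  have "s b / N - integral {of_int b / N..(of_int b + 1) / N} f = integral {of_int b / N..(of_int b + 1) / N} (\<lambda>\<xi>. s b - f \<xi>)"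
    using le(1) len int by (subst Henstock_Kurzweil_Integration.integral_diff) auto
  moreover have "norm (integral {of_int b / N..(of_int b + 1) / N} (\<lambda>\<xi>. s b - f \<xi>)) \<le> \<epsilon> * ((of_int b + 1) / N - of_int b / N)"
  proof (rule integral_bound[OF le(1)])
    show "continuous_on {of_int b / N..(of_int b + 1) / N} (\<lambda>\<xi>. s b - f \<xi>)"
      by (intro continuous_intros continuous_on_subset[OF f]) auto
    fix \<xi> assume "\<xi> \<in> {of_int b / N..(of_int b + 1) / N}"
    thus "norm (s b - f \<xi>) \<le> \<epsilon>" using step.prems[of b \<xi>] step.hyps by simp
  qed
  ultimately have 1: "\<bar>s b / N - integral {of_int b / N..(of_int b + 1) / N} f\<bar> \<le> \<epsilon> / N" unfolding len by simp
  have 2: "\<bar>(\<Sum>y\<in>{a..<b}. s y) / N - integral {of_int a / N..of_int b / N} f\<bar> \<le> \<epsilon> * of_int (b - a) / N"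
    by (rule step.IH) (use step.prems in auto)
  have "{a..<b + 1} = insert b {a..<b}" using step.hyps by auto
  hence "(\<Sum>y\<in>{a..<b + 1}. s y) / N = s b / N + (\<Sum>y\<in>{a..<b}. s y) / N" by (simp add: add_divide_distrib)
  hence "\<bar>(\<Sum>y\<in>{a..<b + 1}. s y) / N - integral {of_int a / N..of_int (b + 1) / N} f\<bar>
    = \<bar>(s b / N - integral {of_int b / N..(of_int b + 1) / N} f) + ((\<Sum>y\<in>{a..<b}. s y) / N - integral {of_int a / N..of_int b / N} f)\<bar>"
    unfolding split by (simp add: algebra_simps)
  also have "\<dots> \<le> \<epsilon> / N + \<epsilon> * of_int (b - a) / N" using 1 2 by (intro order_trans[OF abs_triangle_ineq] add_mono)
  also have "\<dots> = \<epsilon> * of_int (b + 1 - a) / N" using \<open>N > 0\<close> by (simp add: field_simps)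
  finally show ?case .
qed

text \<open>The deterministic stand-in for the odometer; the floor makes it usable as an index into
  stack sums.\<close>

definition profile_at :: "(real \<Rightarrow> real) \<Rightarrow> real \<Rightarrow> int \<Rightarrow> nat" where
  "profile_at w N y = nat \<lfloor>N ^ 4 * w (of_int y / N)\<rfloor>"

lemma profile_at_bounds:
  assumes "w (of_int y / N) \<ge> 0"
  shows "real (profile_at w N y) \<le> N ^ 4 * w (of_int y / N)" "N ^ 4 * w (of_int y / N) \<le> real (profile_at w N y) + 1"
proof -
  have "0 \<le> N ^ 4 * w (of_int y / N)" using assms by simp
  thus "real (profile_at w N y) \<le> N ^ 4 * w (of_int y / N)" "N ^ 4 * w (of_int y / N) \<le> real (profile_at w N y) + 1"
    unfolding profile_at_def by linarith+
qed

lemma profile_at_over: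
  assumes "w (of_int y / N) \<ge> 0" "N > 0"
  shows "\<bar>real (profile_at w N y) / N ^ 4 - w (of_int y / N)\<bar> \<le> 1 / N ^ 4"
proof -
  have "\<bar>real (profile_at w N y) - N ^ 4 * w (of_int y / N)\<bar> \<le> 1"
    using profile_at_bounds[of w y N, OF assms(1)] by linarith
  hence "\<bar>real (profile_at w N y) - N ^ 4 * w (of_int y / N)\<bar> / N ^ 4 \<le> 1 / N ^ 4"
    using \<open>N > 0\<close> by (intro divide_right_mono) auto
  also have "\<bar>real (profile_at w N y) - N ^ 4 * w (of_int y / N)\<bar> / N ^ 4
      = \<bar>(real (profile_at w N y) - N ^ 4 * w (of_int y / N)) / N ^ 4\<bar>" using \<open>N > 0\<close> by (simp add: abs_divide)
  also have "(real (profile_at w N y) - N ^ 4 * w (of_int y / N)) / N ^ 4 = real (profile_at w N y) / N ^ 4 - w (of_int y / N)"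
    using \<open>N > 0\<close> by (simp add: diff_divide_distrib)
  finally show ?thesis .
qed

definition tent_sum :: "(int \<Rightarrow> nat) \<Rightarrow> int \<Rightarrow> int \<Rightarrow> real" where
  "tent_sum m c H = (\<Sum>y=c-H..c+H. real_of_int (tent c H y) * mean_abs (m (y - 1) + m (y + 1)))"

locale lipschitz_profile =
  fixes w :: "real \<Rightarrow> real"
  assumes nonneg: "w x \<ge> 0" and lip: "\<bar>w x - w y\<bar> \<le> 2 * \<bar>x - y\<bar>"
begin

lemma continuous_w: "continuous_on S w"
proof (rule continuous_on_subset[of UNIV])
  show "continuous_on UNIV w"
  proof (rule continuous_onI)
    fix x e :: real assume "e > 0"
    thus "\<exists>d>0. \<forall>x'\<in>UNIV. dist x' x < d \<longrightarrow> dist (w x') (w x) \<le> e"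
      using lip[of _ x] by (intro exI[of _ "e / 2"]) (fastforce simp: dist_real_def intro: order_trans)
  qed
qed simp

lemma w_le: "\<bar>x\<bar> \<le> A \<Longrightarrow> w x \<le> w 0 + 2 * A"
  using lip[of x 0] by simp

text \<open>The uniformity covers points where \<open>w\<close> vanishes. There the square root is
  not Lipschitz, and \<open>abs_sqrt_diff_le\<close> supplies a Hoelder bound of exponent 1/2
  instead.\<close>

lemma mean_abs_profile:
  assumes "\<epsilon> > 0"
  shows "\<forall>\<^sub>F N in at_top. \<forall>y \<xi>. \<bar>\<xi>\<bar> \<le> A \<longrightarrow> \<bar>of_int y / N - \<xi>\<bar> \<le> 1 / N \<longrightarrow>
     \<bar>mean_abs (profile_at w N (y - 1) + profile_at w N (y + 1)) / N\<^sup>2 - sqrt (2 * w \<xi> / pi)\<bar> \<le> \<epsilon>"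
proof (cases "A \<ge> 0")
  case False
  have "\<not> \<bar>\<xi>\<bar> \<le> A" for \<xi> using False by auto
  thus ?thesis by simp
next
  case True
  define Wm where "Wm = w 0 + 2 * (A + 2)"
  have Wm: "Wm \<ge> 0" using nonneg[of 0] True by (simp add: Wm_def)
  \<comment> \<open>The relative error of \<open>mean_abs\<close> then contributes at most a third
    of \<epsilon>; the constant \<open>C / N\<^sup>2\<close> and the difference of square roots
    share the rest.\<close>
  define \<epsilon>0 where "\<epsilon>0 = \<epsilon> / (3 * (sqrt (2 * Wm) + 1))"
  have sW: "sqrt (2 * Wm) \<ge> 0" using Wm by simp
  have e0: "\<epsilon>0 > 0" using assms sW by (simp add: \<epsilon>0_def add_nonneg_pos)
  have e0': "\<epsilon>0 * sqrt (2 * Wm) \<le> \<epsilon> / 3"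
  proof -
    have "\<epsilon>0 * sqrt (2 * Wm) \<le> \<epsilon>0 * (sqrt (2 * Wm) + 1)" using e0 by (intro mult_left_mono) auto
    also have "\<dots> = \<epsilon> / 3" using sW unfolding \<epsilon>0_def by (simp add: field_simps add_nonneg_eq_0_iff)
    finally show ?thesis .
  qed
  obtain C where C: "C \<ge> 0" "\<And>m. \<bar>mean_abs m - sqrt (real m / pi)\<bar> \<le> \<epsilon>0 * sqrt (real m) + C"
    using mean_abs_asymptotics[OF e0] by blast
  have "((\<lambda>N::real. C / N\<^sup>2) \<longlongrightarrow> 0) at_top" by real_asymp
  hence ev1: "\<forall>\<^sub>F N in at_top. C / N\<^sup>2 < \<epsilon> / 3" using assms by (intro order_tendstoD(2)) auto
  have "((\<lambda>N::real. sqrt (10 / N)) \<longlongrightarrow> 0) at_top" by real_asymp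
  hence ev2: "\<forall>\<^sub>F N in at_top. sqrt (10 / N) < \<epsilon> / 3" using assms by (intro order_tendstoD(2)) auto
  show ?thesis using ev1 ev2 eventually_ge_at_top[of "1::real"]
  proof eventually_elim
    case (elim N)
    show ?case
    proof (intro allI impI)
      fix y :: int and \<xi> :: real assume xi: "\<bar>\<xi>\<bar> \<le> A" and y: "\<bar>of_int y / N - \<xi>\<bar> \<le> 1 / N"
      define k where "k = profile_at w N (y - 1) + profile_at w N (y + 1)"
      have N: "N > 0" "N \<ge> 1" using elim by auto
      have iN: "1 / N \<le> 1" "0 < 1 / N" using N by auto
      have N4: "1 / N ^ 4 \<le> 1 / N"
        using N power_increasing[of 1 4 N] by (intro divide_left_mono) auto
      have near: "\<bar>of_int (y - 1) / N - \<xi>\<bar> \<le> 2 / N" "\<bar>of_int (y + 1) / N - \<xi>\<bar> \<le> 2 / N"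
        using y by (simp_all add: diff_divide_distrib add_divide_distrib)
      have w1: "w (of_int (y - 1) / N) \<le> Wm" "w (of_int (y + 1) / N) \<le> Wm"
        unfolding Wm_def using near xi iN by (intro w_le; linarith)+
      have "real k \<le> N ^ 4 * Wm + N ^ 4 * Wm"
        unfolding k_def of_nat_add using w1 N
        by (intro add_mono order_trans[OF profile_at_bounds(1)] nonneg mult_left_mono) auto
      hence kW: "real k / N ^ 4 \<le> 2 * Wm" using N by (simp add: divide_le_eq mult.commute)
      have sqk: "sqrt (real k) / N\<^sup>2 = sqrt (real k / N ^ 4)"
        by (simp add: real_sqrt_divide sqrt_power4)
      \<comment> \<open>Each neighbour of \<open>y\<close> lies within \<open>2 / N\<close> of
        \<xi>, which costs \<open>4 / N\<close> by the Lipschitz constant 2, and rounding costs at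
        most \<open>1 / N\<close>; two neighbours give \<open>10 / N\<close>.\<close>
      have "\<bar>real k / N ^ 4 - 2 * w \<xi>\<bar> \<le> 10 / N"
      proof -
        have tri: "\<bar>p - q\<bar> \<le> s \<Longrightarrow> \<bar>q - r\<bar> \<le> 2 * t \<Longrightarrow> t \<le> v \<Longrightarrow> s \<le> i \<Longrightarrow> \<bar>p - r\<bar> \<le> i + 2 * v"
          for p q r s t i v :: real by linarith
        have "\<bar>real (profile_at w N (y - 1)) / N ^ 4 - w \<xi>\<bar> \<le> 1 / N + 2 * (2 / N)"
          by (rule tri[OF profile_at_over[of w "y - 1" N, OF nonneg N(1)] lip near(1) N4])
        moreover have "\<bar>real (profile_at w N (y + 1)) / N ^ 4 - w \<xi>\<bar> \<le> 1 / N + 2 * (2 / N)"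
          by (rule tri[OF profile_at_over[of w "y + 1" N, OF nonneg N(1)] lip near(2) N4])
        moreover have "real k / N ^ 4 = real (profile_at w N (y - 1)) / N ^ 4 + real (profile_at w N (y + 1)) / N ^ 4"
          by (simp add: k_def add_divide_distrib)
        moreover have "\<bar>p - r\<bar> \<le> i + 2 * (2 * i) \<Longrightarrow> \<bar>q - r\<bar> \<le> i + 2 * (2 * i) \<Longrightarrow> k = p + q \<Longrightarrow> \<bar>k - 2 * r\<bar> \<le> 10 * i"
          for p q r k i :: real by linarith
        moreover have "10 / N = 10 * (1 / N)" "2 / N = 2 * (1 / N)" by simp_all
        ultimately show ?thesis by metis
      qed
      hence d: "\<bar>real k / N ^ 4 / pi - 2 * w \<xi> / pi\<bar> \<le> 10 / N"
      proof -
        have "\<bar>real k / N ^ 4 / pi - 2 * w \<xi> / pi\<bar> = \<bar>real k / N ^ 4 - 2 * w \<xi>\<bar> / pi"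
          unfolding diff_divide_distrib[symmetric] abs_divide by simp
        also have "\<dots> \<le> \<bar>real k / N ^ 4 - 2 * w \<xi>\<bar> / 1" using pi_gt3 by (intro divide_left_mono) auto
        finally show ?thesis using \<open>\<bar>real k / N ^ 4 - 2 * w \<xi>\<bar> \<le> 10 / N\<close> by simp
      qed
      have "\<bar>sqrt (real k / N ^ 4 / pi) - sqrt (2 * w \<xi> / pi)\<bar> \<le> sqrt \<bar>real k / N ^ 4 / pi - 2 * w \<xi> / pi\<bar>"
        using nonneg[of \<xi>] by (intro abs_sqrt_diff_le) auto
      also have "\<dots> \<le> sqrt (10 / N)" using d by simp
      also have "\<dots> \<le> \<epsilon> / 3" using elim by simp
      finally have 1: "\<bar>sqrt (real k / N ^ 4 / pi) - sqrt (2 * w \<xi> / pi)\<bar> \<le> \<epsilon> / 3" .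
      have "\<bar>mean_abs k / N\<^sup>2 - sqrt (real k / N ^ 4 / pi)\<bar> = \<bar>mean_abs k - sqrt (real k / pi)\<bar> / N\<^sup>2"
      proof -
        have "sqrt (real k / N ^ 4 / pi) = sqrt (real k / pi) / N\<^sup>2"
          by (simp add: real_sqrt_divide real_sqrt_mult sqrt_power4)
        thus ?thesis by (simp flip: diff_divide_distrib)
      qed
      also have "\<dots> \<le> (\<epsilon>0 * sqrt (real k) + C) / N\<^sup>2" by (intro divide_right_mono C) auto
      also have "\<dots> = \<epsilon>0 * sqrt (real k / N ^ 4) + C / N\<^sup>2" unfolding sqk[symmetric] by (simp add: add_divide_distrib)
      also have "\<dots> \<le> \<epsilon>0 * sqrt (2 * Wm) + C / N\<^sup>2"
        using kW e0 by (intro add_mono mult_left_mono order_refl) auto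
      also have "\<dots> \<le> \<epsilon> / 3 + \<epsilon> / 3" using e0' elim by (intro add_mono) auto
      finally have 2: "\<bar>mean_abs k / N\<^sup>2 - sqrt (real k / N ^ 4 / pi)\<bar> \<le> \<epsilon> / 3 + \<epsilon> / 3" .
      have "\<bar>mean_abs k / N\<^sup>2 - sqrt (2 * w \<xi> / pi)\<bar> \<le> (\<epsilon> / 3 + \<epsilon> / 3) + \<epsilon> / 3"
        using 1 2 by linarith
      thus "\<bar>mean_abs (profile_at w N (y - 1) + profile_at w N (y + 1)) / N\<^sup>2 - sqrt (2 * w \<xi> / pi)\<bar> \<le> \<epsilon>"
        unfolding k_def[symmetric] by simp
    qed
  qed
qed

text \<open>The factor \<open>N ^ 4\<close> splits into \<open>N\<close> for the tent,
  \<open>N\<^sup>2\<close> for the walk and \<open>N\<close> for the mesh of a Riemann sum.\<close>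

lemma tent_sum_tendsto:
  assumes "h > 0"
  shows "((\<lambda>N. tent_sum (profile_at w N) \<lfloor>N * z\<rfloor> \<lfloor>N * h\<rfloor> / N ^ 4)
     \<longlongrightarrow> integral {z - h..z + h} (\<lambda>y. (h - \<bar>y - z\<bar>) * sqrt (2 * w y / pi))) at_top"
proof (rule tendstoI)
  fix e :: real assume "e > 0"
  define A where "A = \<bar>z\<bar> + h + 6"
  define Gm where "Gm = sqrt (2 * (w 0 + 2 * A) / pi)"
  define f where "f = (\<lambda>y. max 0 (h - \<bar>y - z\<bar>) * sqrt (2 * w y / pi))"
  define \<epsilon> where "\<epsilon> = e / (4 * h * (2 * h + 6))"
  have eps: "\<epsilon> > 0" using \<open>e > 0\<close> assms by (simp add: \<epsilon>_def)
  have fcont: "continuous_on UNIV f" unfolding f_def by (intro continuous_intros continuous_w) auto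
  have "((\<lambda>N::real. 3 / N * Gm * (2 * h + 6)) \<longlongrightarrow> 0) at_top" by real_asymp
  hence ev: "\<forall>\<^sub>F N in at_top. 3 / N * Gm * (2 * h + 6) < e / 4" using \<open>e > 0\<close> by (intro order_tendstoD(2)) auto
  show "\<forall>\<^sub>F N in at_top. dist (tent_sum (profile_at w N) \<lfloor>N * z\<rfloor> \<lfloor>N * h\<rfloor> / N ^ 4)
        (integral {z - h..z + h} (\<lambda>y. (h - \<bar>y - z\<bar>) * sqrt (2 * w y / pi))) < e"
    using mean_abs_profile[OF eps, of A] ev eventually_ge_at_top[of "1::real"]
  proof eventually_elim
    case (elim N)
    define c where "c = \<lfloor>N * z\<rfloor>"
    define H where "H = \<lfloor>N * h\<rfloor>"
    \<comment> \<open>The margin of 3 sites absorbs the floors, so that the interval from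
      \<open>a / N\<close> to \<open>b / N\<close> covers \<open>{z - h..z + h}\<close>; the summand
      \<open>s\<close> and the integrand \<open>f\<close> vanish on the parts added.\<close>
    define a where "a = c - H - 3"
    define b where "b = c + H + 3"
    define s where "s = (\<lambda>y. (real_of_int (tent c H y) / N) * (mean_abs (profile_at w N (y - 1) + profile_at w N (y + 1)) / N\<^sup>2))"
    have N: "N > 0" "N \<ge> 1" using elim by auto
    have iN: "1 / N \<le> 1" "0 < 1 / N" "3 / N = 3 * (1 / N)" "6 / N = 6 * (1 / N)" using N by auto
    have H0: "H \<ge> 0" using N assms by (simp add: H_def)
    have fl: "of_int c \<le> N * z" "N * z < of_int c + 1" "of_int H \<le> N * h" "N * h < of_int H + 1"
      unfolding c_def H_def by linarith+
    have over: "of_int c / N \<le> z" "z < of_int c / N + 1 / N" "of_int H / N \<le> h" "h < of_int H / N + 1 / N"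
      using fl N by (simp_all add: field_simps)
    have close: "\<bar>s y - f \<xi>\<bar> \<le> 3 / N * Gm + h * \<epsilon>"
      if "y \<in> {a..<b}" "\<xi> \<in> {of_int y / N..(of_int y + 1) / N}" for y \<xi>
    proof -
      have xi: "of_int y / N \<le> \<xi>" "\<xi> \<le> of_int y / N + 1 / N" using that(2) by (auto simp: add_divide_distrib)
      hence yx: "\<bar>of_int y / N - \<xi>\<bar> \<le> 1 / N" by linarith
      have "of_int (c - H - 3) / N \<le> of_int y / N" "of_int y / N \<le> of_int (c + H + 3) / N"
        using that(1) N by (auto simp: a_def b_def intro!: divide_right_mono simp flip: of_int_le_iff)
      hence "of_int c / N - of_int H / N - 3 / N \<le> of_int y / N" "of_int y / N \<le> of_int c / N + of_int H / N + 3 / N"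
        by (simp_all add: add_divide_distrib diff_divide_distrib)
      hence xA: "\<bar>\<xi>\<bar> \<le> A" unfolding A_def using xi over iN by linarith
      define P where "P = real_of_int (tent c H y) / N"
      define P' where "P' = max 0 (h - \<bar>\<xi> - z\<bar>)"
      define Q where "Q = mean_abs (profile_at w N (y - 1) + profile_at w N (y + 1)) / N\<^sup>2"
      define Q' where "Q' = sqrt (2 * w \<xi> / pi)"
      have "P = max 0 (of_int H / N - \<bar>of_int y / N - of_int c / N\<bar>)"
      proof -
        have "real_of_int (tent c H y) = max 0 (of_int H - \<bar>of_int y - of_int c\<bar>)" unfolding tent_def of_int_max by simp
        hence "P = max (0 / N) ((of_int H - \<bar>of_int y - of_int c\<bar>) / N)"
          unfolding P_def using N by (auto simp: max_def field_simps)
        moreover have "\<bar>of_int y - of_int c\<bar> / N = \<bar>of_int y / N - of_int c / N\<bar>"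
          unfolding diff_divide_distrib[symmetric] abs_divide using N by simp
        ultimately show ?thesis unfolding diff_divide_distrib[of _ _ N] by (simp only: div_0)
      qed
      hence PP: "\<bar>P - P'\<bar> \<le> 3 / N" unfolding P'_def using yx over iN(3) by linarith
      have P: "0 \<le> P" "P \<le> h"
        using tent_bounds[OF H0, of c y] over(3) N unfolding P_def
        by (auto intro: order_trans[OF divide_right_mono, of _ "of_int H"])
      have QQ: "\<bar>Q - Q'\<bar> \<le> \<epsilon>" unfolding Q_def Q'_def using elim(1) xA yx by blast
      have Q': "0 \<le> Q'" "Q' \<le> Gm" unfolding Q'_def Gm_def using nonneg[of \<xi>] w_le[OF xA]
        by (auto intro!: divide_right_mono)
      have "s y - f \<xi> = (P - P') * Q' + P * (Q - Q')" unfolding s_def f_def P_def P'_def Q_def Q'_def by (simp add: algebra_simps)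
      also have "\<bar>\<dots>\<bar> \<le> \<bar>(P - P') * Q'\<bar> + \<bar>P * (Q - Q')\<bar>" by (rule abs_triangle_ineq)
      also have "\<dots> = \<bar>P - P'\<bar> * Q' + P * \<bar>Q - Q'\<bar>" using P Q' by (simp add: abs_mult)
      also have "\<dots> \<le> 3 / N * Gm + h * \<epsilon>" using PP P QQ Q' N assms by (intro add_mono mult_mono) auto
      finally show ?thesis .
    qed
    have sumeq: "tent_sum (profile_at w N) c H / N ^ 4 = (\<Sum>y\<in>{a..<b}. s y) / N"
    proof -
      have "(\<Sum>y\<in>{a..<b}. s y) = (\<Sum>y=c-H..c+H. s y)"
        using H0 by (intro sum.mono_neutral_right) (auto simp: a_def b_def s_def tent_def)
      also have "\<dots> = tent_sum (profile_at w N) c H / N ^ 3"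
        unfolding tent_sum_def s_def sum_divide_distrib by (intro sum.cong refl) (simp add: power3_eq_cube power2_eq_square)
      finally show ?thesis by (simp add: power3_eq_cube power4_eq_xxxx)
    qed
    have inteq: "integral {of_int a / N..of_int b / N} f = integral {z - h..z + h} (\<lambda>y. (h - \<bar>y - z\<bar>) * sqrt (2 * w y / pi))"
    proof -
      have "of_int a / N \<le> z - h" "z + h \<le> of_int b / N"
        using over iN by (simp_all add: a_def b_def add_divide_distrib diff_divide_distrib)
      hence sub: "{z - h..z + h} \<subseteq> {of_int a / N..of_int b / N}" by auto
      have "(f has_integral integral {z - h..z + h} f) {z - h..z + h}"
        by (intro integrable_integral integrable_continuous_real continuous_on_subset[OF fcont]) auto
      hence "(f has_integral integral {z - h..z + h} f) {of_int a / N..of_int b / N}"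
        by (rule has_integral_on_superset[OF _ _ sub]) (auto simp: f_def)
      hence "integral {of_int a / N..of_int b / N} f = integral {z - h..z + h} f" by (rule integral_unique)
      also have "\<dots> = integral {z - h..z + h} (\<lambda>y. (h - \<bar>y - z\<bar>) * sqrt (2 * w y / pi))"
        by (intro integral_cong) (auto simp: f_def max_def)
      finally show ?thesis .
    qed
    have "\<bar>(\<Sum>y\<in>{a..<b}. s y) / N - integral {of_int a / N..of_int b / N} f\<bar> \<le> (3 / N * Gm + h * \<epsilon>) * of_int (b - a) / N"
      using N H0 fcont close by (intro riemann_sum_bound) (auto simp: a_def b_def)
    also have "\<dots> = (3 / N * Gm + h * \<epsilon>) * (2 * (of_int H / N) + 6 / N)"
      using N by (simp add: a_def b_def add_divide_distrib[symmetric])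
    also have "\<dots> \<le> (3 / N * Gm + h * \<epsilon>) * (2 * h + 6)"
    proof (intro mult_left_mono)
      show "2 * (of_int H / N) + 6 / N \<le> 2 * h + 6" using over iN by linarith
      have "Gm \<ge> 0" using nonneg[of 0] assms by (simp add: Gm_def A_def)
      thus "0 \<le> 3 / N * Gm + h * \<epsilon>" using N assms eps by simp
    qed
    also have "\<dots> = 3 / N * Gm * (2 * h + 6) + h * \<epsilon> * (2 * h + 6)" by (rule distrib_right)
    also have "h * \<epsilon> * (2 * h + 6) = e / 4"
    proof -
      have *: "p * (e / (4 * p * q)) * q = e / 4" if "p \<noteq> 0" "q \<noteq> 0" for p q
        using that by (simp add: field_simps)
      show ?thesis unfolding \<epsilon>_def by (rule *) (use assms in auto)
    qed
    also have "3 / N * Gm * (2 * h + 6) + e / 4 < e" using elim(2) \<open>e > 0\<close> by linarith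
    finally show ?case unfolding inteq c_def[symmetric] H_def[symmetric] sumeq dist_real_def .
  qed
qed

end

section \<open>Deviation bounds in scaled form\<close>

context random_stack_pair begin

lemma profile_near:
  assumes "N \<ge> 1" and w: "\<And>x. w x \<ge> 0" and Wm: "w (of_int y / N) \<le> Wm" and "\<delta> > 0"
    and near: "\<bar>real (odo n y \<omega>) - N ^ 4 * w (of_int y / N)\<bar> \<le> \<delta> * N ^ 4"
  shows "\<bar>int (odo n y \<omega>) - int (profile_at w N y)\<bar> \<le> int (nat \<lceil>\<delta> * N ^ 4\<rceil> + 1)"
    "odo n y \<omega> \<le> nat \<lceil>(Wm + \<delta>) * N ^ 4\<rceil>" 
proof -
  note b = profile_at_bounds[of w y N, OF w]
  have "\<bar>real (odo n y \<omega>) - real (profile_at w N y)\<bar> \<le> \<delta> * N ^ 4 + 1" using near b by linarith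
  also have "\<dots> \<le> of_int (\<lceil>\<delta> * N ^ 4\<rceil> + 1)" by (simp add: le_of_int_ceiling)
  finally have "of_int \<bar>int (odo n y \<omega>) - int (profile_at w N y)\<bar> \<le> (of_int (\<lceil>\<delta> * N ^ 4\<rceil> + 1) :: real)" by simp
  hence "\<bar>int (odo n y \<omega>) - int (profile_at w N y)\<bar> \<le> \<lceil>\<delta> * N ^ 4\<rceil> + 1" by (simp only: of_int_le_iff)
  moreover have "0 \<le> \<delta> * N ^ 4" using assms by simp
  hence "int (nat \<lceil>\<delta> * N ^ 4\<rceil> + 1) = \<lceil>\<delta> * N ^ 4\<rceil> + 1" by linarith
  ultimately show "\<bar>int (odo n y \<omega>) - int (profile_at w N y)\<bar> \<le> int (nat \<lceil>\<delta> * N ^ 4\<rceil> + 1)" by (simp only:)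
  have "N ^ 4 * w (of_int y / N) \<le> N ^ 4 * Wm" using Wm \<open>N \<ge> 1\<close> by (intro mult_left_mono) auto
  hence "real (odo n y \<omega>) \<le> (Wm + \<delta>) * N ^ 4" using near by (simp add: algebra_simps)
  thus "odo n y \<omega> \<le> nat \<lceil>(Wm + \<delta>) * N ^ 4\<rceil>" by linarith
qed

lemma nat_ceiling_le: "x \<ge> 0 \<Longrightarrow> real (nat \<lceil>x\<rceil>) \<le> x + 1"
  by linarith

lemma profile_sizes:
  assumes "N \<ge> 1" "0 \<le> Wm" "\<delta> > 0"
  shows "real (nat \<lceil>\<delta> * N ^ 4\<rceil> + 1) \<le> \<delta> * N ^ 4 + 2"
    "real (nat \<lceil>(Wm + \<delta>) * N ^ 4\<rceil>) \<le> (Wm + \<delta> + 1) * N ^ 4"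
    "sqrt (real (nat \<lceil>(Wm + \<delta>) * N ^ 4\<rceil>)) \<le> sqrt (Wm + \<delta> + 1) * N\<^sup>2"
proof -
  have "0 \<le> \<delta> * N ^ 4" using assms by simp
  from nat_ceiling_le[OF this] show "real (nat \<lceil>\<delta> * N ^ 4\<rceil> + 1) \<le> \<delta> * N ^ 4 + 2"
    unfolding of_nat_add of_nat_1 by linarith
  have "real (nat \<lceil>(Wm + \<delta>) * N ^ 4\<rceil>) \<le> (Wm + \<delta>) * N ^ 4 + 1" using assms by (intro nat_ceiling_le) auto
  also have "\<dots> \<le> (Wm + \<delta> + 1) * N ^ 4" using \<open>N \<ge> 1\<close> by (simp add: distrib_right)
  finally show K: "real (nat \<lceil>(Wm + \<delta>) * N ^ 4\<rceil>) \<le> (Wm + \<delta> + 1) * N ^ 4" .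
  hence "sqrt (real (nat \<lceil>(Wm + \<delta>) * N ^ 4\<rceil>)) \<le> sqrt ((Wm + \<delta> + 1) * N ^ 4)" by simp
  also have "\<dots> = sqrt (Wm + \<delta> + 1) * N\<^sup>2" unfolding real_sqrt_mult sqrt_power4 by (rule refl)
  finally show "sqrt (real (nat \<lceil>(Wm + \<delta>) * N ^ 4\<rceil>)) \<le> sqrt (Wm + \<delta> + 1) * N\<^sup>2" .
qed

text \<open>\<open>ramp_deviation\<close> divided by \<open>N ^ 4\<close>. The mass term
  \<open>n * (b - a)\<close> has the order of the odometer and survives, whereas the stack sums give
  order \<open>N\<^sup>2\<close> at each of about \<open>N\<close> sites and keep a factor
  \<open>1 / N\<close>.\<close>

lemma ramp_scaled:
  assumes "N \<ge> 1" and n: "N ^ 3 = real n" and w: "\<And>x. w x \<ge> 0" and "\<delta> > 0"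
    and Wm: "\<And>\<xi>. \<bar>\<xi>\<bar> \<le> \<bar>\<alpha>\<bar> + \<bar>\<beta>\<bar> + 1 \<Longrightarrow> w \<xi> \<le> Wm" and ab: "\<lfloor>N * \<alpha>\<rfloor> < \<lfloor>N * \<beta>\<rfloor>" and B: "B \<in> events"
    and near: "AE \<omega> in M. \<omega> \<notin> B \<longrightarrow> (\<forall>y. \<bar>real (odo n y \<omega>) - N ^ 4 * w (of_int y / N)\<bar> \<le> \<delta> * N ^ 4)"
  shows "(1 - prob B) * \<bar>real (profile_at w N \<lfloor>N * \<alpha>\<rfloor>) / N ^ 4 - real (profile_at w N \<lfloor>N * \<beta>\<rfloor>) / N ^ 4\<bar>
    \<le> 2 * (\<beta> - \<alpha> + 1 / N) + 2 * (\<delta> + 2 / N ^ 4) + 8 * sqrt (Wm + \<delta> + 1) * (\<beta> - \<alpha> + 2) / N"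
proof -
  define a b where "a = \<lfloor>N * \<alpha>\<rfloor>" and "b = \<lfloor>N * \<beta>\<rfloor>"
  define d where "d = nat \<lceil>\<delta> * N ^ 4\<rceil> + 1"
  define K where "K = nat \<lceil>(Wm + \<delta>) * N ^ 4\<rceil>"
  define m where "m = profile_at w N"
  have N: "N > 0" using assms by simp
  have N4: "N ^ 4 \<ge> 1" using \<open>N \<ge> 1\<close> by simp
  have N34: "N ^ 4 = N ^ 3 * N" "N ^ 4 = N\<^sup>2 * N * N" "N ^ 4 = (N\<^sup>2)\<^sup>2" by (simp_all add: power4_eq_xxxx power3_eq_cube power2_eq_square)
  have fl: "of_int a \<le> N * \<alpha>" "N * \<alpha> < of_int a + 1" "of_int b \<le> N * \<beta>" "N * \<beta> < of_int b + 1"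
    unfolding a_def b_def by linarith+
  have Wm0: "Wm \<ge> 0" using Wm[of 0] w[of 0] by simp
  have win: "w (of_int y / N) \<le> Wm" if "y \<in> {a..b}" for y
  proof (rule Wm)
    have "of_int a \<le> (of_int y :: real)" "(of_int y :: real) \<le> of_int b" using that by auto
    hence "N * \<alpha> - 1 \<le> of_int y" "of_int y \<le> N * \<beta>" using fl by linarith+
    hence "(N * \<alpha> - 1) / N \<le> of_int y / N" "of_int y / N \<le> (N * \<beta>) / N"
      using N by (intro divide_right_mono; simp)+
    hence "\<alpha> - 1 / N \<le> of_int y / N" "of_int y / N \<le> \<beta>" using N by (simp_all add: diff_divide_distrib)
    moreover have "1 / N \<le> 1" using \<open>N \<ge> 1\<close> by simp
    ultimately show "\<bar>of_int y / N\<bar> \<le> \<bar>\<alpha>\<bar> + \<bar>\<beta>\<bar> + 1" by linarith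
  qed
  have "AE \<omega> in M. \<omega> \<notin> B \<longrightarrow> (\<forall>y\<in>{a..b}. \<bar>int (odo n y \<omega>) - int (m y)\<bar> \<le> int d \<and> odo n y \<omega> \<le> K)"
    using near
  proof eventually_elim
    case (elim \<omega>)
    show ?case unfolding m_def d_def K_def
      using elim profile_near[where N = N and w = w and Wm = Wm and \<delta> = \<delta> and n = n and \<omega> = \<omega>, OF \<open>N \<ge> 1\<close> w win \<open>\<delta> > 0\<close>] by blast
  qed
  from ramp_deviation[OF ab[folded a_def b_def] B this]
  have "(1 - prob B) * \<bar>real (m a) - real (m b)\<bar>
     \<le> 2 * real n * real_of_int (b - a) + 2 * real d + 8 * sqrt (real K) * real_of_int (b - a + 1)" .
  also have "\<dots> \<le> 2 * N ^ 3 * (N * (\<beta> - \<alpha>) + 1) + 2 * (\<delta> * N ^ 4 + 2) + 8 * (sqrt (Wm + \<delta> + 1) * N\<^sup>2) * (N * (\<beta> - \<alpha> + 2))"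
  proof (intro add_mono)
    have "real_of_int (b - a) \<le> N * (\<beta> - \<alpha>) + 1" using fl by (simp add: right_diff_distrib)
    thus "2 * real n * real_of_int (b - a) \<le> 2 * N ^ 3 * (N * (\<beta> - \<alpha>) + 1)"
      unfolding n by (intro mult_left_mono) auto
    note sizes = profile_sizes[OF \<open>N \<ge> 1\<close> Wm0 \<open>\<delta> > 0\<close>, folded d_def K_def]
    from sizes(1) show "2 * real d \<le> 2 * (\<delta> * N ^ 4 + 2)" by (intro mult_left_mono) auto
    have K: "8 * sqrt (real K) \<le> 8 * (sqrt (Wm + \<delta> + 1) * N\<^sup>2)" using sizes(3) by simp
    have "real_of_int (b - a + 1) \<le> N * (\<beta> - \<alpha> + 2)" using fl \<open>N \<ge> 1\<close> by (simp add: algebra_simps)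
    with K show "8 * sqrt (real K) * real_of_int (b - a + 1) \<le> 8 * (sqrt (Wm + \<delta> + 1) * N\<^sup>2) * (N * (\<beta> - \<alpha> + 2))"
      by (rule mult_mono) (use ab Wm0 \<open>\<delta> > 0\<close> in \<open>auto simp: a_def b_def\<close>)
  qed
  finally have le: "(1 - prob B) * \<bar>real (m a) - real (m b)\<bar> / N ^ 4
     \<le> (2 * N ^ 3 * (N * (\<beta> - \<alpha>) + 1) + 2 * (\<delta> * N ^ 4 + 2) + 8 * (sqrt (Wm + \<delta> + 1) * N\<^sup>2) * (N * (\<beta> - \<alpha> + 2))) / N ^ 4"
    using N by (intro divide_right_mono) auto
  also have "\<dots> = 2 * (\<beta> - \<alpha> + 1 / N) + 2 * (\<delta> + 2 / N ^ 4) + 8 * sqrt (Wm + \<delta> + 1) * (\<beta> - \<alpha> + 2) / N"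
  proof -
    have "2 * N ^ 3 * (N * (\<beta> - \<alpha>) + 1) / N ^ 4 = 2 * (\<beta> - \<alpha> + 1 / N)" using N by (simp add: N34(1) field_simps)
    moreover have "2 * (\<delta> * N ^ 4 + 2) / N ^ 4 = 2 * (\<delta> + 2 / N ^ 4)" using N by (simp add: field_simps)
    moreover have "8 * (sqrt (Wm + \<delta> + 1) * N\<^sup>2) * (N * (\<beta> - \<alpha> + 2)) / N ^ 4 = 8 * sqrt (Wm + \<delta> + 1) * (\<beta> - \<alpha> + 2) / N"
      using N by (simp add: N34(2))
    ultimately show ?thesis unfolding add_divide_distrib by simp
  qed
  finally have "(1 - prob B) * \<bar>real (m a) - real (m b)\<bar> / N ^ 4 \<le> \<dots>" .
  moreover have "\<bar>real (m a) / N ^ 4 - real (m b) / N ^ 4\<bar> = \<bar>real (m a) - real (m b)\<bar> / N ^ 4"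
    using N by (simp add: abs_divide flip: diff_divide_distrib)
  ultimately show ?thesis by (simp add: a_def b_def m_def)
qed

lemma tent_scaled:
  assumes "N \<ge> 1" and n: "N ^ 3 = real n" and w: "\<And>x. w x \<ge> 0" and "\<delta> > 0" "\<theta> > 0" "h > 0"
    and Wm: "\<And>\<xi>. \<bar>\<xi>\<bar> \<le> \<bar>z\<bar> + h + 3 \<Longrightarrow> w \<xi> \<le> Wm" and H: "\<lfloor>N * h\<rfloor> \<ge> 1" and B: "B \<in> events"
    and near: "AE \<omega> in M. \<omega> \<notin> B \<longrightarrow> (\<forall>y. \<bar>real (odo n y \<omega>) - N ^ 4 * w (of_int y / N)\<bar> \<le> \<delta> * N ^ 4)"
  defines "c \<equiv> \<lfloor>N * z\<rfloor>" and "H \<equiv> \<lfloor>N * h\<rfloor>" and "m \<equiv> profile_at w N"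
  defines "T \<equiv> 2 * (real_of_int (tent c H 0) / N) + real (m (c + H)) / N ^ 4 + real (m (c - H)) / N ^ 4 - 2 * (real (m c) / N ^ 4)"
  shows "\<bar>tent_sum m c H / N ^ 4 - T\<bar>
    \<le> 4 * (\<delta> + 2 / N ^ 4) + prob B * \<bar>T\<bar> + (2 * h + 1) * (8 * sqrt (Wm + \<delta> + 1)) / N
     + (2 * h + 1) * h * (16 * sqrt (2 * (\<delta> + 2 / N ^ 4)) + (\<theta> * (Wm + \<delta> + 1) + prob B / \<theta>) / 2)"
proof -
  define d where "d = nat \<lceil>\<delta> * N ^ 4\<rceil> + 1"
  define K where "K = nat \<lceil>(Wm + \<delta>) * N ^ 4\<rceil>"
  define S where "S = tent_sum m c H"
  define U where "U = 2 * real n * real_of_int (tent c H 0) + real (m (c + H)) + real (m (c - H)) - 2 * real (m c)"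
  have N: "N > 0" using assms by simp
  have N4: "N ^ 4 \<ge> 1" using \<open>N \<ge> 1\<close> by simp
  have N34: "N ^ 4 = N ^ 3 * N" "N ^ 4 = N\<^sup>2 * N * N" "N ^ 4 = (N\<^sup>2)\<^sup>2" by (simp_all add: power4_eq_xxxx power3_eq_cube power2_eq_square)
  have fl: "of_int c \<le> N * z" "N * z < of_int c + 1" "of_int H \<le> N * h" "N * h < of_int H + 1"
    unfolding c_def H_def by linarith+
  have over: "of_int c / N \<le> z" "z < of_int c / N + 1 / N" "of_int H / N \<le> h" "h < of_int H / N + 1 / N"
    using fl N by (simp_all add: field_simps)
  have iN: "1 / N \<le> 1" "0 < 1 / N" using \<open>N \<ge> 1\<close> by auto
  have H1: "H \<ge> 1" using H by (simp add: H_def)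
  have Wm0: "Wm \<ge> 0" using Wm[of 0] w[of 0] \<open>h > 0\<close> by simp
  have win: "w (of_int y / N) \<le> Wm" if "y \<in> {c-H-1..c+H+1}" for y
  proof (rule Wm)
    have "of_int (c - H - 1) \<le> (of_int y :: real)" "(of_int y :: real) \<le> of_int (c + H + 1)"
      using that unfolding of_int_le_iff by auto
    hence "of_int (c - H - 1) / N \<le> of_int y / N" "of_int y / N \<le> of_int (c + H + 1) / N"
      using N by (intro divide_right_mono; simp)+
    hence "of_int c / N - of_int H / N - 1 / N \<le> of_int y / N" "of_int y / N \<le> of_int c / N + of_int H / N + 1 / N"
      by (simp_all add: add_divide_distrib diff_divide_distrib)
    thus "\<bar>of_int y / N\<bar> \<le> \<bar>z\<bar> + h + 3" using over iN by linarith
  qed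
  have "AE \<omega> in M. \<omega> \<notin> B \<longrightarrow> (\<forall>y\<in>{c-H-1..c+H+1}. \<bar>int (odo n y \<omega>) - int (m y)\<bar> \<le> int d \<and> odo n y \<omega> \<le> K)"
    using near
  proof eventually_elim
    case (elim \<omega>)
    show ?case unfolding m_def d_def K_def
      using elim profile_near[where N = N and w = w and Wm = Wm and \<delta> = \<delta> and n = n and \<omega> = \<omega>, OF \<open>N \<ge> 1\<close> w win \<open>\<delta> > 0\<close>] by blast
  qed
  moreover have "m y \<le> K" if "y \<in> {c-H-1..c+H+1}" for y
  proof -
    have "real (m y) \<le> N ^ 4 * w (of_int y / N)" unfolding m_def by (rule profile_at_bounds[OF w])
    also have "\<dots> \<le> (Wm + \<delta>) * N ^ 4" using win[OF that] N \<open>\<delta> > 0\<close> by (simp add: mult.commute)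
    finally show ?thesis unfolding K_def by linarith
  qed
  \<comment> \<open>The absolute differences have size \<open>N\<^sup>2\<close>; scaling the weight
    of the second moment estimate accordingly gives both of its terms the order
    \<open>N\<^sup>2\<close>.\<close>
  moreover have "\<theta> / N\<^sup>2 > 0" using N \<open>\<theta> > 0\<close> by simp
  ultimately have "\<bar>S - U\<bar> \<le> 4 * real d + prob B * \<bar>U\<bar> + real_of_int (2 * H + 1) * (8 * sqrt (real K))
      + real_of_int (2 * H + 1) * real_of_int H * (16 * sqrt (2 * real d) + (\<theta> / N\<^sup>2 * real K + prob B / (\<theta> / N\<^sup>2)) / 2)"
    unfolding S_def tent_sum_def U_def using tent_deviation[OF H1 B, of "\<theta> / N\<^sup>2" c n m d K] by blast
  also have "\<dots> \<le> 4 * (\<delta> * N ^ 4 + 2) + prob B * \<bar>U\<bar> + (N * (2 * h + 1)) * (8 * (sqrt (Wm + \<delta> + 1) * N\<^sup>2))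
      + (N * (2 * h + 1)) * (N * h) * (16 * (sqrt (2 * (\<delta> + 2 / N ^ 4)) * N\<^sup>2) + (\<theta> * (Wm + \<delta> + 1) * N\<^sup>2 + prob B / \<theta> * N\<^sup>2) / 2)"
  proof (rule add_mono[OF add_mono[OF add_mono[OF mult_left_mono order_refl] mult_mono] mult_mono[OF mult_mono add_mono[OF mult_left_mono divide_right_mono[OF add_mono]]]])
    note sizes = profile_sizes[OF \<open>N \<ge> 1\<close> Wm0 \<open>\<delta> > 0\<close>, folded d_def K_def]
    show d: "real d \<le> \<delta> * N ^ 4 + 2" and "8 * sqrt (real K) \<le> 8 * (sqrt (Wm + \<delta> + 1) * N\<^sup>2)"
      using sizes(1,3) by simp_all
    have "(\<delta> + 2 / N ^ 4) * N ^ 4 = \<delta> * N ^ 4 + 2" using N by (simp add: distrib_right)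
    hence "2 * real d \<le> 2 * (\<delta> + 2 / N ^ 4) * N ^ 4" using d by (simp only: mult.assoc) simp
    hence "sqrt (2 * real d) \<le> sqrt (2 * (\<delta> + 2 / N ^ 4) * N ^ 4)" by simp
    also have "\<dots> = sqrt (2 * (\<delta> + 2 / N ^ 4)) * N\<^sup>2" unfolding real_sqrt_mult[of _ "N ^ 4"] sqrt_power4 by (rule refl)
    finally show "sqrt (2 * real d) \<le> sqrt (2 * (\<delta> + 2 / N ^ 4)) * N\<^sup>2" .
    show H2: "real_of_int (2 * H + 1) \<le> N * (2 * h + 1)" using fl \<open>N \<ge> 1\<close> by (simp add: algebra_simps)
    show "real_of_int (2 * H + 1) \<le> N * (2 * h + 1)" by (rule H2)
    show "real_of_int H \<le> N * h" by (rule fl)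
    have "\<theta> / N\<^sup>2 * real K \<le> \<theta> / N\<^sup>2 * ((Wm + \<delta> + 1) * N ^ 4)" using sizes(2) \<open>\<theta> > 0\<close> by (intro mult_left_mono) auto
    also have "\<dots> = \<theta> * (Wm + \<delta> + 1) * N\<^sup>2" using N by (simp add: N34(3) power2_eq_square)
    finally show "\<theta> / N\<^sup>2 * real K \<le> \<theta> * (Wm + \<delta> + 1) * N\<^sup>2" .
    show "prob B / (\<theta> / N\<^sup>2) \<le> prob B / \<theta> * N\<^sup>2" by simp
  qed (use Wm0 \<open>\<delta> > 0\<close> \<open>\<theta> > 0\<close> \<open>h > 0\<close> H1 N in auto)
  finally have "\<bar>S - U\<bar> / N ^ 4 \<le> (4 * (\<delta> * N ^ 4 + 2) + prob B * \<bar>U\<bar> + (N * (2 * h + 1)) * (8 * (sqrt (Wm + \<delta> + 1) * N\<^sup>2))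
      + (N * (2 * h + 1)) * (N * h) * (16 * (sqrt (2 * (\<delta> + 2 / N ^ 4)) * N\<^sup>2) + (\<theta> * (Wm + \<delta> + 1) * N\<^sup>2 + prob B / \<theta> * N\<^sup>2) / 2)) / N ^ 4"
    using N by (intro divide_right_mono) auto
  also have "\<dots> = 4 * (\<delta> + 2 / N ^ 4) + prob B * \<bar>T\<bar> + (2 * h + 1) * (8 * sqrt (Wm + \<delta> + 1)) / N
     + (2 * h + 1) * h * (16 * sqrt (2 * (\<delta> + 2 / N ^ 4)) + (\<theta> * (Wm + \<delta> + 1) + prob B / \<theta>) / 2)"
  proof -
    have UT: "U = T * N ^ 4"
      unfolding T_def U_def n[symmetric] using N by (simp add: N34(1) field_simps)
    have "4 * (\<delta> * N ^ 4 + 2) / N ^ 4 = 4 * (\<delta> + 2 / N ^ 4)" using N by (simp add: field_simps)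
    moreover have "prob B * \<bar>U\<bar> / N ^ 4 = prob B * \<bar>T\<bar>" using N by (simp add: UT abs_mult)
    moreover have "(N * (2 * h + 1)) * (8 * (sqrt (Wm + \<delta> + 1) * N\<^sup>2)) / N ^ 4 = (2 * h + 1) * (8 * sqrt (Wm + \<delta> + 1)) / N"
      using N by (simp add: N34(2))
    moreover have "(N * (2 * h + 1)) * (N * h) * (16 * (sqrt (2 * (\<delta> + 2 / N ^ 4)) * N\<^sup>2) + (\<theta> * (Wm + \<delta> + 1) * N\<^sup>2 + prob B / \<theta> * N\<^sup>2) / 2) / N ^ 4
      = (2 * h + 1) * h * (16 * sqrt (2 * (\<delta> + 2 / N ^ 4)) + (\<theta> * (Wm + \<delta> + 1) + prob B / \<theta>) / 2)"
    proof -
      have "(N * p) * (N * q) * (16 * (r * N\<^sup>2) + (s * N\<^sup>2 + t * N\<^sup>2) / 2) / N ^ 4 = p * q * (16 * r + (s + t) / 2)" for p q r s t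
      proof -
        have E: "(N * p) * (N * q) * (16 * (r * N\<^sup>2) + (s * N\<^sup>2 + t * N\<^sup>2) / 2) = p * q * (16 * r + (s + t) / 2) * N ^ 4"
          unfolding N34(2) by (simp add: algebra_simps)
        show ?thesis unfolding E by (rule nonzero_mult_div_cancel_right) (use N in simp)
      qed
      thus ?thesis .
    qed
    ultimately show ?thesis unfolding add_divide_distrib[of _ _ "N ^ 4"] by simp
  qed
  finally have "\<bar>S - U\<bar> / N ^ 4 \<le> \<dots>" .
  moreover have "\<bar>S / N ^ 4 - T\<bar> = \<bar>S - U\<bar> / N ^ 4"
  proof -
    have "T = U / N ^ 4" unfolding T_def U_def n[symmetric] using N by (simp add: N34(1) add_divide_distrib diff_divide_distrib)
    thus ?thesis using N by (simp add: abs_divide flip: diff_divide_distrib)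
  qed
  ultimately show ?thesis by (simp add: S_def)
qed

end

section \<open>Passage to the limit\<close>

theorem theorem1p4:
  fixes M :: "nat \<Rightarrow> 'a measure"
    and X Y :: "nat \<Rightarrow> int \<Rightarrow> nat \<Rightarrow> 'a \<Rightarrow> int"
    and u :: "nat \<Rightarrow> int \<Rightarrow> 'a \<Rightarrow> real"
    and u_mean :: "nat \<Rightarrow> int \<Rightarrow> real"
    and w :: "real \<Rightarrow> real"
  defines "u \<equiv> \<lambda>n. random_odometer n (X n) (Y n)"
    and "u_mean \<equiv> \<lambda>n. mean_odometer (M n) n (X n) (Y n)"
  assumes stacks: "\<And>n. n \<ge> 1 \<Longrightarrow> random_stacks (M n) (X n) (Y n)"
    and concentration: "\<And>\<delta>::real. \<delta> > 0 \<Longrightarrow>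
      (\<lambda>n. measure (M n) {\<omega> \<in> space (M n).
          (SUP x. ereal \<bar>(u n x \<omega> - u_mean n x) / real n powr (4 / 3)\<bar>) > ereal \<delta>})
        \<longlonglongrightarrow> 0"
    and scaling: "uniform_limit UNIV
      (\<lambda>n \<xi>. u_mean n \<lfloor>real n powr (1 / 3) * \<xi>\<rfloor> / real n powr (4 / 3)) w sequentially"
  shows "\<forall>x. w x =
    (if \<bar>x\<bar> < (18 * pi) powr (1 / 3)
     then 1 / (72 * pi) * ((18 * pi) powr (1 / 3) - \<bar>x\<bar>) ^ 4
     else 0)"
proof -
  define N where "N = (\<lambda>n::nat. real n powr (1 / 3))"
  have N1: "N n \<ge> 1" if "n \<ge> 1" for n using that by (simp add: N_def ge_one_powr_ge_zero)
  have N3: "N n ^ 3 = real n" for n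
    by (cases "n = 0") (simp_all add: N_def powr_powr flip: powr_realpow)
  have N4: "real n powr (4 / 3) = N n ^ 4" for n
    by (cases "n = 0") (simp_all add: N_def powr_powr flip: powr_realpow)
  have Ntop: "filterlim N at_top sequentially"
    unfolding N_def by real_asymp
  have Nn: "real n powr (1 / 3) = N n" for n by (simp add: N_def)
  note scaling = scaling[unfolded N4 Nn]
  note concentration = concentration[unfolded N4]
  have invN: "(\<lambda>n. 1 / N n) \<longlonglongrightarrow> 0"
    by (rule filterlim_compose[OF _ Ntop]) real_asymp
  have mean_lim: "(\<lambda>n. u_mean n \<lfloor>N n * \<xi>\<rfloor> / N n ^ 4) \<longlonglongrightarrow> w \<xi>" for \<xi>
    using tendsto_uniform_limitI[OF scaling] by simp
  have mean_nonneg: "u_mean n x \<ge> 0" for n x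
    unfolding u_mean_def mean_odometer_def by (intro Bochner_Integration.integral_nonneg) (simp add: random_odometer_def)
  have w_nonneg: "w \<xi> \<ge> 0" for \<xi>
    by (rule tendsto_lowerbound[OF mean_lim]) (auto intro!: always_eventually divide_nonneg_nonneg mean_nonneg simp: N_def)
  have near_mean: "\<forall>\<^sub>F n in sequentially. \<forall>y. \<bar>u_mean n y / N n ^ 4 - w (of_int y / N n)\<bar> < \<epsilon>" if "\<epsilon> > 0" for \<epsilon>
    using uniform_limitD[OF scaling that] eventually_ge_at_top[of 1]
  proof eventually_elim
    case (elim n)
    show ?case
    proof
      fix y
      \<comment> \<open>Sampling the uniform limit at \<open>y / N n\<close> makes the floor return
        \<open>y\<close> itself, so the convergence is uniform over sites.\<close>
      have "\<lfloor>N n * (of_int y / N n)\<rfloor> = y" using N1[of n] elim by simp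
      with elim(1) show "\<bar>u_mean n y / N n ^ 4 - w (of_int y / N n)\<bar> < \<epsilon>"
        by (metis UNIV_I dist_real_def)
    qed
  qed
  \<comment> \<open>Continuity of \<open>w\<close> is not yet available. The value of
    \<open>w\<close> at the rounded point and \<open>w \<xi>\<close> are instead compared with the
    same value of \<open>u_mean\<close>.\<close>
  have grid_lim: "(\<lambda>n. w (of_int \<lfloor>N n * \<xi>\<rfloor> / N n)) \<longlonglongrightarrow> w \<xi>" for \<xi>
  proof -
    have "(\<lambda>n. u_mean n \<lfloor>N n * \<xi>\<rfloor> / N n ^ 4 - w (of_int \<lfloor>N n * \<xi>\<rfloor> / N n)) \<longlonglongrightarrow> 0"
    proof (rule tendstoI)
      fix e :: real assume "e > 0"
      from near_mean[OF this]
      show "\<forall>\<^sub>F n in sequentially. dist (u_mean n \<lfloor>N n * \<xi>\<rfloor> / N n ^ 4 - w (of_int \<lfloor>N n * \<xi>\<rfloor> / N n)) 0 < e"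
        by eventually_elim simp
    qed
    from tendsto_diff[OF mean_lim[of \<xi>] this] show ?thesis by simp
  qed
  have profile_lim: "(\<lambda>n. real (profile_at w (N n) (y n)) / N n ^ 4) \<longlonglongrightarrow> l"
    if "(\<lambda>n. w (of_int (y n) / N n)) \<longlonglongrightarrow> l" for y :: "nat \<Rightarrow> int" and l
  proof -
    have "(\<lambda>n. real (profile_at w (N n) (y n)) / N n ^ 4 - w (of_int (y n) / N n)) \<longlonglongrightarrow> 0"
    proof (rule Lim_null_comparison)
      show "\<forall>\<^sub>F n in sequentially. norm (real (profile_at w (N n) (y n)) / N n ^ 4 - w (of_int (y n) / N n)) \<le> 1 / N n ^ 4"
        using eventually_ge_at_top[of 1]
      proof eventually_elim
        case (elim n)
        hence "N n > 0" using N1[of n] by simp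
        from profile_at_over[OF w_nonneg this] show ?case by simp
      qed
      show "(\<lambda>n. 1 / N n ^ 4) \<longlonglongrightarrow> 0" by (rule filterlim_compose[OF _ Ntop]) real_asymp
    qed
    from tendsto_add[OF this that] show ?thesis by simp
  qed
  have w_bdd: "\<exists>Wm. \<forall>\<xi>. \<bar>\<xi>\<bar> \<le> A \<longrightarrow> w \<xi> \<le> Wm" for A
  proof -
    \<comment> \<open>One \<open>n\<close> with uniform error below 1 is enough: on a bounded range
      only finitely many values of \<open>u_mean n\<close> occur.\<close>
    obtain n where n: "\<And>\<xi>. dist (u_mean n \<lfloor>N n * \<xi>\<rfloor> / N n ^ 4) (w \<xi>) < 1" "n \<ge> 1"
      using eventually_happens[OF eventually_conj[OF uniform_limitD[OF scaling zero_less_one] eventually_ge_at_top[of 1]]] by auto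
    define S where "S = {\<lfloor>N n * (- \<bar>A\<bar>)\<rfloor>..\<lfloor>N n * \<bar>A\<bar>\<rfloor>}"
    define Wm where "Wm = 1 + (\<Sum>y\<in>S. u_mean n y / N n ^ 4)"
    have "w \<xi> \<le> Wm" if "\<bar>\<xi>\<bar> \<le> A" for \<xi>
    proof -
      have "N n * (- \<bar>A\<bar>) \<le> N n * \<xi>" "N n * \<xi> \<le> N n * \<bar>A\<bar>"
        by (rule mult_left_mono; use that N1[OF n(2)] in linarith)+
      hence "\<lfloor>N n * \<xi>\<rfloor> \<in> S" unfolding S_def atLeastAtMost_iff by (intro conjI floor_mono)
      hence "u_mean n \<lfloor>N n * \<xi>\<rfloor> / N n ^ 4 \<le> (\<Sum>y\<in>S. u_mean n y / N n ^ 4)"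
        by (intro member_le_sum[of _ S "\<lambda>y. u_mean n y / N n ^ 4"]) (auto intro!: divide_nonneg_nonneg mean_nonneg simp: N_def S_def)
      thus ?thesis using n(1)[of \<xi>] unfolding Wm_def dist_real_def by linarith
    qed
    thus ?thesis by blast
  qed
  \<comment> \<open>Half of \<delta> is spent on concentration around the mean, the other half on
    the distance from the mean to \<open>w\<close>.\<close>
  define B where "B = (\<lambda>\<delta> n. {\<omega> \<in> space (M n). (SUP x. ereal \<bar>(u n x \<omega> - u_mean n x) / N n ^ 4\<bar>) > ereal (\<delta> / 2)})"
  define p where "p = (\<lambda>\<delta> n. measure (M n) (B \<delta> n))"
  have p_lim: "(\<lambda>n. p \<delta> n) \<longlonglongrightarrow> 0" if "\<delta> > 0" for \<delta>
    unfolding p_def B_def using concentration[of "\<delta> / 2"] that by simp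
  have pair: "random_stack_pair (M n) (X n) (Y n)" if "n \<ge> 1" for n
    using stacks[OF that] by (simp add: random_stack_pair_def)
  have B_events: "B \<delta> n \<in> sets (M n)" if "n \<ge> 1" for \<delta> n
  proof -
    interpret random_stack_pair "M n" "X n" "Y n" by (rule pair[OF that])
    have [measurable]: "u n x \<in> borel_measurable (M n)" for x
      unfolding u_def by (rule measurable_random_odometer)
    show ?thesis unfolding B_def by measurable
  qed
  have near: "\<forall>\<^sub>F n in sequentially. n \<ge> 1 \<and> (\<forall>\<omega>\<in>space (M n). \<omega> \<notin> B \<delta> n \<longrightarrow>
      (\<forall>y. \<bar>real (odometer n (stacks_at (X n) \<omega>) (stacks_at (Y n) \<omega>) y) - N n ^ 4 * w (of_int y / N n)\<bar> \<le> \<delta> * N n ^ 4))"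
    if "\<delta> > 0" for \<delta>
    using near_mean[OF half_gt_zero[OF that]] eventually_ge_at_top[of 1]
  proof eventually_elim
    case (elim n)
    have N0: "N n ^ 4 > 0" using N1[of n] elim by simp
    have "\<bar>u n y \<omega> - N n ^ 4 * w (of_int y / N n)\<bar> \<le> \<delta> * N n ^ 4" if "\<omega> \<in> space (M n)" "\<omega> \<notin> B \<delta> n" for \<omega> y
    proof -
      have "ereal \<bar>(u n y \<omega> - u_mean n y) / N n ^ 4\<bar> \<le> (SUP x. ereal \<bar>(u n x \<omega> - u_mean n x) / N n ^ 4\<bar>)"
        by (rule SUP_upper) simp
      also have "\<dots> \<le> ereal (\<delta> / 2)" using that by (auto simp: B_def not_less)
      finally have 1: "\<bar>u n y \<omega> / N n ^ 4 - u_mean n y / N n ^ 4\<bar> \<le> \<delta> / 2" by (simp add: diff_divide_distrib)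
      have 2: "\<bar>u_mean n y / N n ^ 4 - w (of_int y / N n)\<bar> < \<delta> / 2" using elim(1) by blast
      have "\<bar>a - c\<bar> \<le> \<delta>" if "\<bar>a - b\<bar> \<le> \<delta> / 2" "\<bar>b - c\<bar> < \<delta> / 2" for a b c using that by linarith
      from this[OF 1 2] have "\<bar>u n y \<omega> / N n ^ 4 - w (of_int y / N n)\<bar> * N n ^ 4 \<le> \<delta> * N n ^ 4"
        using N0 by (intro mult_right_mono) auto
      also have "\<bar>u n y \<omega> / N n ^ 4 - w (of_int y / N n)\<bar> * N n ^ 4 = \<bar>(u n y \<omega> / N n ^ 4 - w (of_int y / N n)) * N n ^ 4\<bar>"
        using N0 by (simp add: abs_mult)
      also have "(u n y \<omega> / N n ^ 4 - w (of_int y / N n)) * N n ^ 4 = u n y \<omega> - N n ^ 4 * w (of_int y / N n)"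
        unfolding left_diff_distrib using N0 by (simp add: mult.commute)
      finally show ?thesis .
    qed
    with elim(2) show ?case by (simp add: u_def random_odometer_def)
  qed
  have lip_lt: "\<bar>w \<alpha> - w \<beta>\<bar> \<le> 2 * (\<beta> - \<alpha>)" if "\<alpha> < \<beta>" for \<alpha> \<beta>
  proof -
    obtain Wm where Wm: "\<And>\<xi>. \<bar>\<xi>\<bar> \<le> \<bar>\<alpha>\<bar> + \<bar>\<beta>\<bar> + 1 \<Longrightarrow> w \<xi> \<le> Wm" using w_bdd by metis
    \<comment> \<open>First \<open>n\<close> tends to infinity with \<delta> fixed, so that
      \<open>p \<delta> n\<close> vanishes; \<delta> is removed afterwards.\<close>
    have "\<bar>w \<alpha> - w \<beta>\<bar> \<le> 2 * (\<beta> - \<alpha>) + 2 * \<delta>" if d: "\<delta> > 0" for \<delta>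
    proof -
      let ?l = "\<lambda>n. (1 - p \<delta> n) * \<bar>real (profile_at w (N n) \<lfloor>N n * \<alpha>\<rfloor>) / N n ^ 4 - real (profile_at w (N n) \<lfloor>N n * \<beta>\<rfloor>) / N n ^ 4\<bar>"
      let ?r = "\<lambda>N. 2 * (\<beta> - \<alpha> + 1 / N) + 2 * (\<delta> + 2 / N ^ 4) + 8 * sqrt (Wm + \<delta> + 1) * (\<beta> - \<alpha> + 2) / N"
      have "?l \<longlonglongrightarrow> (1 - 0) * \<bar>w \<alpha> - w \<beta>\<bar>"
        by (intro tendsto_intros p_lim d profile_lim grid_lim)
      moreover have "(\<lambda>n. ?r (N n)) \<longlonglongrightarrow> 2 * (\<beta> - \<alpha>) + 2 * \<delta>"
        by (rule filterlim_compose[OF _ Ntop]) real_asymp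
      moreover have "\<forall>\<^sub>F n in sequentially. ?l n \<le> ?r (N n)"
      proof -
        have "filterlim (\<lambda>n. N n * (\<beta> - \<alpha>)) at_top sequentially"
          using Ntop \<open>\<alpha> < \<beta>\<close> by (intro filterlim_at_top_mult_tendsto_pos[OF tendsto_const]) auto
        hence "\<forall>\<^sub>F n in sequentially. N n * (\<beta> - \<alpha>) \<ge> 2" by (simp add: filterlim_at_top)
        with near[OF d] show ?thesis
        proof eventually_elim
          case (elim n)
          hence n: "n \<ge> 1" by simp
          interpret random_stack_pair "M n" "X n" "Y n" by (rule pair[OF n])
          have "\<lfloor>N n * \<alpha>\<rfloor> < \<lfloor>N n * \<beta>\<rfloor>" using elim(2) unfolding right_diff_distrib by linarith
          moreover have "AE \<omega> in M n. \<omega> \<notin> B \<delta> n \<longrightarrow> (\<forall>y. \<bar>real (odo n y \<omega>) - N n ^ 4 * w (of_int y / N n)\<bar> \<le> \<delta> * N n ^ 4)"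
            using elim(1) by (intro AE_I2) blast
          ultimately show ?case unfolding p_def
            by (intro ramp_scaled[OF N1[OF n] N3 w_nonneg d Wm _ B_events[OF n]])
        qed
      qed
      ultimately show ?thesis by (intro tendsto_le[OF sequentially_bot]) auto
    qed
    hence "\<bar>w \<alpha> - w \<beta>\<bar> \<le> 2 * (\<beta> - \<alpha>) + e" if "e > 0" for e
      using that by (metis field_sum_of_halves half_gt_zero mult_2)
    thus ?thesis by (rule field_le_epsilon)
  qed
  have lip: "\<bar>w x - w y\<bar> \<le> 2 * \<bar>x - y\<bar>" for x y
    using lip_lt[of x y] lip_lt[of y x] by (cases x y rule: linorder_cases) (auto simp: abs_minus_commute)
  interpret lipschitz_profile w by unfold_locales (rule w_nonneg lip)+
  have w_lim: "(\<lambda>n. w (s n)) \<longlonglongrightarrow> w l" if "s \<longlonglongrightarrow> l" for s l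
    using continuous_on_tendsto_compose[OF continuous_w[of UNIV] that] by simp
  have floor_lim: "(\<lambda>n. of_int \<lfloor>N n * \<xi>\<rfloor> / N n) \<longlonglongrightarrow> \<xi>" for \<xi>
  proof -
    have "(\<lambda>n. of_int \<lfloor>N n * \<xi>\<rfloor> / N n - \<xi>) \<longlonglongrightarrow> 0"
    proof (rule Lim_null_comparison[OF _ invN])
      show "\<forall>\<^sub>F n in sequentially. norm (of_int \<lfloor>N n * \<xi>\<rfloor> / N n - \<xi>) \<le> 1 / N n"
        using eventually_ge_at_top[of 1]
      proof eventually_elim
        case (elim n)
        have N0: "N n > 0" using N1[of n] elim by simp
        have "of_int \<lfloor>N n * \<xi>\<rfloor> / N n - \<xi> = (of_int \<lfloor>N n * \<xi>\<rfloor> - N n * \<xi>) / N n" using N0 by (simp add: diff_divide_distrib)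
        moreover have "\<bar>of_int \<lfloor>N n * \<xi>\<rfloor> - N n * \<xi>\<bar> \<le> 1" by linarith
        ultimately show ?case using N0 by (simp add: abs_divide divide_right_mono)
      qed
    qed
    from tendsto_add[OF this tendsto_const[of \<xi>]] show ?thesis by simp
  qed
  have weak: "w (z + h) + w (z - h) - 2 * w z + 2 * max 0 (h - \<bar>z\<bar>)
       = integral {z - h..z + h} (\<lambda>y. (h - \<bar>y - z\<bar>) * sqrt (2 * w y / pi))" if "h > 0" for z h
  proof -
    define c where "c = (\<lambda>n. \<lfloor>N n * z\<rfloor>)"
    define H where "H = (\<lambda>n. \<lfloor>N n * h\<rfloor>)"
    define m where "m = (\<lambda>n. profile_at w (N n))"
    define T where "T = (\<lambda>n. 2 * (real_of_int (tent (c n) (H n) 0) / N n) + real (m n (c n + H n)) / N n ^ 4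
        + real (m n (c n - H n)) / N n ^ 4 - 2 * (real (m n (c n)) / N n ^ 4))"
    define S where "S = (\<lambda>n. tent_sum (m n) (c n) (H n) / N n ^ 4)"
    define I where "I = integral {z - h..z + h} (\<lambda>y. (h - \<bar>y - z\<bar>) * sqrt (2 * w y / pi))"
    define L where "L = 2 * max 0 (h - \<bar>z\<bar>) + w (z + h) + w (z - h) - 2 * w z"
    obtain Wm where Wm: "\<And>\<xi>. \<bar>\<xi>\<bar> \<le> \<bar>z\<bar> + h + 3 \<Longrightarrow> w \<xi> \<le> Wm" using w_bdd by metis
    have S_lim: "S \<longlonglongrightarrow> I"
      unfolding S_def I_def m_def c_def H_def
      by (rule filterlim_compose[OF tent_sum_tendsto[OF \<open>h > 0\<close>] Ntop])
    have T_lim: "T \<longlonglongrightarrow> L"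
    proof -
      have "(\<lambda>n. real_of_int (tent (c n) (H n) 0) / N n) = (\<lambda>n. max 0 (of_int (H n) / N n - \<bar>of_int (c n) / N n\<bar>))"
      proof
        fix n
        have "N n \<ge> 0" by (simp add: N_def)
        have "real_of_int (tent (c n) (H n) 0) = max 0 (of_int (H n) - \<bar>of_int (c n)\<bar>)" unfolding tent_def of_int_max by simp
        also have "\<dots> / N n = max (0 / N n) ((of_int (H n) - \<bar>of_int (c n)\<bar>) / N n)"
          using \<open>N n \<ge> 0\<close> by (simp add: max_divide_distrib_right)
        finally show "real_of_int (tent (c n) (H n) 0) / N n = max 0 (of_int (H n) / N n - \<bar>of_int (c n) / N n\<bar>)"
          using \<open>N n \<ge> 0\<close> by (simp add: diff_divide_distrib)
      qed
      moreover have "(\<lambda>n. max 0 (of_int (H n) / N n - \<bar>of_int (c n) / N n\<bar>)) \<longlonglongrightarrow> max 0 (h - \<bar>z\<bar>)"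
        unfolding c_def H_def by (intro tendsto_intros floor_lim)
      moreover have "(\<lambda>n. real (m n (c n + H n)) / N n ^ 4) \<longlonglongrightarrow> w (z + h)" unfolding m_def
        by (intro profile_lim w_lim) (unfold of_int_add add_divide_distrib c_def H_def, intro tendsto_intros floor_lim)
      moreover have "(\<lambda>n. real (m n (c n - H n)) / N n ^ 4) \<longlonglongrightarrow> w (z - h)" unfolding m_def
        by (intro profile_lim w_lim) (unfold of_int_diff diff_divide_distrib c_def H_def, intro tendsto_intros floor_lim)
      moreover have "(\<lambda>n. real (m n (c n)) / N n ^ 4) \<longlonglongrightarrow> w z" unfolding m_def c_def
        by (intro profile_lim w_lim floor_lim)
      ultimately show ?thesis unfolding T_def L_def by (intro tendsto_diff tendsto_add tendsto_mult tendsto_const) simp_all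
    qed
    \<comment> \<open>The limit in \<open>n\<close> of the bound in \<open>tent_scaled\<close> with
      \<open>\<theta> = \<delta>\<close>; the term \<open>p \<delta> n / \<delta>\<close> disappears
      because \<delta> is fixed in that limit. As \<open>r 0 = 0\<close> and \<open>r\<close> is
      right-continuous at 0, \<open>I = L\<close> follows.\<close>
    define r where "r = (\<lambda>\<delta>::real. 4 * \<delta> + (2 * h + 1) * h * (16 * sqrt (2 * \<delta>) + (\<delta> * (Wm + \<delta> + 1)) / 2))"
    have bound: "\<bar>I - L\<bar> \<le> r \<delta>" if d: "\<delta> > 0" for \<delta>
    proof -
      let ?r = "\<lambda>n. 4 * (\<delta> + 2 / N n ^ 4) + p \<delta> n * \<bar>T n\<bar> + (2 * h + 1) * (8 * sqrt (Wm + \<delta> + 1)) / N n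
        + (2 * h + 1) * h * (16 * sqrt (2 * (\<delta> + 2 / N n ^ 4)) + (\<delta> * (Wm + \<delta> + 1) + p \<delta> n / \<delta>) / 2)"
      have "(\<lambda>n. \<bar>S n - T n\<bar>) \<longlonglongrightarrow> \<bar>I - L\<bar>" by (intro tendsto_intros S_lim T_lim)
      moreover have "?r \<longlonglongrightarrow> 4 * (\<delta> + 0) + 0 * \<bar>L\<bar> + 0 + (2 * h + 1) * h * (16 * sqrt (2 * (\<delta> + 0)) + (\<delta> * (Wm + \<delta> + 1) + 0 / \<delta>) / 2)"
      proof (intro tendsto_add tendsto_mult tendsto_divide tendsto_const tendsto_rabs tendsto_real_sqrt p_lim d T_lim)
        show "(\<lambda>n. 2 / N n ^ 4) \<longlonglongrightarrow> 0" "(\<lambda>n. 2 / N n ^ 4) \<longlonglongrightarrow> 0"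
          by (rule filterlim_compose[OF _ Ntop], real_asymp)+
        show "(\<lambda>n. (2 * h + 1) * (8 * sqrt (Wm + \<delta> + 1)) / N n) \<longlonglongrightarrow> 0"
          by (rule filterlim_compose[OF _ Ntop], real_asymp)
      qed (use d in auto)
      moreover have "\<forall>\<^sub>F n in sequentially. \<bar>S n - T n\<bar> \<le> ?r n"
      proof -
        have "filterlim (\<lambda>n. N n * h) at_top sequentially"
          using Ntop \<open>h > 0\<close> by (intro filterlim_at_top_mult_tendsto_pos[OF tendsto_const]) auto
        hence "\<forall>\<^sub>F n in sequentially. N n * h \<ge> 1" by (simp add: filterlim_at_top)
        with near[OF d] show ?thesis
        proof eventually_elim
          case (elim n)
          hence n: "n \<ge> 1" by simp
          interpret random_stack_pair "M n" "X n" "Y n" by (rule pair[OF n])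
          have "\<lfloor>N n * h\<rfloor> \<ge> 1" using elim(2) by linarith
          moreover have "AE \<omega> in M n. \<omega> \<notin> B \<delta> n \<longrightarrow> (\<forall>y. \<bar>real (odo n y \<omega>) - N n ^ 4 * w (of_int y / N n)\<bar> \<le> \<delta> * N n ^ 4)"
            using elim(1) by (intro AE_I2) blast
          ultimately show ?case unfolding p_def S_def T_def m_def c_def H_def
            by (intro tent_scaled[OF N1[OF n] N3 w_nonneg d d \<open>h > 0\<close> Wm _ B_events[OF n]])
        qed
      qed
      ultimately have "\<bar>I - L\<bar> \<le> 4 * (\<delta> + 0) + 0 * \<bar>L\<bar> + 0 + (2 * h + 1) * h * (16 * sqrt (2 * (\<delta> + 0)) + (\<delta> * (Wm + \<delta> + 1) + 0 / \<delta>) / 2)"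
        by (intro tendsto_le[OF sequentially_bot])
      thus ?thesis by (simp add: r_def)
    qed
    have "(r \<longlongrightarrow> r 0) (at_right 0)" unfolding r_def by (intro tendsto_intros) simp_all
    hence "\<bar>I - L\<bar> \<le> r 0"
      by (rule tendsto_lowerbound) (auto simp: eventually_at_right_field intro!: exI[of _ 1] bound)
    thus ?thesis by (simp add: r_def I_def L_def algebra_simps)
  qed
  show ?thesis using profile_unique[OF w_nonneg lip weak] by blast
qed

end
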